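(* Let $\alpha\in(0,1)$. Suppose that $u$ is a unique solution of $$\partial_t^\alpha u(t)+f(u(t))=g(t)\quad\text{for }t\in(0,T],\qquad u(0)=u_0,$$ and that, for some $\sigma\in(0,1)\cup(1,2)$ and some constant $C_u$, it satisfies $\bigl|\frac{d^l}{dt^l}u(t)\bigr|\le C_u(1+t^{\sigma-l})$ for $l=0,1,2$ and $t\in(0,T]$. Consider the numerical scheme $$\delta_t^\alpha U^m+F(U^m,U^{m-1})=g(t_m)\quad\text{for }m=1,\dots,M,\qquad U^0=u_0,$$ where $F$ satisfies condition A1 with $q=2$ and condition A2 with some constants $\lambda_0,\lambda_1\ge0$. Additionally, suppose that the temporal meshes are quasi-graded with some $r\ge1$ and that $\lambda_0\tau_j^\alpha<\{\Gamma(2-\alpha)\}^{-1}$ for all $j\ge1$. Then there exists a unique solution $\{U^m\}$ of the numerical scheme, and there is a constant $C$, independent of $M$ and $m$, such that for all $m\ge1$ $$|u(t_m)-U^m|\le C\,\mathcal E^m,\qquad \mathcal E^m:=\begin{cases}M^{-\nu r}\,t_m^{\alpha-1}&\text{if }1\le r<\frac{2-\alpha}{\nu},\\[2pt] M^{-(2-\alpha)}\,t_m^{\alpha-1}\,[1+\ln(t_m/t_1)]&\text{if }r=\frac{2-\alpha}{\nu}\ge1,\\[2pt] M^{-(2-\alpha)}\,t_m^{\sigma-\frac{2-\alpha}{r}}&\text{if }r>\frac{2-\alpha}{\nu},\end{cases}\qquad \nu:=1+\sigma-\alpha.$$ If $u$ is a unique solution of $\partial_t^\alpha u(t)+f(u(t))=g(t)$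 for $t\in(0,T]$, $u(0)=u_0$, satisfying $\bigl|\frac{d^l}{dt^l}u(t)\bigr|\le C_u(1+t^{\sigma-l})$ for $l=0,1,2$ and $t\in(0,T]$ with some $\sigma\in(0,1)\cup(1,2)$, the temporal meshes are quasi-graded with some $r\ge1$ and satisfy $\lambda_0\tau_j^\alpha<\{\Gamma(2-\alpha)\}^{-1}$ for all $j\ge1$, and $F$ satisfies condition A2 with some constants $\lambda_0,\lambda_1\ge0$ and condition A1 with $q=1$ instead of $q=2$, then there exists a unique solution $\{U^m\}$ of the numerical scheme $\delta_t^\alpha U^m+F(U^m,U^{m-1})=g(t_m)$ for $m=1,\dots,M$, $U^0=u_0$, and there is a constant $C$, independent of $M$ and $m$, such that for all $m\ge1$ $$|u(t_m)-U^m|\le C\,\widetilde{\mathcal E}^m,\qquad \widetilde{\mathcal E}^m:=\mathcal E^m+M^{-1}\,t_m^{\min\{\sigma,1\}+\alpha-1/r}.$$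
   Context: Fix $T>0$, $u_0\in\mathbb{R}$ and real-valued functions $f,g$. The solution $u$ is continuous on $[0,T]$ and twice continuously differentiable on $(0,T]$; its range is $\mathcal R_u:=\{u(t):t\in[0,T]\}$. The Caputo derivative is $\partial_t^\alpha u(t):=\frac1{\Gamma(1-\alpha)}\int_0^t(t-s)^{-\alpha}u'(s)\,ds$. A temporal mesh is $0=t_0<t_1<\dots<t_M=T$, with $\tau_j:=t_j-t_{j-1}$ and $\tau:=t_1$; one such mesh is considered for each $M$. The meshes are quasi-graded with grading parameter $r\ge1$ if there are positive constants $c_1,c_2,c_3$, independent of $M$ and $j$, such that $c_1M^{-r}\le\tau\le c_2M^{-r}$ and $\tau_j\le c_3\,\tau^{1/r}t_j^{1-1/r}$ for all $j=1,\dots,M$. The L1 operator is $\delta_t^\alpha U^m:=\frac1{\Gamma(1-\alpha)}\sum_{j=1}^m\frac{U^j-U^{j-1}}{t_j-t_{j-1}}\int_{t_{j-1}}^{t_j}(t_m-s)^{-\alpha}\,ds$. Condition A1 (consistency), with parameter $q\ge1$: for some fixed positive constant $L$, $|F(v,w)-f(v)|\le L|v-w|^q$ for all $v,w\in\mathcal R_u$. Condition A2 (one-sided Lipschitz condition), with constants $\lambda_0,\lambda_1\ge0$: $F$ is continuous in $\mathbb{R}^2$; $F(v+\nu,w)-F(v,w)\ge-\lambda_0\nu$ for all $v,w\in\mathbb{R}$, $\nu\ge0$; and $|F(v,w+\omega)-F(v,w)|\le\lambda_1|\omega|$ for all $v,w\in\mathcal R_u$, $\omega\in\mathbb{R}$.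 Constants $C$ may depend on the data $T,\alpha,\sigma,\lambda_0,\lambda_1,L,u$ and on the family of meshes, but not on $M$ or $m$. *)

theory Defs
  imports "HOL-Analysis.Analysis"
begin

text \<open>
  Derivative with respect to time on \<open>[0,T]\<close>: two-sided in the interior, one-sided at \<open>t = T\<close>.
  The value at \<open>t = 0\<close>, where the solutions need not be differentiable, is never relevant.
\<close>
definition time_deriv :: "real \<Rightarrow> (real \<Rightarrow> real) \<Rightarrow> real \<Rightarrow> real" where
  "time_deriv T v = (\<lambda>t. vector_derivative v (at t within {0..T}))"

definition twice_cont_diff :: "real \<Rightarrow> (real \<Rightarrow> real) \<Rightarrow> bool" where
  "twice_cont_diff T v \<longleftrightarrow>
     (\<forall>l<2. \<forall>t\<in>{0<..T}. (time_deriv T ^^ l) v differentiable (at t within {0..T})) \<and>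
     continuous_on {0<..T} ((time_deriv T ^^ 2) v)"

definition caputo :: "real \<Rightarrow> real \<Rightarrow> (real \<Rightarrow> real) \<Rightarrow> real \<Rightarrow> real" where
  "caputo \<alpha> T v t =
     1 / Gamma (1 - \<alpha>) * (LBINT s:{0..t}. (t - s) powr (- \<alpha>) * time_deriv T v s)"

text \<open>
  The integrability clause states that the Caputo derivative exists; it is needed because
  the library integral of a non-integrable function is 0.
\<close>
definition ivp_solution ::
    "real \<Rightarrow> real \<Rightarrow> (real \<Rightarrow> real) \<Rightarrow> (real \<Rightarrow> real) \<Rightarrow> real \<Rightarrow> (real \<Rightarrow> real) \<Rightarrow> bool" where
  "ivp_solution \<alpha> T f g u0 v \<longleftrightarrow>
     continuous_on {0..T} v \<and> twice_cont_diff T v \<and> v 0 = u0 \<and>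
     (\<forall>t\<in>{0<..T}.
        set_integrable lborel {0..t} (\<lambda>s. (t - s) powr (- \<alpha>) * time_deriv T v s) \<and>
        caputo \<alpha> T v t + f (v t) = g t)"

definition unique_ivp_solution ::
    "real \<Rightarrow> real \<Rightarrow> (real \<Rightarrow> real) \<Rightarrow> (real \<Rightarrow> real) \<Rightarrow> real \<Rightarrow> (real \<Rightarrow> real) \<Rightarrow> bool" where
  "unique_ivp_solution \<alpha> T f g u0 u \<longleftrightarrow>
     ivp_solution \<alpha> T f g u0 u \<and>
     (\<forall>v. ivp_solution \<alpha> T f g u0 v \<longrightarrow> (\<forall>t\<in>{0..T}. v t = u t))"

definition temporal_mesh :: "real \<Rightarrow> nat \<Rightarrow> (nat \<Rightarrow> real) \<Rightarrow> bool" where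
  "temporal_mesh T M t \<longleftrightarrow> t 0 = 0 \<and> t M = T \<and> (\<forall>j\<in>{1..M}. t (j - 1) < t j)"

text \<open>A family of meshes is a function \<open>t\<close>, where \<open>t M j\<close> is the \<open>j\<close>-th node of the mesh with \<open>M\<close> steps.\<close>
definition quasi_graded :: "real \<Rightarrow> (nat \<Rightarrow> nat \<Rightarrow> real) \<Rightarrow> bool" where
  "quasi_graded r t \<longleftrightarrow>
     (\<exists>c1>0. \<exists>c2>0. \<exists>c3>0. \<forall>M\<ge>1.
        c1 * real M powr (- r) \<le> t M 1 \<and> t M 1 \<le> c2 * real M powr (- r) \<and>
        (\<forall>j\<in>{1..M}. t M j - t M (j - 1) \<le> c3 * t M 1 powr (1 / r) * t M j powr (1 - 1 / r)))"

definition L1_op :: "real \<Rightarrow> (nat \<Rightarrow> real) \<Rightarrow> (nat \<Rightarrow> real) \<Rightarrow> nat \<Rightarrow> real" where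
  "L1_op \<alpha> t U m =
     1 / Gamma (1 - \<alpha>) *
     (\<Sum>j=1..m. (U j - U (j - 1)) / (t j - t (j - 1)) *
        (LBINT s:{t (j - 1)..t j}. (t m - s) powr (- \<alpha>)))"

definition L1_scheme ::
    "real \<Rightarrow> nat \<Rightarrow> (nat \<Rightarrow> real) \<Rightarrow> (real \<Rightarrow> real \<Rightarrow> real) \<Rightarrow> (real \<Rightarrow> real) \<Rightarrow> real \<Rightarrow>
     (nat \<Rightarrow> real) \<Rightarrow> bool" where
  "L1_scheme \<alpha> M t F g u0 U \<longleftrightarrow>
     U 0 = u0 \<and> (\<forall>m\<in>{1..M}. L1_op \<alpha> t U m + F (U m) (U (m - 1)) = g (t m))"

definition consistent ::
    "real set \<Rightarrow> real \<Rightarrow> real \<Rightarrow> (real \<Rightarrow> real) \<Rightarrow> (real \<Rightarrow> real \<Rightarrow> real) \<Rightarrow> bool" where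
  "consistent R q L f F \<longleftrightarrow>
     (\<forall>v\<in>R. \<forall>w\<in>R. \<bar>F v w - f v\<bar> \<le> L * \<bar>v - w\<bar> powr q)"

definition one_sided_Lipschitz ::
    "real set \<Rightarrow> real \<Rightarrow> real \<Rightarrow> (real \<Rightarrow> real \<Rightarrow> real) \<Rightarrow> bool" where
  "one_sided_Lipschitz R lam0 lam1 F \<longleftrightarrow>
     continuous_on UNIV (\<lambda>(v, w). F v w) \<and>
     (\<forall>v w. \<forall>\<nu>\<ge>0. F (v + \<nu>) w - F v w \<ge> - lam0 * \<nu>) \<and>
     (\<forall>v\<in>R. \<forall>w\<in>R. \<forall>\<omega>. \<bar>F v (w + \<omega>) - F v w\<bar> \<le> lam1 * \<bar>\<omega>\<bar>)"

definition err_bound :: "real \<Rightarrow> real \<Rightarrow> real \<Rightarrow> nat \<Rightarrow> (nat \<Rightarrow> real) \<Rightarrow> nat \<Rightarrow> real" where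
  "err_bound \<alpha> \<sigma> r M t m =
     (let \<nu> = 1 + \<sigma> - \<alpha> in
      if r < (2 - \<alpha>) / \<nu> then real M powr (- \<nu> * r) * t m powr (\<alpha> - 1)
      else if r = (2 - \<alpha>) / \<nu> then
        real M powr (- (2 - \<alpha>)) * t m powr (\<alpha> - 1) * (1 + ln (t m / t 1))
      else real M powr (- (2 - \<alpha>)) * t m powr (\<sigma> - (2 - \<alpha>) / r))"

definition err_bound_q1 :: "real \<Rightarrow> real \<Rightarrow> real \<Rightarrow> nat \<Rightarrow> (nat \<Rightarrow> real) \<Rightarrow> nat \<Rightarrow> real" where
  "err_bound_q1 \<alpha> \<sigma> r M t m =
     err_bound \<alpha> \<sigma> r M t m + real M powr (- 1) * t m powr (min \<sigma> 1 + \<alpha> - 1 / r)"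

end

theory Submission imports Defs begin

text \<open>
  The L1 operator is \<open>\<Sum>j<m. a m j * (U m - U j)\<close> with nonnegative weights, so the error is dominated
  by any supersolution of \<open>L1 W m - lam0 * W m - lam1 * W (m - 1) \<ge> R m\<close>, where \<open>R m\<close> bounds the truncation
  and consistency errors. Supersolutions are sought as \<open>\<Phi> V\<close>, where \<open>V s = s powr (\<alpha> - 1)\<close>, made linear
  on an initial interval of length comparable to \<open>t 1\<close>, is annihilated by the Riemann--Liouville
  derivative up to terms of good sign and up to an interpolation error. For nondecreasing \<open>\<Phi>\<close> one has
  \<open>L1 (\<Phi> V) m = \<Phi> m * L1 V m + (\<Sum>j<m. a m j * (\<Phi> m - \<Phi> j) * V j)\<close>, and the last sum is at least of order
  \<open>(\<Phi> (t m) - \<Phi> (t m / 2)) / t m\<close>. The three regimes of the error bound come from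
  \<open>\<Phi> s = 2 - (P / (2 * s)) powr \<gamma>\<close>, \<open>\<Phi> s = 1 + ln (2 * s / P)\<close> and \<open>\<Phi> s = s powr b\<close>. An additional
  factor \<open>exp (\<mu> * s) * (1 + s powr (\<alpha> / 2))\<close> absorbs the zeroth-order terms. These barriers need \<open>t 1\<close> to be
  small, which excludes finitely many meshes only.
\<close>

section \<open>The L1 operator and its comparison principle\<close>

text \<open>The obstacle is a source concentrated near time zero, such as
  \<open>(t 1 / s) powr \<gamma> / s\<close>. The response to it behaves like
  \<open>s powr (\<alpha> - 1)\<close>, the fractional integral of a point mass, and the barrier has
  to reproduce this decay. On the mesh the derivative of that function is nonnegative only up to a
  defect \<open>C * (t 1 / s) powr \<eta> / s\<close>. Since \<open>P\<close> is at least
  \<open>K * t 1\<close>, a large \<open>K\<close> makes the defect at most half of the gain. The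
  node \<open>P\<close> is chosen first, and \<open>\<Phi>\<close> may depend on it. The factor
  \<open>exp (\<mu> * s)\<close> yields a gain of relative size \<open>\<mu> powr \<alpha>\<close>,
  but only where a time window of length \<open>1 / \<mu>\<close> fits well behind \<open>s\<close>.
  Closer to zero the gain \<open>s powr (\<alpha> / 2) / s\<close> of the other factor takes over,
  since it dominates \<open>s powr (\<alpha> - 1)\<close> there.\<close>

lemma kernel_has_integral:
  fixes \<alpha> a b x :: real
  assumes "0 < \<alpha>" "\<alpha> < 1" "a \<le> b" "b \<le> x"
  shows "((\<lambda>s. (x - s) powr (- \<alpha>)) has_integral
           ((x - a) powr (1 - \<alpha>) - (x - b) powr (1 - \<alpha>)) / (1 - \<alpha>)) {a..b}"
proof -
  define F where "F = (\<lambda>s. - ((x - s) powr (1 - \<alpha>)) / (1 - \<alpha>))"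
  have "((\<lambda>s. (x - s) powr (- \<alpha>)) has_integral (F b - F a)) {a..b}"
  proof (rule fundamental_theorem_of_calculus_interior[OF assms(3)])
    show "continuous_on {a..b} F"
      unfolding F_def using assms
      by (intro continuous_on_divide continuous_on_minus continuous_on_powr' continuous_intros) auto
    fix s assume "s \<in> {a<..<b}"
    then have "x - s > 0" using assms by auto
    then have "(F has_real_derivative (x - s) powr (- \<alpha>)) (at s)"
      unfolding F_def using assms
      by (auto intro!: derivative_eq_intros DERIV_chain2[OF has_real_derivative_powr])
    then show "(F has_vector_derivative (x - s) powr (- \<alpha>)) (at s)"
      by (simp add: has_real_derivative_iff_has_vector_derivative)
  qed
  moreover have "F b - F a = ((x - a) powr (1 - \<alpha>) - (x - b) powr (1 - \<alpha>)) / (1 - \<alpha>)"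
    unfolding F_def using assms by (simp add: diff_divide_distrib)
  ultimately show ?thesis by simp
qed

lemma kernel_set_integral:
  fixes \<alpha> a b x :: real
  assumes "0 < \<alpha>" "\<alpha> < 1" "a \<le> b" "b \<le> x"
  shows "(LBINT s:{a..b}. (x - s) powr (- \<alpha>)) =
           ((x - a) powr (1 - \<alpha>) - (x - b) powr (1 - \<alpha>)) / (1 - \<alpha>)"
proof -
  note hi = kernel_has_integral[OF assms]
  have "(\<lambda>s. (x - s) powr (- \<alpha>)) absolutely_integrable_on {a..b}"
    using hi by (intro nonnegative_absolutely_integrable_1) (auto simp: has_integral_integrable)
  then have "set_integrable lborel {a..b} (\<lambda>s. (x - s) powr (- \<alpha>))"
    unfolding set_integrable_def by (subst (asm) integrable_completion) auto
  from set_borel_integral_eq_integral(2)[OF this] show ?thesis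
    using hi by (simp add: integral_unique)
qed

text \<open>Mean of \<open>s \<mapsto> (t m - s) powr (- \<alpha>)\<close> over the \<open>j\<close>-th mesh interval.\<close>
definition avg_kernel :: "real \<Rightarrow> (nat \<Rightarrow> real) \<Rightarrow> nat \<Rightarrow> nat \<Rightarrow> real" where
  "avg_kernel \<alpha> t m j =
     ((t m - t (j - 1)) powr (1 - \<alpha>) - (t m - t j) powr (1 - \<alpha>)) / ((1 - \<alpha>) * (t j - t (j - 1)))"

definition L1_weight :: "real \<Rightarrow> (nat \<Rightarrow> real) \<Rightarrow> nat \<Rightarrow> nat \<Rightarrow> real" where
  "L1_weight \<alpha> t m j =
     (avg_kernel \<alpha> t m (Suc j) - (if j = 0 then 0 else avg_kernel \<alpha> t m j)) / Gamma (1 - \<alpha>)"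

lemma mesh_mono:
  assumes "temporal_mesh T M t" "i \<le> j" "j \<le> M"
  shows "t i \<le> t j"
  using assms(2,3)
proof (induction j rule: dec_induct)
  case base then show ?case by simp
next
  case (step n)
  have "Suc n \<in> {1..M}" using step assms(3) by auto
  then have "t (Suc n - 1) < t (Suc n)" using assms(1) unfolding temporal_mesh_def by blast
  then show ?case using step by simp
qed

lemma mesh_step:
  assumes "temporal_mesh T M t" "j \<in> {1..M}"
  shows "t (j - 1) < t j"
  using assms by (auto simp: temporal_mesh_def)

lemma mesh_strict_mono:
  assumes "temporal_mesh T M t" "i < j" "j \<le> M"
  shows "t i < t j"
  using mesh_mono[OF assms(1), of i "j - 1"] mesh_step[OF assms(1), of j] assms by fastforce

lemma mesh_0 [simp]: "temporal_mesh T M t \<Longrightarrow> t 0 = 0"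
  by (simp add: temporal_mesh_def)

lemma mesh_pos: "temporal_mesh T M t \<Longrightarrow> 0 < m \<Longrightarrow> m \<le> M \<Longrightarrow> 0 < t m"
  using mesh_strict_mono[of T M t 0 m] by simp

lemma mesh_nonneg: "temporal_mesh T M t \<Longrightarrow> m \<le> M \<Longrightarrow> 0 \<le> t m"
  using mesh_mono[of T M t 0 m] by simp

lemma mesh_le_T: "temporal_mesh T M t \<Longrightarrow> m \<le> M \<Longrightarrow> t m \<le> T"
  using mesh_mono[of T M t m M] by (simp add: temporal_mesh_def)

lemma L1_op_eq:
  assumes "0 < \<alpha>" "\<alpha> < 1" "temporal_mesh T M t" "m \<le> M"
  shows "L1_op \<alpha> t U m =
           1 / Gamma (1 - \<alpha>) * (\<Sum>j=1..m. (U j - U (j - 1)) * avg_kernel \<alpha> t m j)"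
  unfolding L1_op_def
proof (intro arg_cong[where f = "\<lambda>x. _ * x"] sum.cong refl)
  fix j assume j: "j \<in> {1..m}"
  then have "t (j - 1) < t j" "t j \<le> t m"
    using mesh_step[OF assms(3), of j] mesh_mono[OF assms(3), of j m] assms(4) by auto
  then show "(U j - U (j - 1)) / (t j - t (j - 1)) * (LBINT s:{t (j - 1)..t j}. (t m - s) powr - \<alpha>) =
        (U j - U (j - 1)) * avg_kernel \<alpha> t m j"
    using kernel_set_integral[of \<alpha> "t (j - 1)" "t j" "t m"] assms(1,2)
    by (simp add: avg_kernel_def)
qed

text \<open>The quotient is the mean of \<open>s powr (- \<alpha>)\<close> over the interval, hence
  a value of that function at an intermediate point. The lower bound survives \<open>a = 0\<close>,
  where the integrand is singular.\<close>

lemma powr_mean_bounds: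
  fixes \<alpha> a b :: real
  assumes "0 < \<alpha>" "\<alpha> < 1" "0 \<le> a" "a < b"
  shows "b powr (- \<alpha>) \<le> (b powr (1 - \<alpha>) - a powr (1 - \<alpha>)) / ((1 - \<alpha>) * (b - a))"
    and "a > 0 \<Longrightarrow> (b powr (1 - \<alpha>) - a powr (1 - \<alpha>)) / ((1 - \<alpha>) * (b - a)) \<le> a powr (- \<alpha>)"
proof -
  have "\<exists>l z. a < z \<and> z < b \<and> ((\<lambda>x. x powr (1 - \<alpha>)) has_real_derivative l) (at z) \<and>
          b powr (1 - \<alpha>) - a powr (1 - \<alpha>) = (b - a) * l"
  proof (intro MVT assms)
    show "continuous_on {a..b} (\<lambda>x. x powr (1 - \<alpha>))"
      using assms by (intro continuous_on_powr' continuous_intros) auto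
    fix x assume "a < x" "x < b"
    then show "(\<lambda>x. x powr (1 - \<alpha>)) differentiable (at x)"
      using assms by (auto simp: real_differentiable_def intro!: exI derivative_eq_intros)
  qed
  then obtain l z where z: "a < z" "z < b" and l: "((\<lambda>x. x powr (1 - \<alpha>)) has_real_derivative l) (at z)"
      and eq: "b powr (1 - \<alpha>) - a powr (1 - \<alpha>) = (b - a) * l" by blast
  have "((\<lambda>x. x powr (1 - \<alpha>)) has_real_derivative (1 - \<alpha>) * z powr (- \<alpha>)) (at z)"
    using z assms by (auto intro!: derivative_eq_intros)
  from DERIV_unique[OF l this] eq
  have *: "(b powr (1 - \<alpha>) - a powr (1 - \<alpha>)) / ((1 - \<alpha>) * (b - a)) = z powr (- \<alpha>)"
    using assms by simp
  show "b powr (- \<alpha>) \<le> (b powr (1 - \<alpha>) - a powr (1 - \<alpha>)) / ((1 - \<alpha>) * (b - a))"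
    unfolding * using z assms by (intro powr_mono2') auto
  show "(b powr (1 - \<alpha>) - a powr (1 - \<alpha>)) / ((1 - \<alpha>) * (b - a)) \<le> a powr (- \<alpha>)" if "a > 0"
    unfolding * using z assms that by (intro powr_mono2') auto
qed

lemma avg_kernel_bounds:
  assumes "0 < \<alpha>" "\<alpha> < 1" "temporal_mesh T M t" "m \<le> M" "j \<in> {1..m}"
  shows "(t m - t (j - 1)) powr (- \<alpha>) \<le> avg_kernel \<alpha> t m j"
    and "j < m \<Longrightarrow> avg_kernel \<alpha> t m j \<le> (t m - t j) powr (- \<alpha>)"
proof -
  have *: "t (j - 1) < t j" "t j \<le> t m"
    using mesh_step[OF assms(3), of j] mesh_mono[OF assms(3), of j m] assms(4,5) by auto
  show "(t m - t (j - 1)) powr (- \<alpha>) \<le> avg_kernel \<alpha> t m j"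
    using powr_mean_bounds(1)[of \<alpha> "t m - t j" "t m - t (j - 1)"] * assms(1,2)
    by (simp add: avg_kernel_def)
  assume "j < m"
  then have "t j < t m" using mesh_strict_mono[OF assms(3), of j m] assms by auto
  then show "avg_kernel \<alpha> t m j \<le> (t m - t j) powr (- \<alpha>)"
    using powr_mean_bounds(2)[of \<alpha> "t m - t j" "t m - t (j - 1)"] * assms(1,2)
    by (simp add: avg_kernel_def)
qed

lemma avg_kernel_pos:
  assumes "0 < \<alpha>" "\<alpha> < 1" "temporal_mesh T M t" "m \<le> M" "j \<in> {1..m}"
  shows "avg_kernel \<alpha> t m j > 0"
proof -
  have "t (j - 1) < t m" using mesh_strict_mono[OF assms(3), of "j - 1" m] assms(4,5) by auto
  then have "(t m - t (j - 1)) powr (- \<alpha>) > 0" by simp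
  then show ?thesis using avg_kernel_bounds(1)[OF assms] by linarith
qed

lemma avg_kernel_last:
  assumes "0 < \<alpha>" "\<alpha> < 1" "temporal_mesh T M t" "m \<in> {1..M}"
  shows "avg_kernel \<alpha> t m m = (t m - t (m - 1)) powr (- \<alpha>) / (1 - \<alpha>)"
proof -
  define h where "h = t m - t (m - 1)"
  have "h > 0" using mesh_step[OF assms(3,4)] by (simp add: h_def)
  then have "h powr (1 - \<alpha>) = h * h powr (- \<alpha>)"
    by (simp add: powr_diff powr_minus divide_inverse)
  then show ?thesis
    using \<open>h > 0\<close> assms(1,2) unfolding avg_kernel_def h_def[symmetric] by simp
qed

lemma Gamma_1_minus_pos: "(\<alpha>::real) < 1 \<Longrightarrow> Gamma (1 - \<alpha>) > 0"
  by (rule Gamma_real_pos) simp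

lemma Gamma_2_minus: "(\<alpha>::real) < 1 \<Longrightarrow> Gamma (2 - \<alpha>) = (1 - \<alpha>) * Gamma (1 - \<alpha>)"
  using Gamma_plus1[of "1 - \<alpha>"] nonpos_Ints_nonpos[of "1 - \<alpha>"] by force

text \<open>The kernel increases towards \<open>t m\<close>. Its value at the common node
  \<open>t j\<close> separates the means over the two neighbouring intervals.\<close>

lemma L1_weight_nonneg:
  assumes "0 < \<alpha>" "\<alpha> < 1" "temporal_mesh T M t" "m \<le> M" "j < m"
  shows "L1_weight \<alpha> t m j \<ge> 0"
proof -
  have "avg_kernel \<alpha> t m j \<le> avg_kernel \<alpha> t m (Suc j)" if "j \<noteq> 0"
    using avg_kernel_bounds(2)[OF assms(1-4), of j] avg_kernel_bounds(1)[OF assms(1-4), of "Suc j"]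
      assms that by auto
  moreover have "avg_kernel \<alpha> t m (Suc j) > 0"
    using assms avg_kernel_pos[OF assms(1-4), of "Suc j"] by auto
  ultimately show ?thesis
    using Gamma_1_minus_pos[OF assms(2)] by (auto simp: L1_weight_def)
qed

text \<open>All values are measured against the final one, \<open>U m\<close>, so the boundary term
  vanishes at \<open>n = m\<close>; carrying it along makes the induction on \<open>n\<close>
  possible.\<close>

lemma summation_by_parts_to_end:
  fixes K U :: "nat \<Rightarrow> real"
  assumes "n \<le> m"
  shows "(\<Sum>j=1..n. (U j - U (j - 1)) * K j) =
         (\<Sum>j<n. (K (Suc j) - (if j = 0 then 0 else K j)) * (U m - U j)) - (if n = 0 then 0 else K n * (U m - U n))"
  by (induction n) (auto simp: algebra_simps)

lemma sum_L1_weight: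
  "n > 0 \<Longrightarrow> (\<Sum>j<n. L1_weight \<alpha> t m j) = avg_kernel \<alpha> t m n / Gamma (1 - \<alpha>)"
proof (induction n)
  case (Suc n)
  then show ?case by (cases "n = 0") (auto simp: L1_weight_def diff_divide_distrib)
qed simp

lemma L1_op_weights:
  assumes "0 < \<alpha>" "\<alpha> < 1" "temporal_mesh T M t" "m \<le> M"
  shows "L1_op \<alpha> t U m = (\<Sum>j<m. L1_weight \<alpha> t m j * (U m - U j))"
  unfolding L1_op_eq[OF assms] summation_by_parts_to_end[OF order_refl]
  by (simp add: sum_divide_distrib L1_weight_def)

lemma L1_op_split:
  assumes "0 < \<alpha>" "\<alpha> < 1" "temporal_mesh T M t" "m \<in> {1..M}"
  shows "L1_op \<alpha> t U m =
     (t m - t (m - 1)) powr (- \<alpha>) / Gamma (2 - \<alpha>) * U m - (\<Sum>j<m. L1_weight \<alpha> t m j * U j)"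
proof -
  have "L1_op \<alpha> t U m = (\<Sum>j<m. L1_weight \<alpha> t m j) * U m - (\<Sum>j<m. L1_weight \<alpha> t m j * U j)"
    using L1_op_weights[OF assms(1-3), of m U] assms(4)
    by (simp add: sum_distrib_right sum_subtractf right_diff_distrib)
  also have "(\<Sum>j<m. L1_weight \<alpha> t m j) = (t m - t (m - 1)) powr (- \<alpha>) / Gamma (2 - \<alpha>)"
    using assms sum_L1_weight[of m] avg_kernel_last[OF assms] Gamma_2_minus[OF assms(2)]
    by simp
  finally show ?thesis .
qed

text \<open>A discrete product rule, from \<open>A m * V m - A j * V j = A m * (V m - V j) + (A m -
  A j) * V j\<close>. For nondecreasing \<open>A\<close> and nonnegative \<open>V\<close> the
  correction is a gain.\<close>

lemma L1_op_mult:
  assumes "0 < \<alpha>" "\<alpha> < 1" "temporal_mesh T M t" "m \<le> M"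
  shows "L1_op \<alpha> t (\<lambda>j. A j * V j) m =
     A m * L1_op \<alpha> t V m + (\<Sum>j<m. L1_weight \<alpha> t m j * ((A m - A j) * V j))"
  unfolding L1_op_weights[OF assms] sum_distrib_left sum.distrib[symmetric]
  by (intro sum.cong refl) (simp add: algebra_simps)

lemma L1_op_add:
  "L1_op \<alpha> t (\<lambda>j. A j + B j) m = L1_op \<alpha> t A m + L1_op \<alpha> t B m"
  unfolding L1_op_def distrib_left[symmetric] sum.distrib[symmetric]
  by (intro arg_cong[where f = "\<lambda>x. _ * x"] sum.cong refl)
    (simp add: add_diff_add add_divide_distrib distrib_right)

lemma L1_op_scale:
  "L1_op \<alpha> t (\<lambda>j. c * A j) m = c * L1_op \<alpha> t A m"
  unfolding L1_op_def sum_distrib_left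
  by (intro sum.cong refl) (simp add: right_diff_distrib[symmetric])

text \<open>Multiplied by \<open>h powr (- \<alpha>)\<close>, the step condition says that the
  diagonal coefficient of the L1 operator exceeds \<open>lam\<close>.\<close>

lemma diagonal_dominates:
  fixes \<alpha> h lam :: real
  assumes "0 < \<alpha>" "\<alpha> < 1" "h > 0" "lam * h powr \<alpha> < 1 / Gamma (2 - \<alpha>)"
  shows "lam < h powr (- \<alpha>) / Gamma (2 - \<alpha>)"
proof -
  have "lam * h powr \<alpha> * h powr (- \<alpha>) < 1 / Gamma (2 - \<alpha>) * h powr (- \<alpha>)"
    using assms by (intro mult_strict_right_mono) auto
  moreover have "h powr \<alpha> * h powr (- \<alpha>) = 1"
    using assms by (simp flip: powr_add)
  ultimately show ?thesis by (simp add: mult.assoc)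
qed

text \<open>Marching in time: the history enters with nonnegative weights and \<open>lam1\<close> is
  nonnegative, so at each level the inequality reduces to one between
  \<open>(d - lam0) * E m\<close> and \<open>(d - lam0) * W m\<close>, with a positive factor by the
  step condition.\<close>

lemma L1_comparison:
  fixes E W :: "nat \<Rightarrow> real"
  assumes "0 < \<alpha>" "\<alpha> < 1" "temporal_mesh T M t" "lam1 \<ge> 0"
    and step: "\<And>j. j \<in> {1..M} \<Longrightarrow> lam0 * (t j - t (j - 1)) powr \<alpha> < 1 / Gamma (2 - \<alpha>)"
    and init: "E 0 \<le> W 0"
    and le: "\<And>m. m \<in> {1..M} \<Longrightarrow> L1_op \<alpha> t E m - lam0 * E m - lam1 * E (m - 1) \<le>
               L1_op \<alpha> t W m - lam0 * W m - lam1 * W (m - 1)"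
  shows "m \<le> M \<Longrightarrow> E m \<le> W m"
proof (induction m rule: less_induct)
  case (less m)
  show ?case
  proof (cases "m = 0")
    case True then show ?thesis using init by simp
  next
    case False
    then have m: "m \<in> {1..M}" using less by auto
    have IH: "E j \<le> W j" if "j < m" for j using less that by auto
    define d where "d = (t m - t (m - 1)) powr (- \<alpha>) / Gamma (2 - \<alpha>)"
    have d: "d > lam0" unfolding d_def
      using diagonal_dominates[OF assms(1,2) _ step[OF m]] mesh_step[OF assms(3) m] by simp
    have "(\<Sum>j<m. L1_weight \<alpha> t m j * E j) \<le> (\<Sum>j<m. L1_weight \<alpha> t m j * W j)"
      using IH L1_weight_nonneg[OF assms(1-3)] less m by (intro sum_mono mult_left_mono) auto
    moreover have "lam1 * E (m - 1) \<le> lam1 * W (m - 1)"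
      using IH m assms(4) by (intro mult_left_mono) auto
    ultimately have "(d - lam0) * E m \<le> (d - lam0) * W m"
      using le[OF m] unfolding L1_op_split[OF assms(1-3) m] d_def[symmetric]
      by (simp add: algebra_simps)
    then show ?thesis using d by simp
  qed
qed

text \<open>A discrete Kato inequality: after multiplication by the sign of the last value every
  difference is at least the difference of the moduli. Through it a one-sided condition on
  \<open>F\<close> controls the modulus of the error.\<close>

lemma L1_op_abs_le:
  assumes "0 < \<alpha>" "\<alpha> < 1" "temporal_mesh T M t" "m \<le> M"
  shows "L1_op \<alpha> t (\<lambda>j. \<bar>E j\<bar>) m \<le> sgn (E m) * L1_op \<alpha> t E m"
  unfolding L1_op_weights[OF assms] sum_distrib_left
proof (rule sum_mono)
  fix j assume j: "j \<in> {..<m}"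
  have "\<bar>E m\<bar> - \<bar>E j\<bar> \<le> sgn (E m) * (E m - E j)"
    by (auto simp: sgn_if abs_if)
  then have "L1_weight \<alpha> t m j * (\<bar>E m\<bar> - \<bar>E j\<bar>) \<le> L1_weight \<alpha> t m j * (sgn (E m) * (E m - E j))"
    using L1_weight_nonneg[OF assms, of j] j by (intro mult_left_mono) auto
  then show "L1_weight \<alpha> t m j * (\<bar>E m\<bar> - \<bar>E j\<bar>) \<le> sgn (E m) * (L1_weight \<alpha> t m j * (E m - E j))"
    by (simp add: mult.left_commute)
qed

section \<open>Solvability of the scheme\<close>

lemma quasi_monotone_equation_unique_solution:
  fixes G :: "real \<Rightarrow> real"
  assumes "continuous_on UNIV G" "c > 0" "\<And>v d. d \<ge> 0 \<Longrightarrow> G (v + d) - G v \<ge> c * d"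
  shows "\<exists>!v. G v = y"
proof -
  \<comment> \<open>Growth at rate \<open>c\<close> covers the gap between \<open>G 0\<close> and
    \<open>y\<close> within the distance \<open>\<bar>y - G 0\<bar> / c\<close>, so these two points
    bracket a root.\<close>
  have up: "G ((\<bar>y - G 0\<bar>) / c) \<ge> y"
    using assms(3)[of "\<bar>y - G 0\<bar> / c" 0] assms(2) by simp
  have lo: "G (- (\<bar>y - G 0\<bar> / c)) \<le> y"
    using assms(3)[of "\<bar>y - G 0\<bar> / c" "- (\<bar>y - G 0\<bar> / c)"] assms(2) by simp
  have "\<exists>x\<ge>- (\<bar>y - G 0\<bar> / c). x \<le> \<bar>y - G 0\<bar> / c \<and> G x = y"
    using lo up assms(1,2) by (intro IVT') (auto intro: continuous_on_subset order_trans[of _ 0])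
  then obtain v where v: "G v = y" by blast
  have "w = v" if "G w = y" for w
    using assms(3)[of "\<bar>w - v\<bar>" "min v w"] that v assms(2)
    by (cases "v \<le> w") (auto simp: min_def mult_le_0_iff)
  then show ?thesis using v by blast
qed

text \<open>Level \<open>m\<close> is a scalar equation whose left side,
  \<open>d * v + F v (U (m - 1))\<close>, increases at rate at least \<open>d - lam0 > 0\<close>.
  Membership in \<open>extensional\<close> pins down the values beyond \<open>M\<close>, so that
  uniqueness can be asserted for functions on all indices.\<close>

lemma L1_scheme_ex1:
  fixes F :: "real \<Rightarrow> real \<Rightarrow> real" and h :: "nat \<Rightarrow> real"
  assumes "0 < \<alpha>" "\<alpha> < 1" "temporal_mesh T M t"
    and step: "\<And>j. j \<in> {1..M} \<Longrightarrow> lam0 * (t j - t (j - 1)) powr \<alpha> < 1 / Gamma (2 - \<alpha>)"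
    and cont: "\<And>w. continuous_on UNIV (\<lambda>v. F v w)"
    and mono: "\<And>v w d. d \<ge> 0 \<Longrightarrow> F (v + d) w - F v w \<ge> - lam0 * d"
  shows "\<exists>!U. U \<in> extensional {0..M} \<and> U 0 = u0 \<and>
           (\<forall>m\<in>{1..M}. L1_op \<alpha> t U m + F (U m) (U (m - 1)) = h m)"
proof -
  define P where "P n U \<longleftrightarrow> U \<in> extensional {0..n} \<and> U 0 = u0 \<and>
      (\<forall>m\<in>{1..n}. L1_op \<alpha> t U m + F (U m) (U (m - 1)) = h m)" for n U
  have "\<exists>!U. P n U" if "n \<le> M" for n
    using that
  proof (induction n)
    case 0
    have "P 0 U \<longleftrightarrow> U = (\<lambda>j. if j = 0 then u0 else undefined)" for U
      by (auto simp: P_def extensional_def fun_eq_iff)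
    then show ?case by simp
  next
    case (Suc n)
    then have "\<exists>!U. P n U" by simp
    then obtain U where PU: "P n U" and uniq: "\<And>V. P n V \<Longrightarrow> V = U" by blast
    have U: "U \<in> extensional {0..n}" "U 0 = u0"
        "\<And>m. m \<in> {1..n} \<Longrightarrow> L1_op \<alpha> t U m + F (U m) (U (m - 1)) = h m"
      using PU by (auto simp: P_def)
    have m: "Suc n \<in> {1..M}" using Suc.prems by auto
    define d where "d = (t (Suc n) - t (Suc n - 1)) powr (- \<alpha>) / Gamma (2 - \<alpha>)"
    have d: "d > lam0" unfolding d_def
      using diagonal_dominates[OF assms(1,2) _ step[OF m]] mesh_step[OF assms(3) m] by simp
    have cong: "L1_op \<alpha> t V k = L1_op \<alpha> t V' k" if "\<And>j. j \<le> k \<Longrightarrow> V j = V' j" for V V' k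
      unfolding L1_op_def using that by (auto intro!: sum.cong)
    have "\<exists>!v. d * v + F v (U n) = h (Suc n) + (\<Sum>j<Suc n. L1_weight \<alpha> t (Suc n) j * U j)"
    proof (rule quasi_monotone_equation_unique_solution[of _ "d - lam0"])
      show "continuous_on UNIV (\<lambda>v. d * v + F v (U n))" by (intro continuous_intros cont)
      show "(d - lam0) * \<nu> \<le> d * (v + \<nu>) + F (v + \<nu>) (U n) - (d * v + F v (U n))" if "0 \<le> \<nu>" for v \<nu>
        using mono[OF that, of v "U n"] by (simp add: algebra_simps)
    qed (use d in simp)
    then obtain v where v: "d * v + F v (U n) = h (Suc n) + (\<Sum>j<Suc n. L1_weight \<alpha> t (Suc n) j * U j)"
      and vu: "\<And>w. d * w + F w (U n) = h (Suc n) + (\<Sum>j<Suc n. L1_weight \<alpha> t (Suc n) j * U j) \<Longrightarrow> w = v"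
      by blast
    have split: "L1_op \<alpha> t V (Suc n) = d * V (Suc n) - (\<Sum>j<Suc n. L1_weight \<alpha> t (Suc n) j * U j)"
      if "\<And>j. j \<le> n \<Longrightarrow> V j = U j" for V
      unfolding L1_op_split[OF assms(1-3) m] d_def using that by simp
    show ?case
    proof (rule ex1I[of _ "U(Suc n := v)"])
      show "P (Suc n) (U(Suc n := v))"
        unfolding P_def
      proof (intro conjI ballI)
        show "U(Suc n := v) \<in> extensional {0..Suc n}" using U(1) by (auto simp: extensional_def)
        fix k assume k: "k \<in> {1..Suc n}"
        show "L1_op \<alpha> t (U(Suc n := v)) k + F ((U(Suc n := v)) k) ((U(Suc n := v)) (k - 1)) = h k"
        proof (cases "k = Suc n")
          case True
          then show ?thesis using v by (auto simp: split)
        next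
          case False
          then have "L1_op \<alpha> t (U(Suc n := v)) k = L1_op \<alpha> t U k" using k by (intro cong) auto
          then show ?thesis using False k U(3)[of k] by auto
        qed
      qed (use U in auto)
    next
      fix V assume "P (Suc n) V"
      then have V: "V \<in> extensional {0..Suc n} \<and> V 0 = u0 \<and>
        (\<forall>m\<in>{1..Suc n}. L1_op \<alpha> t V m + F (V m) (V (m - 1)) = h m)" by (simp add: P_def)
      \<comment> \<open>Forgetting the last value leads back to uniqueness at the previous level;
        \<open>undefined\<close> is what \<open>extensional\<close> demands outside the index
        range.\<close>
      define V' where "V' = V(Suc n := undefined)"
      have "V' = U"
      proof (rule uniq, unfold P_def, intro conjI)
        show "V' \<in> extensional {0..n}" using V by (auto simp: V'_def extensional_def)
        show "V' 0 = u0" using V by (auto simp: V'_def)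
        show "\<forall>m\<in>{1..n}. L1_op \<alpha> t V' m + F (V' m) (V' (m - 1)) = h m"
        proof
          fix k assume k: "k \<in> {1..n}"
          then have "L1_op \<alpha> t V' k = L1_op \<alpha> t V k" by (intro cong) (auto simp: V'_def)
          then show "L1_op \<alpha> t V' k + F (V' k) (V' (k - 1)) = h k"
            using k V by (auto simp: V'_def)
        qed
      qed
      then have eq: "V j = U j" if "j \<le> n" for j
        using that unfolding V'_def by (metis fun_upd_other not_less_eq_eq order_refl)
      have "L1_op \<alpha> t V (Suc n) + F (V (Suc n)) (V n) = h (Suc n)" using V by force
      then have "V (Suc n) = v" by (intro vu) (auto simp: split eq algebra_simps)
      moreover have "V j = U j" if "j > Suc n" for j
        using that V U(1) by (auto simp: extensional_def)
      ultimately show "V = U(Suc n := v)"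
        using eq by (auto simp: fun_eq_iff) (metis less_Suc_eq_le linorder_neqE_nat)
    qed
  qed
  then show ?thesis by (simp add: P_def)
qed

section \<open>Quasi-graded meshes and summation of interpolation errors\<close>

lemma avg_kernel_mult:
  "t (j - 1) < t j \<Longrightarrow> (t j - t (j - 1)) * avg_kernel \<alpha> t m j =
     ((t m - t (j - 1)) powr (1 - \<alpha>) - (t m - t j) powr (1 - \<alpha>)) / (1 - \<alpha>)"
  by (simp add: avg_kernel_def)

text \<open>A single mesh with an explicit constant \<open>c\<close>, so that later constants can be
  uniform over all meshes with the same parameters. Fineness is measured by \<open>t 1\<close>; its
  relation to \<open>M\<close> returns only in the final bounds.\<close>

definition graded_mesh :: "real \<Rightarrow> real \<Rightarrow> real \<Rightarrow> nat \<Rightarrow> (nat \<Rightarrow> real) \<Rightarrow> bool" where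
  "graded_mesh c r T M t \<longleftrightarrow> temporal_mesh T M t \<and> 1 \<le> M \<and>
     (\<forall>j\<in>{1..M}. t j - t (j - 1) \<le> c * t 1 powr (1 / r) * t j powr (1 - 1 / r))"

lemma graded_mesh_temporal: "graded_mesh c r T M t \<Longrightarrow> temporal_mesh T M t"
  by (simp add: graded_mesh_def)

lemma graded_mesh_first_pos: "graded_mesh c r T M t \<Longrightarrow> t 1 > 0"
  using mesh_pos[of T M t 1] by (simp add: graded_mesh_def)

lemma graded_mesh_first_le:
  "graded_mesh c r T M t \<Longrightarrow> 1 \<le> m \<Longrightarrow> m \<le> M \<Longrightarrow> t 1 \<le> t m"
  using mesh_mono[of T M t 1 m] by (simp add: graded_mesh_def)

lemma graded_mesh_step_le:
  assumes "graded_mesh c r T M t" "r \<ge> 1" "c > 0" "1 \<le> j" "j \<le> m" "m \<le> M"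
  shows "t j - t (j - 1) \<le> c * t 1 powr (1 / r) * t m powr (1 - 1 / r)"
proof -
  have "t j - t (j - 1) \<le> c * t 1 powr (1 / r) * t j powr (1 - 1 / r)"
    using assms by (auto simp: graded_mesh_def)
  also have "\<dots> \<le> c * t 1 powr (1 / r) * t m powr (1 - 1 / r)"
    using assms mesh_mono[OF graded_mesh_temporal[OF assms(1)], of j m]
      mesh_nonneg[OF graded_mesh_temporal[OF assms(1)], of j]
    by (intro mult_left_mono powr_mono2) auto
  finally show ?thesis .
qed

text \<open>With \<open>x\<close> the first node and \<open>y\<close> the current time, a step is at
  most the fraction \<open>c * (x / y) powr (1 / r)\<close> of the current time, which is small once
  \<open>y\<close> is large compared with \<open>x\<close>.\<close>

lemma graded_step_rescale:
  fixes c x y r :: real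
  assumes "x > 0" "y > 0"
  shows "c * x powr (1 / r) * y powr (1 - 1 / r) = c * (x / y) powr (1 / r) * y"
  using assms by (simp add: powr_divide powr_diff)

text \<open>If \<open>t j\<close> exceeded \<open>2 * t (j - 1)\<close>, the step would be more than
  half of \<open>t j\<close>. The grading bound would then force \<open>t j powr (1 / r)\<close>
  below \<open>2 * c * t 1 powr (1 / r)\<close>, hence \<open>t j\<close> below a multiple of
  \<open>t (j - 1)\<close>. The index starts at 2 because \<open>t 0\<close> is zero.\<close>

lemma graded_mesh_ratio:
  assumes g: "graded_mesh c r T M t" and "r \<ge> 1" "c > 0" "2 \<le> j" "j \<le> M"
  shows "t j \<le> max 2 ((2 * c) powr r) * t (j - 1)"
proof (rule ccontr)
  assume neg: "\<not> ?thesis"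
  note m = graded_mesh_temporal[OF g]
  have p: "t (j - 1) > 0" "t 1 \<le> t (j - 1)" "t 1 > 0" "t j > 0"
    using mesh_pos[OF m, of "j - 1"] mesh_pos[OF m, of j] mesh_mono[OF m, of 1 "j - 1"] assms
      graded_mesh_first_pos[OF g] by auto
  have big: "2 * t (j - 1) < t j" "(2 * c) powr r * t (j - 1) < t j"
    using neg mult_right_mono[of 2 "max 2 ((2 * c) powr r)" "t (j - 1)"] p
      mult_right_mono[of "(2 * c) powr r" "max 2 ((2 * c) powr r)" "t (j - 1)"] by linarith+
  have "t j / 2 < t j - t (j - 1)" using big by simp
  also have "\<dots> \<le> c * t 1 powr (1 / r) * t j powr (1 - 1 / r)"
    using graded_mesh_step_le[OF g, of j j] assms by simp
  also have "\<dots> = c * (t 1 powr (1 / r) / t j powr (1 / r)) * t j"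
    using graded_step_rescale[of "t 1" "t j" c r] p by (simp add: powr_divide)
  finally have "t j powr (1 / r) < 2 * c * t 1 powr (1 / r)"
    using p by (simp add: field_simps)
  also have "\<dots> \<le> 2 * c * t (j - 1) powr (1 / r)"
    using p assms by (intro mult_left_mono powr_mono2) auto
  finally have "(t j powr (1 / r)) powr r < (2 * c * t (j - 1) powr (1 / r)) powr r"
    using assms by (intro powr_less_mono2) auto
  then have "t j < (2 * c) powr r * t (j - 1)"
    using p assms by (simp add: powr_powr powr_mult)
  then show False using big by simp
qed

section \<open>Elementary inequalities for powers\<close>

lemma powr_neg_diff_le:
  fixes \<alpha> a b :: real
  assumes "0 < \<alpha>" "0 < a" "a \<le> b"
  shows "a powr (- \<alpha>) - b powr (- \<alpha>) \<le> \<alpha> * a powr (- \<alpha> - 1) * (b - a)"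
proof (cases "a = b")
  case False
  then have "a < b" using assms by simp
  have "\<exists>z. a < z \<and> z < b \<and> b powr (- \<alpha>) - a powr (- \<alpha>) = (b - a) * (- \<alpha> * z powr (- \<alpha> - 1))"
    using assms by (intro MVT2 \<open>a < b\<close> has_real_derivative_powr) auto
  then obtain z where z: "a < z" and e: "b powr (- \<alpha>) - a powr (- \<alpha>) = (b - a) * (- \<alpha> * z powr (- \<alpha> - 1))"
    by blast
  have "(b - a) * (\<alpha> * z powr (- \<alpha> - 1)) \<le> (b - a) * (\<alpha> * a powr (- \<alpha> - 1))"
    using z assms by (intro mult_left_mono powr_mono2') auto
  then show ?thesis using e by (simp add: mult_ac)
qed simp

lemma powr_ratio_bound:
  fixes x y \<rho> e :: real
  assumes "0 < x" "x \<le> y" "y \<le> \<rho> * x"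
  shows "y powr e \<le> \<rho> powr \<bar>e\<bar> * x powr e" "x powr e \<le> \<rho> powr \<bar>e\<bar> * y powr e"
proof -
  have r1: "\<rho> \<ge> 1" using assms by (metis mult_le_cancel_right1 order_trans not_le less_le_trans)
  define z where "z = y / x"
  have z: "1 \<le> z" "z \<le> \<rho>" "y = z * x" using assms by (auto simp: z_def field_simps)
  have "z powr e \<le> \<rho> powr \<bar>e\<bar>"
    using z r1 by (intro order_trans[OF powr_mono[of e "\<bar>e\<bar>" z] powr_mono2]) auto
  then show "y powr e \<le> \<rho> powr \<bar>e\<bar> * x powr e"
    using z assms by (simp add: powr_mult mult_right_mono)
  have "1 \<le> z powr (\<bar>e\<bar> + e)" using z by (intro ge_one_powr_ge_zero) auto
  also have "\<dots> \<le> \<rho> powr \<bar>e\<bar> * z powr e"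
    using z by (auto simp: powr_add intro!: mult_right_mono powr_mono2)
  finally have "1 * x powr e \<le> \<rho> powr \<bar>e\<bar> * z powr e * x powr e"
    by (intro mult_right_mono) auto
  then show "x powr e \<le> \<rho> powr \<bar>e\<bar> * y powr e"
    using z assms by (simp add: powr_mult mult.assoc)
qed

text \<open>Compares a term of a Riemann sum for \<open>s powr (e - 1)\<close> with an increment of
  the antiderivative, so that such sums telescope. The division by \<open>e\<close> covers both
  signs of the exponent.\<close>

lemma powr_increment_ge:
  fixes x y \<rho> e :: real
  assumes "0 < x" "x < y" "y \<le> \<rho> * x" "e \<noteq> 0"
  shows "(y - x) * y powr (e - 1) \<le> \<rho> powr \<bar>e - 1\<bar> * ((y powr e - x powr e) / e)"
proof -
  have "\<exists>z. x < z \<and> z < y \<and> y powr e - x powr e = (y - x) * (e * z powr (e - 1))"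
    using assms by (intro MVT2 has_real_derivative_powr) auto
  then obtain z where z: "x < z" "z < y" and eq: "y powr e - x powr e = (y - x) * (e * z powr (e - 1))"
    by blast
  have "\<rho> > 0" using assms zero_less_mult_pos2[of \<rho> x] by linarith
  then have "\<rho> * x \<le> \<rho> * z" using z by simp
  then have "y powr (e - 1) \<le> \<rho> powr \<bar>e - 1\<bar> * z powr (e - 1)"
    using z assms by (intro powr_ratio_bound(1)) auto
  then have "(y - x) * y powr (e - 1) \<le> (y - x) * (\<rho> powr \<bar>e - 1\<bar> * z powr (e - 1))"
    using assms by (intro mult_left_mono) auto
  also have "\<dots> = \<rho> powr \<bar>e - 1\<bar> * ((y powr e - x powr e) / e)"
    using assms eq by simp
  finally show ?thesis .
qed

text \<open>The first summand stems from the intervals with \<open>t j > t m / 2\<close>, the second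
  from the earlier ones. The last divisor is the exponent of an antiderivative; the parameter
  \<open>q\<close> gives the freedom to keep it away from zero.\<close>

definition interpolation_const :: "real \<Rightarrow> real \<Rightarrow> real \<Rightarrow> real \<Rightarrow> real \<Rightarrow> real" where
  "interpolation_const \<alpha> c r \<sigma> q =
     2 powr (2 - \<sigma>) * c powr (2 - \<alpha>) * (1 + 2 * 2 powr (1 - \<alpha>) / (1 - \<alpha>)) +
     \<alpha> * 2 powr (\<alpha> + 1) * c\<^sup>2 * max 2 ((2 * c) powr r) powr \<bar>\<sigma> - q\<bar> / \<bar>\<sigma> - q + 1\<bar>"

lemma interpolation_const_pos:
  assumes "0 < \<alpha>" "\<alpha> < 1" "c > 0"
  shows "interpolation_const \<alpha> c r \<sigma> q > 0"
  unfolding interpolation_const_def using assms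
  by (intro add_pos_nonneg mult_pos_pos) auto

text \<open>
  The interpolation errors \<open>X j\<close> on the mesh intervals up to \<open>t m\<close> are summed by comparing each
  with the increment of an increasing function: close to \<open>t m\<close> with \<open>Q\<close>, whose total variation is
  of order \<open>H powr (1 - \<alpha>)\<close> even if the last steps are much shorter than \<open>H\<close>, and away from \<open>t m\<close>
  with a power function.
\<close>
lemma interpolation_errors_sum:
  fixes \<alpha> c r \<sigma> q A :: real and X :: "nat \<Rightarrow> real"
  assumes \<alpha>: "0 < \<alpha>" "\<alpha> < 1" and r: "r \<ge> 1" and c: "c > 0" and \<sigma>: "\<sigma> < 2"
    and q: "0 \<le> q" "q \<le> 2 / r" "\<sigma> - q + 1 \<noteq> 0"
    and g: "graded_mesh c r T M t" and p: "1 \<le> p" "p \<le> m" "m \<le> M" and A: "0 \<le> A"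
    and X1: "\<And>j. j \<in> {p+1..m} \<Longrightarrow> X j \<le> A * (t j - t (j - 1)) * t j powr (\<sigma> - 2) *
          (2 * (t j - t (j - 1)) * avg_kernel \<alpha> t m j)"
    and X2: "\<And>j. j \<in> {p+1..m} \<Longrightarrow> j < m \<Longrightarrow> X j \<le> A * (t j - t (j - 1)) * t j powr (\<sigma> - 2) *
          ((t j - t (j - 1)) * ((t m - t j) powr (- \<alpha>) - (t m - t (j - 1)) powr (- \<alpha>)))"
  shows "(\<Sum>j=p+1..m. X j) \<le> interpolation_const \<alpha> c r \<sigma> q * A *
     (t 1 powr ((2 - \<alpha>) / r) * t m powr (\<sigma> - \<alpha> - (2 - \<alpha>) / r) + t m powr (- \<alpha> - 1) * t 1 powr q *
        (if \<sigma> - q + 1 > 0 then t m powr (\<sigma> - q + 1) else t p powr (\<sigma> - q + 1)))"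
proof -
  define e where "e = \<sigma> - q + 1"
  define \<rho> where "\<rho> = max 2 ((2 * c) powr r)"
  define C1 where "C1 = 2 powr (2 - \<sigma>) * c powr (2 - \<alpha>) * (1 + 2 * 2 powr (1 - \<alpha>) / (1 - \<alpha>))"
  define C2 where "C2 = \<alpha> * 2 powr (\<alpha> + 1) * c\<^sup>2 * \<rho> powr \<bar>e - 1\<bar>"
  have const: "interpolation_const \<alpha> c r \<sigma> q = C1 + C2 / \<bar>e\<bar>"
    by (simp add: interpolation_const_def C1_def C2_def e_def \<rho>_def)
  have e0: "e \<noteq> 0" using q by (simp add: e_def)
  have C1: "C1 > 0" unfolding C1_def using c \<alpha> by (intro mult_pos_pos) (auto intro!: add_pos_nonneg)
  have C2: "C2 > 0" unfolding C2_def using c \<alpha> by (auto simp: \<rho>_def)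
  note mesh = graded_mesh_temporal[OF g]
  define H where "H = c * t 1 powr (1 / r) * t m powr (1 - 1 / r)"
  define G where "G x = x powr (1 - \<alpha>) / (1 - \<alpha>)" for x :: real
  \<comment> \<open>The first summand telescopes kernel differences at distance at least
    \<open>H\<close> from \<open>t m\<close>, the second telescopes kernel integrals closer to
    \<open>t m\<close>. On an interval whose right end is within \<open>H\<close> of
    \<open>t m\<close> the cap \<open>2 * H\<close> is inactive, since no step exceeds
    \<open>H\<close>.\<close>
  define Q where "Q j = H * max (t m - t j) H powr (- \<alpha>) - 2 * G (min (t m - t j) (2 * H))" for j
  have t1: "t 1 > 0" using graded_mesh_first_pos[OF g] .
  have tm: "t m > 0" using mesh_pos[OF mesh, of m] p by simp
  have tp: "t p > 0" using mesh_pos[OF mesh, of p] p by simp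
  have H: "H > 0" unfolding H_def using c t1 tm by simp
  have G_mono: "G x \<le> G y" if "0 \<le> x" "x \<le> y" for x y
    unfolding G_def using that \<alpha> by (intro divide_right_mono powr_mono2) auto
  have step: "t j - t (j - 1) \<le> H" "t (j - 1) < t j" "t j \<le> t m" "0 < t (j - 1)" "t 1 \<le> t j"
    "t j \<le> \<rho> * t (j - 1)"
    if "j \<in> {p+1..m}" for j
  proof -
    have j: "1 \<le> j" "2 \<le> j" "j \<le> m" "j \<le> M" "j \<in> {1..M}" "0 < j - 1" "j - 1 \<le> M"
      using p that by auto
    show "t j - t (j - 1) \<le> H" unfolding H_def
      by (rule graded_mesh_step_le[OF g r c j(1,3) p(3)])
    show "t (j - 1) < t j" by (rule mesh_step[OF mesh j(5)])
    show "t j \<le> t m" by (rule mesh_mono[OF mesh j(3) p(3)])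
    show "0 < t (j - 1)" by (rule mesh_pos[OF mesh j(6,7)])
    show "t 1 \<le> t j" by (rule mesh_mono[OF mesh j(1,4)])
    show "t j \<le> \<rho> * t (j - 1)" unfolding \<rho>_def by (rule graded_mesh_ratio[OF g r c j(2,4)])
  qed
  have Q_mono: "max (t m - t (j - 1)) H powr (- \<alpha>) \<le> max (t m - t j) H powr (- \<alpha>)"
       "G (min (t m - t j) (2 * H)) \<le> G (min (t m - t (j - 1)) (2 * H))"
    if "j \<in> {p+1..m}" for j
  proof -
    note s = step(2,3)[OF that]
    show "max (t m - t (j - 1)) H powr (- \<alpha>) \<le> max (t m - t j) H powr (- \<alpha>)"
      using s H \<alpha> by (intro powr_mono2') auto
    show "G (min (t m - t j) (2 * H)) \<le> G (min (t m - t (j - 1)) (2 * H))"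
      using s H by (intro G_mono) auto
  qed
  have Q_incr: "0 \<le> Q j - Q (j - 1)" if "j \<in> {p+1..m}" for j
  proof -
    have "H * max (t m - t (j - 1)) H powr (- \<alpha>) \<le> H * max (t m - t j) H powr (- \<alpha>)"
      using Q_mono(1)[OF that] H by (intro mult_left_mono) auto
    then show ?thesis using Q_mono(2)[OF that] unfolding Q_def by linarith
  qed
  define near where "near j = A * 2 powr (2 - \<sigma>) * t m powr (\<sigma> - 2) * H * (Q j - Q (j - 1))" for j
  define far where "far j = A * C2 * t m powr (- \<alpha> - 1) * t 1 powr q * ((t j powr e - t (j - 1) powr e) / e)" for j
  have near_nonneg: "near j \<ge> 0" if "j \<in> {p+1..m}" for j
    unfolding near_def using A H Q_incr[OF that] by simp
  have \<rho>0: "\<rho> powr \<bar>e - 1\<bar> > 0" by (simp add: \<rho>_def)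
  have incr: "(t j - t (j - 1)) * t j powr (e - 1) \<le> \<rho> powr \<bar>e - 1\<bar> * ((t j powr e - t (j - 1) powr e) / e)"
    if "j \<in> {p+1..m}" for j
    using step[OF that] e0 by (intro powr_increment_ge) auto
  have far_nonneg: "far j \<ge> 0" if "j \<in> {p+1..m}" for j
  proof -
    have "0 \<le> (t j - t (j - 1)) * t j powr (e - 1)" using step[OF that] by simp
    also note incr[OF that]
    finally have "0 \<le> (t j powr e - t (j - 1) powr e) / e"
      using \<rho>0 by (simp only: zero_le_mult_iff) (auto simp: not_le powr_gt_zero)
    then show ?thesis unfolding far_def using A C2 by (intro mult_nonneg_nonneg) auto
  qed
  \<comment> \<open>Only in the second half of the time range is the kernel close to its
    singularity, and there \<open>t j\<close> is comparable with \<open>t m\<close>. In the first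
    half the kernel varies at a rate of order \<open>t m powr (- \<alpha> - 1)\<close>, and the
    singularity of the interpolated function at 0 decides.\<close>
  have X_le: "X j \<le> near j + far j" if j: "j \<in> {p+1..m}" for j
  proof (cases "t j > t m / 2")
    case True
    note s = step[OF j]
    define \<tau> where "\<tau> = t j - t (j - 1)"
    have \<tau>: "0 < \<tau>" "\<tau> \<le> H" using s by (auto simp: \<tau>_def)
    have pw: "t j powr (\<sigma> - 2) \<le> 2 powr (2 - \<sigma>) * t m powr (\<sigma> - 2)"
      using powr_ratio_bound(1)[of "t j" "t m" 2 "\<sigma> - 2"] powr_ratio_bound(2)[of "t j" "t m" 2 "\<sigma> - 2"]
        True s tm \<sigma> by auto
    have "\<exists>Y. X j \<le> A * \<tau> * t j powr (\<sigma> - 2) * Y \<and> Y \<le> Q j - Q (j - 1)"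
    proof (cases "t m - t j \<ge> H")
      case True
      then have "j < m" using H j by (cases "j = m") auto
      let ?Y = "\<tau> * ((t m - t j) powr (- \<alpha>) - (t m - t (j - 1)) powr (- \<alpha>))"
      have "?Y \<le> H * ((t m - t j) powr (- \<alpha>) - (t m - t (j - 1)) powr (- \<alpha>))"
        using \<tau> True s \<alpha> H by (intro mult_right_mono) (auto intro!: powr_mono2')
      also have "\<dots> \<le> Q j - Q (j - 1)"
      proof -
        have "max (t m - t j) H = t m - t j" "max (t m - t (j - 1)) H = t m - t (j - 1)"
          using True s by auto
        then show ?thesis
          using Q_mono(2)[OF j] by (simp only: Q_def right_diff_distrib)
      qed
      finally show ?thesis using X2[OF j \<open>j < m\<close>] unfolding \<tau>_def by blast
    next
      case False
      have "\<tau> * avg_kernel \<alpha> t m j = G (t m - t (j - 1)) - G (t m - t j)"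
        using avg_kernel_mult[of t j \<alpha> m] \<tau> by (simp add: G_def \<tau>_def diff_divide_distrib)
      then have "2 * \<tau> * avg_kernel \<alpha> t m j = 2 * (G (t m - t (j - 1)) - G (t m - t j))"
        by (simp only: mult.assoc)
      also have "\<dots> \<le> Q j - Q (j - 1)"
        using False s Q_mono(1)[OF j] H by (simp add: Q_def min_def)
      finally show ?thesis using X1[OF j] unfolding \<tau>_def by blast
    qed
    then obtain Y where Y: "X j \<le> A * \<tau> * t j powr (\<sigma> - 2) * Y" "Y \<le> Q j - Q (j - 1)" by blast
    note Y(1)
    also have "A * \<tau> * t j powr (\<sigma> - 2) * Y \<le> A * \<tau> * t j powr (\<sigma> - 2) * (Q j - Q (j - 1))"
      using Y(2) A \<tau> by (intro mult_left_mono) auto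
    also have "\<dots> \<le> A * H * (2 powr (2 - \<sigma>) * t m powr (\<sigma> - 2)) * (Q j - Q (j - 1))"
      using pw A \<tau> H Q_incr[OF j] by (intro mult_right_mono mult_mono mult_left_mono) auto
    also have "\<dots> = near j" by (simp add: near_def)
    finally show ?thesis using far_nonneg[OF j] by simp
  next
    case False
    note s = step[OF j]
    then have "j < m" using False j tm by (cases "j = m") auto
    define \<tau> where "\<tau> = t j - t (j - 1)"
    have \<tau>: "0 < \<tau>" using s by (auto simp: \<tau>_def)
    have tj: "t j > 0" using s by simp
    have "\<tau> \<le> c * (t 1 / t j) powr (1 / r) * t j"
      using graded_mesh_step_le[OF g r c, of j j] j p
      unfolding \<tau>_def graded_step_rescale[OF t1 tj, of c r] by simp
    then have "\<tau>\<^sup>2 \<le> (c * (t 1 / t j) powr (1 / r) * t j)\<^sup>2"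
      using \<tau> by (intro power_mono) auto
    also have "\<dots> = c\<^sup>2 * (t 1 / t j) powr (2 / r) * (t j)\<^sup>2"
      using t1 tj by (simp add: power_mult_distrib powr_power)
    \<comment> \<open>The ratio \<open>t 1 / t j\<close> is at most 1, so the exponent
      \<open>2 / r\<close> may be lowered to \<open>q\<close>.\<close>
    also have "\<dots> \<le> c\<^sup>2 * (t 1 / t j) powr q * (t j)\<^sup>2"
      using t1 tj s q by (intro mult_right_mono mult_left_mono powr_mono') auto
    also have "\<dots> = c\<^sup>2 * t 1 powr q * t j powr (2 - q)"
      using t1 tj by (simp add: powr_divide powr_diff)
    finally have sq: "\<tau>\<^sup>2 \<le> c\<^sup>2 * t 1 powr q * t j powr (2 - q)" .
    have "(t m - t j) powr (- \<alpha>) - (t m - t (j - 1)) powr (- \<alpha>) \<le> \<alpha> * (t m - t j) powr (- \<alpha> - 1) * \<tau>"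
      using powr_neg_diff_le[of \<alpha> "t m - t j" "t m - t (j - 1)"] False tm s \<alpha> by (simp add: \<tau>_def)
    also have "\<dots> \<le> \<alpha> * (t m / 2) powr (- \<alpha> - 1) * \<tau>"
      using False tm \<alpha> \<tau> by (intro mult_right_mono mult_left_mono powr_mono2') auto
    also have "\<dots> = \<alpha> * 2 powr (\<alpha> + 1) * t m powr (- \<alpha> - 1) * \<tau>"
      using tm by (simp add: powr_divide powr_minus powr_diff powr_add field_simps)
    finally have kd: "(t m - t j) powr (- \<alpha>) - (t m - t (j - 1)) powr (- \<alpha>) \<le>
        \<alpha> * 2 powr (\<alpha> + 1) * t m powr (- \<alpha> - 1) * \<tau>" .
    have "X j \<le> A * \<tau> * t j powr (\<sigma> - 2) * (\<tau> * ((t m - t j) powr (- \<alpha>) - (t m - t (j - 1)) powr (- \<alpha>)))"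
      using X2[OF j \<open>j < m\<close>] unfolding \<tau>_def .
    also have "\<dots> \<le> A * \<tau> * t j powr (\<sigma> - 2) * (\<tau> * (\<alpha> * 2 powr (\<alpha> + 1) * t m powr (- \<alpha> - 1) * \<tau>))"
      using kd A \<tau> by (intro mult_left_mono) auto
    \<comment> \<open>Of the three factors \<open>\<tau>\<close>, two are spent on the grading
      bound; the third is the mesh width of a Riemann sum for \<open>s powr (e - 1)\<close>.\<close>
    also have "\<dots> = A * \<alpha> * 2 powr (\<alpha> + 1) * t m powr (- \<alpha> - 1) * \<tau> * t j powr (\<sigma> - 2) * \<tau>\<^sup>2"
      by (simp add: power2_eq_square)
    also have "\<dots> \<le> A * \<alpha> * 2 powr (\<alpha> + 1) * t m powr (- \<alpha> - 1) * \<tau> * t j powr (\<sigma> - 2) *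
          (c\<^sup>2 * t 1 powr q * t j powr (2 - q))"
      using sq A \<tau> \<alpha> by (intro mult_left_mono) auto
    also have "\<dots> = A * \<alpha> * 2 powr (\<alpha> + 1) * c\<^sup>2 * t m powr (- \<alpha> - 1) * t 1 powr q *
          (\<tau> * (t j powr (\<sigma> - 2) * t j powr (2 - q)))" by simp
    also have "t j powr (\<sigma> - 2) * t j powr (2 - q) = t j powr (e - 1)"
      by (simp add: e_def flip: powr_add)
    also have "A * \<alpha> * 2 powr (\<alpha> + 1) * c\<^sup>2 * t m powr (- \<alpha> - 1) * t 1 powr q * (\<tau> * t j powr (e - 1))
        \<le> A * \<alpha> * 2 powr (\<alpha> + 1) * c\<^sup>2 * t m powr (- \<alpha> - 1) * t 1 powr q *
            (\<rho> powr \<bar>e - 1\<bar> * ((t j powr e - t (j - 1) powr e) / e))"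
      using incr[OF j] A \<alpha> unfolding \<tau>_def by (intro mult_left_mono) auto
    also have "\<dots> = far j" by (simp add: far_def C2_def)
    finally show ?thesis using near_nonneg[OF j] by simp
  qed
  have tele: "(\<Sum>j=p+1..m. f j - f (j - 1)) = f m - f p" for f :: "nat \<Rightarrow> real"
    using sum_telescope''[OF p(2), of f] by (simp add: atLeastSucAtMost_greaterThanAtMost)
  have Q_var: "Q m - Q p \<le> H powr (1 - \<alpha>) * (1 + 2 * 2 powr (1 - \<alpha>) / (1 - \<alpha>))"
  proof -
    have "Q m = H powr (1 - \<alpha>)" using H \<alpha>
      by (simp add: Q_def G_def powr_diff powr_minus divide_inverse max_def)
    moreover have "G (min (t m - t p) (2 * H)) \<le> G (2 * H)"
      using H mesh_mono[OF mesh p(2,3)] by (intro G_mono) auto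
    moreover have "G (2 * H) = 2 powr (1 - \<alpha>) * H powr (1 - \<alpha>) / (1 - \<alpha>)"
      using H by (simp add: G_def powr_mult)
    moreover have "H * max (t m - t p) H powr (- \<alpha>) \<ge> 0" using H by simp
    ultimately have "Q m - Q p \<le> H powr (1 - \<alpha>) + 2 * (2 powr (1 - \<alpha>) * H powr (1 - \<alpha>) / (1 - \<alpha>))"
      unfolding Q_def[of p] by linarith
    also have "\<dots> = H powr (1 - \<alpha>) * (1 + 2 * 2 powr (1 - \<alpha>) / (1 - \<alpha>))"
      by (simp add: algebra_simps)
    finally show ?thesis .
  qed
  have "(\<Sum>j=p+1..m. near j) = A * 2 powr (2 - \<sigma>) * t m powr (\<sigma> - 2) * H * (Q m - Q p)"
    unfolding near_def sum_distrib_left[symmetric] tele ..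
  also have "\<dots> \<le> A * 2 powr (2 - \<sigma>) * t m powr (\<sigma> - 2) * H *
      (H powr (1 - \<alpha>) * (1 + 2 * 2 powr (1 - \<alpha>) / (1 - \<alpha>)))"
    using Q_var A H by (intro mult_left_mono) auto
  also have "\<dots> = A * 2 powr (2 - \<sigma>) * (1 + 2 * 2 powr (1 - \<alpha>) / (1 - \<alpha>)) * t m powr (\<sigma> - 2) * (H * H powr (1 - \<alpha>))"
    by simp
  also have "H * H powr (1 - \<alpha>) = H powr (2 - \<alpha>)"
    using H powr_add[of H 1 "1 - \<alpha>"] by simp
  also have "\<dots> = c powr (2 - \<alpha>) * t 1 powr ((2 - \<alpha>) / r) * t m powr ((1 - 1 / r) * (2 - \<alpha>))"
    using c t1 tm by (simp add: H_def powr_mult powr_powr)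
  also have "A * 2 powr (2 - \<sigma>) * (1 + 2 * 2 powr (1 - \<alpha>) / (1 - \<alpha>)) * t m powr (\<sigma> - 2) *
        (c powr (2 - \<alpha>) * t 1 powr ((2 - \<alpha>) / r) * t m powr ((1 - 1 / r) * (2 - \<alpha>)))
      = C1 * A * (t 1 powr ((2 - \<alpha>) / r) * (t m powr (\<sigma> - 2) * t m powr ((1 - 1 / r) * (2 - \<alpha>))))"
    by (simp add: C1_def)
  also have "t m powr (\<sigma> - 2) * t m powr ((1 - 1 / r) * (2 - \<alpha>)) = t m powr (\<sigma> - \<alpha> - (2 - \<alpha>) / r)"
    unfolding powr_add[symmetric] using r by (intro arg_cong[where f = "\<lambda>x. _ powr x"]) (simp add: field_simps)
  finally have sum_near: "(\<Sum>j=p+1..m. near j) \<le>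
      C1 * A * (t 1 powr ((2 - \<alpha>) / r) * t m powr (\<sigma> - \<alpha> - (2 - \<alpha>) / r))" .
  \<comment> \<open>The increment of \<open>s powr e / e\<close> is controlled by the upper end of
    the range for \<open>e > 0\<close> and by the lower end for \<open>e < 0\<close>.\<close>
  define S where "S = (if e > 0 then t m powr e else t p powr e)"
  have "(\<Sum>j=p+1..m. far j) = A * C2 * t m powr (- \<alpha> - 1) * t 1 powr q * ((t m powr e - t p powr e) / e)"
    unfolding far_def sum_distrib_left[symmetric] sum_divide_distrib[symmetric]
    by (simp only: tele[of "\<lambda>j. t j powr e"])
  also have "\<dots> \<le> A * C2 * t m powr (- \<alpha> - 1) * t 1 powr q * (S / \<bar>e\<bar>)"
  proof (intro mult_left_mono)
    show "(t m powr e - t p powr e) / e \<le> S / \<bar>e\<bar>"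
      using e0 by (cases "e > 0") (auto simp: S_def field_simps mult_nonpos_nonneg)
  qed (use A C2 in auto)
  also have "\<dots> = (C2 / \<bar>e\<bar>) * A * (t m powr (- \<alpha> - 1) * t 1 powr q * S)" by simp
  finally have sum_far: "(\<Sum>j=p+1..m. far j) \<le> (C2 / \<bar>e\<bar>) * A * (t m powr (- \<alpha> - 1) * t 1 powr q * S)" .
  have "(\<Sum>j=p+1..m. X j) \<le> (\<Sum>j=p+1..m. near j + far j)"
    using X_le by (intro sum_mono) auto
  also have "\<dots> \<le> C1 * A * (t 1 powr ((2 - \<alpha>) / r) * t m powr (\<sigma> - \<alpha> - (2 - \<alpha>) / r)) +
     (C2 / \<bar>e\<bar>) * A * (t m powr (- \<alpha> - 1) * t 1 powr q * S)"
    using sum_near sum_far by (simp add: sum.distrib)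
  also have "\<dots> \<le> (C1 + C2 / \<bar>e\<bar>) * A * (t 1 powr ((2 - \<alpha>) / r) * t m powr (\<sigma> - \<alpha> - (2 - \<alpha>) / r)) +
     (C1 + C2 / \<bar>e\<bar>) * A * (t m powr (- \<alpha> - 1) * t 1 powr q * S)"
    using C1 C2 A by (intro add_mono mult_right_mono) (auto simp: S_def)
  finally show ?thesis
    unfolding S_def e_def[symmetric] const by (simp add: distrib_left)
qed

section \<open>The base barrier\<close>

text \<open>The kernel minus its mean integrates to zero, and \<open>\<kappa>\<close> times
  \<open>v'\<close> integrates to the L1 contribution, so any constant \<open>d\<close> may be
  subtracted from \<open>v'\<close>. The error thus becomes the integral of a product of two small
  factors. Passing to the open interval removes the endpoints, where nothing is known about
  \<open>v'\<close>.\<close>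

lemma interpolation_error_has_integral:
  fixes v v' :: "real \<Rightarrow> real" and \<alpha> a b x d I :: real
  defines "\<kappa> \<equiv> ((x - a) powr (1 - \<alpha>) - (x - b) powr (1 - \<alpha>)) / ((1 - \<alpha>) * (b - a))"
  assumes \<alpha>: "0 < \<alpha>" "\<alpha> < 1" and ab: "a < b" "b \<le> x"
    and cont: "continuous_on {a..b} v"
    and deriv: "\<And>s. s \<in> {a<..<b} \<Longrightarrow> (v has_real_derivative v' s) (at s)"
    and int: "((\<lambda>s. (x - s) powr (- \<alpha>) * v' s) has_integral I) {a..b}"
  shows "((\<lambda>s. ((x - s) powr (- \<alpha>) - \<kappa>) * (v' s - d)) has_integral (I - (v b - v a) * \<kappa>)) {a<..<b}"
proof -
  have v': "(v' has_integral (v b - v a)) {a..b}"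
    using ab cont deriv
    by (intro fundamental_theorem_of_calculus_interior) (auto simp: has_real_derivative_iff_has_vector_derivative)
  have k: "((\<lambda>s. (x - s) powr (- \<alpha>)) has_integral (b - a) * \<kappa>) {a..b}"
    using kernel_has_integral[of \<alpha> a b x] \<alpha> ab by (simp add: \<kappa>_def)
  have c: "((\<lambda>s. d * \<kappa>) has_integral (b - a) * (d * \<kappa>)) {a..b}"
    using has_integral_const_real[of "d * \<kappa>" a b] ab by simp
  have "((\<lambda>s. (x - s) powr (- \<alpha>) * v' s - d * (x - s) powr (- \<alpha>) - (v' s * \<kappa> - d * \<kappa>)) has_integral
          (I - d * ((b - a) * \<kappa>) - ((v b - v a) * \<kappa> - (b - a) * (d * \<kappa>)))) {a..b}"
    by (intro has_integral_diff has_integral_mult_right has_integral_mult_left int k v' c)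
  also have "(\<lambda>s. (x - s) powr (- \<alpha>) * v' s - d * (x - s) powr (- \<alpha>) - (v' s * \<kappa> - d * \<kappa>)) =
      (\<lambda>s. ((x - s) powr (- \<alpha>) - \<kappa>) * (v' s - d))"
    by (auto simp: algebra_simps)
  also have "I - d * ((b - a) * \<kappa>) - ((v b - v a) * \<kappa> - (b - a) * (d * \<kappa>)) = I - (v b - v a) * \<kappa>"
    by simp
  finally show ?thesis by (simp add: has_integral_Icc_iff_Ioo)
qed

text \<open>The first bound serves intervals at or near the singularity \<open>x\<close>; the
  second, the oscillation of the kernel over the interval, serves those away from it.\<close>

lemma kernel_minus_mean_le:
  fixes \<alpha> a b x s :: real
  defines "\<kappa> \<equiv> ((x - a) powr (1 - \<alpha>) - (x - b) powr (1 - \<alpha>)) / ((1 - \<alpha>) * (b - a))"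
  assumes \<alpha>: "0 < \<alpha>" "\<alpha> < 1" and s: "a < s" "s < b" "b \<le> x"
  shows "\<bar>(x - s) powr (- \<alpha>) - \<kappa>\<bar> \<le> (x - s) powr (- \<alpha>) + \<kappa>"
    and "b < x \<Longrightarrow> \<bar>(x - s) powr (- \<alpha>) - \<kappa>\<bar> \<le> (x - b) powr (- \<alpha>) - (x - a) powr (- \<alpha>)"
proof -
  have \<kappa>: "(x - a) powr (- \<alpha>) \<le> \<kappa>"
    using powr_mean_bounds(1)[of \<alpha> "x - b" "x - a"] \<alpha> s by (simp add: \<kappa>_def)
  then have "0 \<le> \<kappa>" using powr_ge_zero[of "x - a" "- \<alpha>"] by linarith
  then show "\<bar>(x - s) powr (- \<alpha>) - \<kappa>\<bar> \<le> (x - s) powr (- \<alpha>) + \<kappa>"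
    using powr_ge_zero[of "x - s" "- \<alpha>"] by linarith
  assume "b < x"
  then have "\<kappa> \<le> (x - b) powr (- \<alpha>)"
    using powr_mean_bounds(2)[of \<alpha> "x - b" "x - a"] \<alpha> s by (simp add: \<kappa>_def)
  moreover have "(x - s) powr (- \<alpha>) \<le> (x - b) powr (- \<alpha>)" "(x - a) powr (- \<alpha>) \<le> (x - s) powr (- \<alpha>)"
    using \<alpha> s \<open>b < x\<close> by (auto intro!: powr_mono2')
  ultimately show "\<bar>(x - s) powr (- \<alpha>) - \<kappa>\<bar> \<le> (x - b) powr (- \<alpha>) - (x - a) powr (- \<alpha>)"
    using \<kappa> by linarith
qed

lemma has_integral_abs_le:
  fixes f g :: "real \<Rightarrow> real"
  assumes "(f has_integral i) S" "(g has_integral j) S" "\<And>x. x \<in> S \<Longrightarrow> \<bar>f x\<bar> \<le> g x"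
  shows "\<bar>i\<bar> \<le> j"
proof -
  have "i \<le> j" by (rule has_integral_le[OF assms(1,2)]) (use assms(3) in fastforce)
  moreover have "- i \<le> j"
    by (rule has_integral_le[OF has_integral_neg[OF assms(1)] assms(2)]) (use assms(3) in fastforce)
  ultimately show ?thesis by simp
qed

text \<open>Integrating the two bounds for the kernel minus its mean against \<open>D\<close> gives
  exactly the two kinds of estimate on which \<open>interpolation_errors_sum\<close> relies.\<close>

lemma mesh_interpolation_error:
  fixes v v' :: "real \<Rightarrow> real"
  assumes \<alpha>: "0 < \<alpha>" "\<alpha> < 1" and mesh: "temporal_mesh T M t" and m: "m \<le> M" "j \<in> {1..m}"
    and cont: "continuous_on {t (j - 1)..t j} v"
    and deriv: "\<And>s. s \<in> {t (j - 1)<..<t j} \<Longrightarrow> (v has_real_derivative v' s) (at s)"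
    and int: "((\<lambda>s. (t m - s) powr (- \<alpha>) * v' s) has_integral I) {t (j - 1)..t j}"
    and D: "\<And>s. s \<in> {t (j - 1)<..<t j} \<Longrightarrow> \<bar>v' s - d\<bar> \<le> D"
  shows "\<bar>I - (v (t j) - v (t (j - 1))) * avg_kernel \<alpha> t m j\<bar> \<le>
           D * (2 * (t j - t (j - 1)) * avg_kernel \<alpha> t m j)"
    and "j < m \<Longrightarrow> \<bar>I - (v (t j) - v (t (j - 1))) * avg_kernel \<alpha> t m j\<bar> \<le>
           D * ((t j - t (j - 1)) * ((t m - t j) powr (- \<alpha>) - (t m - t (j - 1)) powr (- \<alpha>)))"
proof -
  define a b x \<kappa> where defs: "a = t (j - 1)" "b = t j" "x = t m" "\<kappa> = avg_kernel \<alpha> t m j"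
  have ab: "a < b" "b \<le> x"
    using mesh_step[OF mesh, of j] mesh_mono[OF mesh, of j m] m by (auto simp: defs)
  have \<kappa>: "((x - a) powr (1 - \<alpha>) - (x - b) powr (1 - \<alpha>)) / ((1 - \<alpha>) * (b - a)) = \<kappa>"
    by (simp add: defs avg_kernel_def)
  have D0: "D \<ge> 0" using D[of "(a + b) / 2"] ab by (force simp: defs)
  note err = interpolation_error_has_integral[OF \<alpha> ab cont[folded defs] deriv[folded defs] int[folded defs],
      of d, unfolded \<kappa>]
  have k: "((\<lambda>s. D * ((x - s) powr (- \<alpha>) + \<kappa>)) has_integral D * ((b - a) * \<kappa> + (b - a) * \<kappa>)) {a<..<b}"
    using kernel_has_integral[of \<alpha> a b x] \<alpha> ab \<kappa> has_integral_const_real[of \<kappa> a b]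
    unfolding has_integral_Icc_iff_Ioo[symmetric]
    by (intro has_integral_mult_right has_integral_add) (auto simp flip: \<kappa>)
  have "\<bar>I - (v b - v a) * \<kappa>\<bar> \<le> D * ((b - a) * \<kappa> + (b - a) * \<kappa>)"
  proof (rule has_integral_abs_le[OF err k])
    fix s assume s: "s \<in> {a<..<b}"
    have "\<bar>((x - s) powr (- \<alpha>) - \<kappa>) * (v' s - d)\<bar> = \<bar>v' s - d\<bar> * \<bar>(x - s) powr (- \<alpha>) - \<kappa>\<bar>"
      by (simp add: abs_mult)
    also have "\<dots> \<le> D * ((x - s) powr (- \<alpha>) + \<kappa>)"
      using kernel_minus_mean_le(1)[OF \<alpha>, of a s b x] s ab D[of s] D0 unfolding \<kappa>
      by (intro mult_mono) (auto simp: defs)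
    finally show "\<bar>((x - s) powr (- \<alpha>) - \<kappa>) * (v' s - d)\<bar> \<le> D * ((x - s) powr (- \<alpha>) + \<kappa>)" .
  qed
  then show "\<bar>I - (v (t j) - v (t (j - 1))) * avg_kernel \<alpha> t m j\<bar> \<le>
           D * (2 * (t j - t (j - 1)) * avg_kernel \<alpha> t m j)"
    by (simp add: defs algebra_simps)
  assume "j < m"
  then have bx: "b < x" using mesh_strict_mono[OF mesh, of j m] m by (simp add: defs)
  define \<Delta> where "\<Delta> = (x - b) powr (- \<alpha>) - (x - a) powr (- \<alpha>)"
  have c: "((\<lambda>s. D * \<Delta>) has_integral (b - a) * (D * \<Delta>)) {a<..<b}"
    using has_integral_const_real[of "D * \<Delta>" a b] ab unfolding has_integral_Icc_iff_Ioo[symmetric] by simp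
  have "\<bar>I - (v b - v a) * \<kappa>\<bar> \<le> (b - a) * (D * \<Delta>)"
  proof (rule has_integral_abs_le[OF err c])
    fix s assume s: "s \<in> {a<..<b}"
    have "\<bar>((x - s) powr (- \<alpha>) - \<kappa>) * (v' s - d)\<bar> = \<bar>v' s - d\<bar> * \<bar>(x - s) powr (- \<alpha>) - \<kappa>\<bar>"
      by (simp add: abs_mult)
    also have "\<dots> \<le> D * \<Delta>"
      using kernel_minus_mean_le(2)[OF \<alpha>, of a s b x] s ab bx D[of s] D0 unfolding \<kappa> \<Delta>_def
      by (intro mult_mono) (auto simp: defs)
    finally show "\<bar>((x - s) powr (- \<alpha>) - \<kappa>) * (v' s - d)\<bar> \<le> D * \<Delta>" .
  qed
  then show "\<bar>I - (v (t j) - v (t (j - 1))) * avg_kernel \<alpha> t m j\<bar> \<le>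
           D * ((t j - t (j - 1)) * ((t m - t j) powr (- \<alpha>) - (t m - t (j - 1)) powr (- \<alpha>)))"
    by (simp add: defs \<Delta>_def mult_ac)
qed

lemma mesh_interpolation_errors_sum:
  fixes \<alpha> c r \<sigma> q A :: real and v v' :: "real \<Rightarrow> real"
  assumes \<alpha>: "0 < \<alpha>" "\<alpha> < 1" and r: "r \<ge> 1" and c: "c > 0" and \<sigma>: "\<sigma> < 2"
    and q: "0 \<le> q" "q \<le> 2 / r" "\<sigma> - q + 1 \<noteq> 0"
    and g: "graded_mesh c r T M t" and p: "1 \<le> p" "p \<le> m" "m \<le> M" and A: "0 \<le> A"
    and cont: "\<And>j. j \<in> {p+1..m} \<Longrightarrow> continuous_on {t (j - 1)..t j} v"
    and deriv: "\<And>j s. j \<in> {p+1..m} \<Longrightarrow> s \<in> {t (j - 1)<..<t j} \<Longrightarrow> (v has_real_derivative v' s) (at s)"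
    and int: "\<And>j. j \<in> {p+1..m} \<Longrightarrow>
       ((\<lambda>s. (t m - s) powr (- \<alpha>) * v' s) has_integral I j) {t (j - 1)..t j}"
    and D: "\<And>j s. j \<in> {p+1..m} \<Longrightarrow> s \<in> {t (j - 1)<..<t j} \<Longrightarrow>
       \<bar>v' s - v' (t j)\<bar> \<le> A * (t j - t (j - 1)) * t j powr (\<sigma> - 2)"
  shows "(\<Sum>j=p+1..m. \<bar>I j - (v (t j) - v (t (j - 1))) * avg_kernel \<alpha> t m j\<bar>) \<le>
     interpolation_const \<alpha> c r \<sigma> q * A *
     (t 1 powr ((2 - \<alpha>) / r) * t m powr (\<sigma> - \<alpha> - (2 - \<alpha>) / r) + t m powr (- \<alpha> - 1) * t 1 powr q *
        (if \<sigma> - q + 1 > 0 then t m powr (\<sigma> - q + 1) else t p powr (\<sigma> - q + 1)))"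
proof (rule interpolation_errors_sum[OF \<alpha> r c \<sigma> q g p A])
  fix j assume j: "j \<in> {p+1..m}"
  then have j': "j \<in> {1..m}" by auto
  note err = mesh_interpolation_error[OF \<alpha> graded_mesh_temporal[OF g] p(3) j' cont[OF j] deriv[OF j] int[OF j] D[OF j]]
  show "\<bar>I j - (v (t j) - v (t (j - 1))) * avg_kernel \<alpha> t m j\<bar> \<le> A * (t j - t (j - 1)) * t j powr (\<sigma> - 2) *
          (2 * (t j - t (j - 1)) * avg_kernel \<alpha> t m j)" by (rule err(1))
  show "\<bar>I j - (v (t j) - v (t (j - 1))) * avg_kernel \<alpha> t m j\<bar> \<le> A * (t j - t (j - 1)) * t j powr (\<sigma> - 2) *
          ((t j - t (j - 1)) * ((t m - t j) powr (- \<alpha>) - (t m - t (j - 1)) powr (- \<alpha>)))" if "j < m"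
    by (rule err(2)[OF _ _ that])
qed

text \<open>The branches agree at \<open>P\<close>. The linear one removes the singularity at 0 and
  vanishes there; if \<open>P\<close> is a node, the L1 operator treats it without interpolation
  error.\<close>

definition base_barrier :: "real \<Rightarrow> real \<Rightarrow> real \<Rightarrow> real" where
  "base_barrier \<alpha> P s = (if s \<le> P then s * P powr (\<alpha> - 2) else s powr (\<alpha> - 1))"

lemma base_barrier_ge: "P > 0 \<Longrightarrow> P \<le> s \<Longrightarrow> base_barrier \<alpha> P s = s powr (\<alpha> - 1)"
  by (auto simp: base_barrier_def powr_diff power2_eq_square)

lemma base_barrier_nonneg: "s \<ge> 0 \<Longrightarrow> base_barrier \<alpha> P s \<ge> 0"
  by (simp add: base_barrier_def)

text \<open>A linear function is interpolated exactly, so the terms telescope through the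
  antiderivative of the kernel. Stopping at \<open>n\<close> isolates what the linear branch of the
  barrier contributes at later times.\<close>

lemma L1_initial_segment:
  assumes \<alpha>: "0 < \<alpha>" "\<alpha> < 1" and mesh: "temporal_mesh T M t" and "n \<le> m" "m \<le> M"
  shows "(\<Sum>j=1..n. (t j * c - t (j - 1) * c) * avg_kernel \<alpha> t m j) =
     c * (t m powr (1 - \<alpha>) - (t m - t n) powr (1 - \<alpha>)) / (1 - \<alpha>)"
proof -
  define f where "f j = - (c / (1 - \<alpha>)) * (t m - t j) powr (1 - \<alpha>)" for j
  have "(\<Sum>j=1..n. (t j * c - t (j - 1) * c) * avg_kernel \<alpha> t m j) = (\<Sum>j=1..n. f j - f (j - 1))"
  proof (intro sum.cong refl)
    fix j assume "j \<in> {1..n}"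
    then have "t (j - 1) < t j" using mesh_step[OF mesh, of j] assms by auto
    have "(t j * c - t (j - 1) * c) * avg_kernel \<alpha> t m j = c * ((t j - t (j - 1)) * avg_kernel \<alpha> t m j)"
      by (simp add: algebra_simps)
    also have "\<dots> = f j - f (j - 1)"
      unfolding avg_kernel_mult[where t = t and j = j, OF \<open>t (j - 1) < t j\<close>] f_def
      by (simp add: right_diff_distrib diff_divide_distrib)
    finally show "(t j * c - t (j - 1) * c) * avg_kernel \<alpha> t m j = f j - f (j - 1)" .
  qed
  also have "\<dots> = f n - f 0"
    using sum_telescope''[of 0 n f] by (simp add: atLeastSucAtMost_greaterThanAtMost)
  also have "\<dots> = c * (t m powr (1 - \<alpha>) - (t m - t n) powr (1 - \<alpha>)) / (1 - \<alpha>)"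
    using mesh by (simp add: f_def right_diff_distrib diff_divide_distrib)
  finally show ?thesis .
qed

lemma L1_base_barrier_initial:
  assumes \<alpha>: "0 < \<alpha>" "\<alpha> < 1" and mesh: "temporal_mesh T M t" and m: "1 \<le> m" "m \<le> p" "p \<le> M"
  shows "L1_op \<alpha> t (\<lambda>j. base_barrier \<alpha> (t p) (t j)) m =
     base_barrier \<alpha> (t p) (t m) * t m powr (- \<alpha>) / Gamma (2 - \<alpha>)"
proof -
  have "t j \<le> t p" if "j \<le> m" for j using mesh_mono[OF mesh, of j p] m that by simp
  then have V: "base_barrier \<alpha> (t p) (t j) = t j * t p powr (\<alpha> - 2)" if "j \<le> m" for j
    using that by (simp add: base_barrier_def)
  have "t m > 0" using mesh_pos[OF mesh, of m] m by simp
  then have "t m powr (1 - \<alpha>) = t m * t m powr (- \<alpha>)"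
    using powr_add[of "t m" 1 "- \<alpha>"] by simp
  moreover have "(\<Sum>j=1..m. (base_barrier \<alpha> (t p) (t j) - base_barrier \<alpha> (t p) (t (j - 1))) * avg_kernel \<alpha> t m j)
      = t p powr (\<alpha> - 2) * (t m powr (1 - \<alpha>) - (t m - t m) powr (1 - \<alpha>)) / (1 - \<alpha>)"
  proof -
    have "(\<Sum>j=1..m. (base_barrier \<alpha> (t p) (t j) - base_barrier \<alpha> (t p) (t (j - 1))) * avg_kernel \<alpha> t m j)
      = (\<Sum>j=1..m. (t j * t p powr (\<alpha> - 2) - t (j - 1) * t p powr (\<alpha> - 2)) * avg_kernel \<alpha> t m j)"
    proof (intro sum.cong refl)
      fix j assume "j \<in> {1..m}"
      then have "j \<le> m" "j - 1 \<le> m" by auto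
      then show "(base_barrier \<alpha> (t p) (t j) - base_barrier \<alpha> (t p) (t (j - 1))) * avg_kernel \<alpha> t m j =
          (t j * t p powr (\<alpha> - 2) - t (j - 1) * t p powr (\<alpha> - 2)) * avg_kernel \<alpha> t m j"
        by (simp only: V)
    qed
    then show ?thesis using L1_initial_segment[OF \<alpha> mesh, of m m "t p powr (\<alpha> - 2)"] m by simp
  qed
  ultimately show ?thesis
    using L1_op_eq[OF \<alpha> mesh, of m] m \<alpha> Gamma_2_minus[OF \<alpha>(2)] V[of m]
    by (simp add: mult_ac)
qed

text \<open>With \<open>y = P / x\<close> this is
  \<open>(1 - y) powr a * (1 + a * y) \<le> 1\<close>, from \<open>1 - y \<le> exp (- y)\<close> and
  \<open>1 + a * y \<le> exp (a * y)\<close>. It lets the linear branch of the barrier compensate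
  for the decreasing one.\<close>

lemma powr_times_linear_le:
  fixes a P x :: real
  assumes "0 < a" "0 < P" "P \<le> x"
  shows "(x - P) powr a * (x + a * P) \<le> x powr (a + 1)"
proof (cases "P = x")
  case False
  define y where "y = P / x"
  have y: "0 < y" "y < 1" and P: "P = y * x" using assms False by (auto simp: y_def)
  have x: "x > 0" using assms by simp
  have "(1 - y) powr a \<le> exp (- y) powr a"
    using y assms exp_ge_add_one_self[of "- y"] by (intro powr_mono2) auto
  also have "\<dots> = exp (- (a * y))" by (simp add: exp_powr_real mult.commute)
  finally have "(1 - y) powr a * (1 + a * y) \<le> exp (- (a * y)) * exp (a * y)"
    using y assms by (intro mult_mono) auto
  then have "(1 - y) powr a * (1 + a * y) \<le> 1" by (simp flip: exp_add)
  then have "(x powr a * x) * ((1 - y) powr a * (1 + a * y)) \<le> (x powr a * x) * 1"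
    using x by (intro mult_left_mono) auto
  moreover have "(x - P) powr a = x powr a * (1 - y) powr a"
    using x y P powr_mult[of x "1 - y" a] by (simp add: algebra_simps)
  moreover have "x powr (a + 1) = x powr a * x" using x by (simp add: powr_add)
  ultimately show ?thesis by (simp add: P algebra_simps)
qed (use assms in auto)

text \<open>The substitution \<open>w = (x - s) / s\<close> turns the integrand into a multiple of
  \<open>w powr (- \<alpha>)\<close>. The resulting antiderivative is continuous up to
  \<open>s = x\<close>, so the weak singularity of the kernel is harmless.\<close>

lemma singular_integral:
  fixes \<alpha> a b x :: real
  assumes \<alpha>: "0 < \<alpha>" "\<alpha> < 1" and "0 < a" "a \<le> b" "b \<le> x"
  shows "((\<lambda>s. (x - s) powr (- \<alpha>) * ((\<alpha> - 1) * s powr (\<alpha> - 2))) has_integral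
     (((x - b) / b) powr (1 - \<alpha>) / x - ((x - a) / a) powr (1 - \<alpha>) / x)) {a..b}"
proof (rule fundamental_theorem_of_calculus_interior)
  show "continuous_on {a..b} (\<lambda>s. ((x - s) / s) powr (1 - \<alpha>) / x)"
    using assms by (intro continuous_on_divide continuous_on_powr' continuous_intros) auto
  fix s assume s: "s \<in> {a<..<b}"
  have pos: "0 < s" "0 < (x - s) / s" "s < x" using s assms by auto
  have "((\<lambda>s. (x - s) / s) has_real_derivative - (x / s\<^sup>2)) (at s)"
    using pos by (auto intro!: derivative_eq_intros simp: field_simps power2_eq_square)
  then have "((\<lambda>s. ((x - s) / s) powr (1 - \<alpha>) / x) has_real_derivative
       ((1 - \<alpha>) * ((x - s) / s) powr (1 - \<alpha> - 1) * - (x / s\<^sup>2)) / x) (at s)"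
    by (intro DERIV_cdivide DERIV_chain2[OF has_real_derivative_powr] pos)
  also have "((1 - \<alpha>) * ((x - s) / s) powr (1 - \<alpha> - 1) * - (x / s\<^sup>2)) / x =
       (x - s) powr (- \<alpha>) * ((\<alpha> - 1) * s powr (\<alpha> - 2))"
    using pos assms by (simp add: powr_divide powr_diff powr_minus divide_simps) (simp add: algebra_simps)
  finally show "((\<lambda>s. ((x - s) / s) powr (1 - \<alpha>) / x) has_vector_derivative
       (x - s) powr (- \<alpha>) * ((\<alpha> - 1) * s powr (\<alpha> - 2))) (at s)"
    by (simp add: has_real_derivative_iff_has_vector_derivative)
qed (use assms in auto)

text \<open>
  The Caputo derivative of the base barrier is nonnegative beyond \<open>P\<close>, because the
  Riemann--Liouville derivative of \<open>s powr (\<alpha> - 1)\<close> vanishes; the L1 operator differs from it by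
  the interpolation error only.
\<close>
lemma L1_base_barrier_ge:
  fixes \<alpha> c r \<eta> :: real
  assumes \<alpha>: "0 < \<alpha>" "\<alpha> < 1" and r: "r \<ge> 1" and c: "c > 0"
    and \<eta>: "0 < \<eta>" "\<eta> < \<alpha>" "\<eta> \<le> 1 / r"
  shows "\<exists>C>0. \<forall>T M t p m. graded_mesh c r T M t \<longrightarrow> 1 \<le> p \<longrightarrow> p \<le> m \<longrightarrow> m \<le> M \<longrightarrow>
     L1_op \<alpha> t (\<lambda>j. base_barrier \<alpha> (t p) (t j)) m \<ge> - C * (t 1 / t m) powr \<eta> / t m"
proof -
  define \<rho> where "\<rho> = max 2 ((2 * c) powr r)"
  define A where "A = (1 - \<alpha>) * (2 - \<alpha>) * \<rho> powr (3 - \<alpha>)"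
  have "1 / r \<le> (2 - \<alpha>) / r" "1 / r \<le> 2 / r" using r \<alpha> by (auto simp: divide_simps)
  then have \<eta>': "\<eta> \<le> (2 - \<alpha>) / r" "\<eta> \<le> 2 / r" using \<eta> by auto
  have A: "A > 0" using \<alpha> by (simp add: A_def \<rho>_def)
  \<comment> \<open>The summation lemma is used for \<open>s powr (\<alpha> - 1)\<close>, with
    \<open>\<alpha> - 1\<close> as \<open>\<sigma>\<close> and \<open>\<eta>\<close> as
    \<open>q\<close>. Then \<open>\<sigma> - q + 1 = \<alpha> - \<eta>\<close> is positive, so the
    late end of the time range governs the sum.\<close>
  define C where "C = interpolation_const \<alpha> c r (\<alpha> - 1) \<eta>"
  have C: "C > 0" unfolding C_def by (rule interpolation_const_pos[OF \<alpha> c])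
  show ?thesis
  proof (intro exI[of _ "2 * C * A / Gamma (1 - \<alpha>)"] conjI allI impI)
    have \<Gamma>: "Gamma (1 - \<alpha>) > 0" using Gamma_1_minus_pos \<alpha> by blast
    then show "2 * C * A / Gamma (1 - \<alpha>) > 0" using C A by simp
    fix T M t p m
    assume g: "graded_mesh c r T M t" and p: "(1::nat) \<le> p" "p \<le> m" "m \<le> M"
    note mesh = graded_mesh_temporal[OF g]
    define V where "V j = base_barrier \<alpha> (t p) (t j)" for j
    define J where "J j = ((t m - t j) / t j) powr (1 - \<alpha>) / t m - ((t m - t (j - 1)) / t (j - 1)) powr (1 - \<alpha>) / t m" for j
    define X where "X j = \<bar>J j - (t j powr (\<alpha> - 1) - t (j - 1) powr (\<alpha> - 1)) * avg_kernel \<alpha> t m j\<bar>" for j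
    have tp: "t p > 0" and tm: "t m > 0" and t1: "t 1 > 0" and t1m: "t 1 \<le> t m" and tpm: "t p \<le> t m"
      using mesh_pos[OF mesh, of p] mesh_pos[OF mesh, of m] mesh_pos[OF mesh, of 1] mesh_mono[OF mesh, of 1 m]
        mesh_mono[OF mesh, of p m] p by auto
    have tj: "0 < t (j - 1)" "t (j - 1) < t j" "t j \<le> t m" "t j \<le> \<rho> * t (j - 1)" "t p \<le> t (j - 1)"
      if "j \<in> {p+1..m}" for j
      using mesh_pos[OF mesh, of "j - 1"] mesh_step[OF mesh, of j] mesh_mono[OF mesh, of j m]
        graded_mesh_ratio[OF g r c, of j, folded \<rho>_def] mesh_mono[OF mesh, of p "j - 1"] p that by auto
    have D: "\<bar>(\<alpha> - 1) * s powr (\<alpha> - 2) - (\<alpha> - 1) * t j powr (\<alpha> - 2)\<bar> \<le>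
          A * (t j - t (j - 1)) * t j powr ((\<alpha> - 1) - 2)" if j: "j \<in> {p+1..m}" and s': "s \<in> {t (j - 1)<..<t j}" for j s
    proof -
      note s = tj[OF j]
      have sp: "0 < s" "s < t j" "t (j - 1) < s" using s' s by auto
      have mono: "t j powr (\<alpha> - 2) \<le> s powr (\<alpha> - 2)" using sp \<alpha> by (intro powr_mono2') auto
      have eq: "(\<alpha> - 1) * s powr (\<alpha> - 2) - (\<alpha> - 1) * t j powr (\<alpha> - 2) =
         - ((1 - \<alpha>) * (s powr (\<alpha> - 2) - t j powr (\<alpha> - 2)))" by (simp add: algebra_simps)
      have "\<bar>(\<alpha> - 1) * s powr (\<alpha> - 2) - (\<alpha> - 1) * t j powr (\<alpha> - 2)\<bar> =
          (1 - \<alpha>) * (s powr (\<alpha> - 2) - t j powr (\<alpha> - 2))"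
        unfolding eq abs_minus_cancel using mono \<alpha> by simp
      also have "s powr (\<alpha> - 2) - t j powr (\<alpha> - 2) \<le> (2 - \<alpha>) * s powr (\<alpha> - 3) * (t j - s)"
        using powr_neg_diff_le[of "2 - \<alpha>" s "t j"] sp \<alpha> by simp
      also have "\<dots> \<le> (2 - \<alpha>) * (\<rho> powr (3 - \<alpha>) * t j powr (\<alpha> - 3)) * (t j - t (j - 1))"
      proof -
        have "\<rho> \<ge> 0" by (simp add: \<rho>_def)
        then have "\<rho> * t (j - 1) \<le> \<rho> * s" using sp by (intro mult_left_mono) auto
        then have "t j \<le> \<rho> * s" using s(4) by linarith
        then have "s powr (\<alpha> - 3) \<le> \<rho> powr (3 - \<alpha>) * t j powr (\<alpha> - 3)"
          using powr_ratio_bound(2)[of s "t j" \<rho> "\<alpha> - 3"] sp \<alpha> by simp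
        then show ?thesis using sp \<alpha> by (intro mult_mono mult_left_mono) auto
      qed
      finally show ?thesis using \<alpha> by (simp add: A_def mult_ac)
    qed
    have "(\<Sum>j=p+1..m. X j) \<le> C * A * (t 1 powr ((2 - \<alpha>) / r) * t m powr ((\<alpha> - 1) - \<alpha> - (2 - \<alpha>) / r) +
          t m powr (- \<alpha> - 1) * t 1 powr \<eta> *
          (if (\<alpha> - 1) - \<eta> + 1 > 0 then t m powr ((\<alpha> - 1) - \<eta> + 1) else t p powr ((\<alpha> - 1) - \<eta> + 1)))"
      unfolding C_def X_def
    proof (rule mesh_interpolation_errors_sum[where v = "\<lambda>s. s powr (\<alpha> - 1)" and v' = "\<lambda>s. (\<alpha> - 1) * s powr (\<alpha> - 2)",
          OF \<alpha> r c _ _ \<eta>'(2) _ g p])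
      fix j assume j: "j \<in> {p+1..m}"
      note s = tj[OF j]
      show "continuous_on {t (j - 1)..t j} (\<lambda>s. s powr (\<alpha> - 1))"
        using s by (intro continuous_intros) auto
      show "((\<lambda>s. s powr (\<alpha> - 1)) has_real_derivative (\<alpha> - 1) * s powr (\<alpha> - 2)) (at s)"
        if "s \<in> {t (j - 1)<..<t j}" for s
        using has_real_derivative_powr[of s "\<alpha> - 1"] that s by simp
      show "((\<lambda>s. (t m - s) powr (- \<alpha>) * ((\<alpha> - 1) * s powr (\<alpha> - 2))) has_integral J j) {t (j - 1)..t j}"
        unfolding J_def using s \<alpha> by (intro singular_integral) auto
    qed (use A D \<alpha> \<eta> in auto)
    also have "\<dots> = C * A * ((t 1 / t m) powr ((2 - \<alpha>) / r) / t m + (t 1 / t m) powr \<eta> / t m)"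
    proof -
      have inv_aux: "x powr e = 1 / (x powr q * x)" if "x > 0" "e = - (q + 1)" for x e q :: real
        unfolding that(2) using that(1) by (simp only: powr_minus_divide powr_add powr_one)
      have "t m powr ((\<alpha> - 1) - \<alpha> - (2 - \<alpha>) / r) = 1 / (t m powr ((2 - \<alpha>) / r) * t m)"
        using tm by (intro inv_aux) auto
      moreover have "t m powr (- \<alpha> - 1) * t m powr ((\<alpha> - 1) - \<eta> + 1) = 1 / (t m powr \<eta> * t m)"
        unfolding powr_add[symmetric] using tm by (intro inv_aux) auto
      ultimately show ?thesis
        using \<eta> t1 tm by (simp add: powr_divide mult_ac)
    qed
    also have "\<dots> \<le> C * A * ((t 1 / t m) powr \<eta> / t m + (t 1 / t m) powr \<eta> / t m)"
      using C A t1 tm t1m \<eta>' by (intro mult_left_mono add_mono divide_right_mono powr_mono') auto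
    also have "\<dots> = 2 * C * A * (t 1 / t m) powr \<eta> / t m" by simp
    finally have X_sum: "(\<Sum>j=p+1..m. X j) \<le> 2 * C * A * (t 1 / t m) powr \<eta> / t m" .
    have J_sum: "(\<Sum>j=p+1..m. J j) = - (((t m - t p) / t p) powr (1 - \<alpha>) / t m)"
      using sum_telescope''[OF p(2), of "\<lambda>j. ((t m - t j) / t j) powr (1 - \<alpha>) / t m"]
      by (simp add: atLeastSucAtMost_greaterThanAtMost J_def)
    \<comment> \<open>Up to the factor \<open>1 / Gamma (1 - \<alpha>)\<close>, the decreasing
      branch contributes minus the left side to the Caputo derivative at \<open>t m\<close>, and the
      linear branch contributes the right side.\<close>
    have init: "((t m - t p) / t p) powr (1 - \<alpha>) / t m \<le>
        t p powr (\<alpha> - 2) * (t m powr (1 - \<alpha>) - (t m - t p) powr (1 - \<alpha>)) / (1 - \<alpha>)"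
    proof -
      have "(t m - t p) powr (1 - \<alpha>) * (t m + (1 - \<alpha>) * t p) \<le> t m powr ((1 - \<alpha>) + 1)"
        using tp tpm \<alpha> by (intro powr_times_linear_le) auto
      also have "\<dots> = t m powr (1 - \<alpha>) * t m" using tm by (simp only: powr_add) simp
      finally have le: "(1 - \<alpha>) * t p * (t m - t p) powr (1 - \<alpha>) \<le>
          t m * (t m powr (1 - \<alpha>) - (t m - t p) powr (1 - \<alpha>))" by (simp add: algebra_simps)
      have "((t m - t p) / t p) powr (1 - \<alpha>) = (t m - t p) powr (1 - \<alpha>) * t p * t p powr (\<alpha> - 2)"
      proof -
        have "t p * t p powr (\<alpha> - 2) = t p powr (\<alpha> - 1)"
          using tp powr_add[of "t p" 1 "\<alpha> - 2"] by simp
        also have "\<dots> = 1 / t p powr (1 - \<alpha>)" using powr_minus_divide[of "t p" "1 - \<alpha>"] by simp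
        finally have "t p * t p powr (\<alpha> - 2) = 1 / t p powr (1 - \<alpha>)" .
        then show ?thesis using tp tpm by (simp only: powr_divide mult.assoc) simp
      qed
      then have "((t m - t p) / t p) powr (1 - \<alpha>) / t m =
          t p powr (\<alpha> - 2) * ((1 - \<alpha>) * t p * (t m - t p) powr (1 - \<alpha>)) / (t m * (1 - \<alpha>))"
        using \<alpha> by simp
      also have "\<dots> \<le> t p powr (\<alpha> - 2) * (t m * (t m powr (1 - \<alpha>) - (t m - t p) powr (1 - \<alpha>))) / (t m * (1 - \<alpha>))"
        using le tm \<alpha> by (intro divide_right_mono mult_left_mono) auto
      finally show ?thesis using tm by simp
    qed
    have split: "(\<Sum>j=1..m. (V j - V (j - 1)) * avg_kernel \<alpha> t m j) =
        (\<Sum>j=1..p. (V j - V (j - 1)) * avg_kernel \<alpha> t m j) + (\<Sum>j=p+1..m. (V j - V (j - 1)) * avg_kernel \<alpha> t m j)"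
      using sum.ub_add_nat[of 1 p "\<lambda>j. (V j - V (j - 1)) * avg_kernel \<alpha> t m j" "m - p"] p by simp
    have first: "(\<Sum>j=1..p. (V j - V (j - 1)) * avg_kernel \<alpha> t m j) =
        t p powr (\<alpha> - 2) * (t m powr (1 - \<alpha>) - (t m - t p) powr (1 - \<alpha>)) / (1 - \<alpha>)"
    proof -
      have "V j = t j * t p powr (\<alpha> - 2)" if "j \<le> p" for j
        using mesh_mono[OF mesh that] p by (simp add: V_def base_barrier_def)
      then have "(\<Sum>j=1..p. (V j - V (j - 1)) * avg_kernel \<alpha> t m j) =
          (\<Sum>j=1..p. (t j * t p powr (\<alpha> - 2) - t (j - 1) * t p powr (\<alpha> - 2)) * avg_kernel \<alpha> t m j)"
        by (intro sum.cong refl) auto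
      then show ?thesis
        using L1_initial_segment[OF \<alpha> mesh p(2,3), of "t p powr (\<alpha> - 2)"] by simp
    qed
    have rest: "(\<Sum>j=p+1..m. (V j - V (j - 1)) * avg_kernel \<alpha> t m j) \<ge> (\<Sum>j=p+1..m. J j - X j)"
    proof (intro sum_mono)
      fix j assume j: "j \<in> {p+1..m}"
      have "V j = t j powr (\<alpha> - 1)" "V (j - 1) = t (j - 1) powr (\<alpha> - 1)"
        using tj[OF j] tp by (auto simp: V_def base_barrier_ge)
      moreover have "a - \<bar>a - b\<bar> \<le> b" for a b :: real by linarith
      ultimately show "J j - X j \<le> (V j - V (j - 1)) * avg_kernel \<alpha> t m j"
        unfolding X_def by simp
    qed
    have "(\<Sum>j=1..m. (V j - V (j - 1)) * avg_kernel \<alpha> t m j) \<ge> - (2 * C * A * (t 1 / t m) powr \<eta> / t m)"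
      using init J_sum X_sum rest unfolding split first sum_subtractf by linarith
    then have "(\<Sum>j=1..m. (V j - V (j - 1)) * avg_kernel \<alpha> t m j) / Gamma (1 - \<alpha>) \<ge>
        - (2 * C * A * (t 1 / t m) powr \<eta> / t m) / Gamma (1 - \<alpha>)"
      using \<Gamma> by (intro divide_right_mono) auto
    then show "L1_op \<alpha> t (\<lambda>j. base_barrier \<alpha> (t p) (t j)) m \<ge>
        - (2 * C * A / Gamma (1 - \<alpha>)) * (t 1 / t m) powr \<eta> / t m"
      using L1_op_eq[OF \<alpha> mesh p(3), of V] unfolding V_def by (simp add: mult_ac)
  qed
qed

text \<open>The weights telescope to a difference of two kernel means, taken at the extreme nodes of
  the window. Each extreme node lies within one step \<open>h\<close> of its end of the window, and
  \<open>x + h \<le> y - h\<close> ensures that the window contains a node.\<close>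

lemma L1_weight_window_sum:
  assumes \<alpha>: "0 < \<alpha>" "\<alpha> < 1" and mesh: "temporal_mesh T M t" and m: "m \<le> M"
    and xy: "0 < x" "0 < h" "x + h \<le> y - h" "y < t m"
    and step: "\<And>j. j \<in> {1..m} \<Longrightarrow> t j - t (j - 1) \<le> h"
  shows "((x + h) powr (- \<alpha>) - (y - h) powr (- \<alpha>)) / Gamma (1 - \<alpha>) \<le>
     (\<Sum>j | j < m \<and> t m - y \<le> t j \<and> t j \<le> t m - x. L1_weight \<alpha> t m j)"
proof -
  define q where "q = (LEAST j. t m - y \<le> t j)"
  have "t m - y \<le> t m" using xy by simp
  then have q: "t m - y \<le> t q" "q \<le> m"
    unfolding q_def by (rule LeastI, rule Least_le)
  have "q \<noteq> 0" using q xy mesh_0[OF mesh] by (intro notI) simp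
  then have q1: "1 \<le> q" by simp
  have "t (q - 1) < t m - y"
    using not_less_Least[of "q - 1" "\<lambda>j. t m - y \<le> t j"] q1 unfolding q_def[symmetric] by force
  then have q_up: "t q < t m - y + h" using step[of q] q q1 by simp
  define n where "n = (GREATEST j. j \<le> m \<and> t j \<le> t m - x)"
  have ex: "0 \<le> m \<and> t 0 \<le> t m - x" using xy mesh_0[OF mesh] by simp
  have n: "n \<le> m \<and> t n \<le> t m - x"
    unfolding n_def by (rule GreatestI_nat[where P = "\<lambda>j. j \<le> m \<and> t j \<le> t m - x", OF ex, of m]) auto
  then have nm: "n < m" using xy by (cases "n = m") auto
  have "\<not> t (Suc n) \<le> t m - x"
  proof
    assume "t (Suc n) \<le> t m - x"
    then have "Suc n \<le> n"
      unfolding n_def using nm by (intro Greatest_le_nat[where b = m]) (auto simp: n_def)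
    then show False by simp
  qed
  then have n_low: "t n > t m - x - h" using step[of "Suc n"] nm by force
  have "\<not> n < q" using mesh_mono[OF mesh, of n q] q_up n_low xy q m by auto
  then have qn: "q \<le> n" by simp
  have "(x + h) powr (- \<alpha>) \<le> (t m - t n) powr (- \<alpha>)"
    using n n_low xy \<alpha> by (intro powr_mono2') auto
  also have "\<dots> \<le> avg_kernel \<alpha> t m (Suc n)"
    using avg_kernel_bounds(1)[OF \<alpha> mesh m, of "Suc n"] nm by simp
  finally have up: "(x + h) powr (- \<alpha>) \<le> avg_kernel \<alpha> t m (Suc n)" .
  have "avg_kernel \<alpha> t m q \<le> (t m - t q) powr (- \<alpha>)"
    using avg_kernel_bounds(2)[OF \<alpha> mesh m, of q] q1 qn nm by simp
  also have "\<dots> \<le> (y - h) powr (- \<alpha>)"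
    using q_up xy \<alpha> by (intro powr_mono2') auto
  finally have lo: "avg_kernel \<alpha> t m q \<le> (y - h) powr (- \<alpha>)" .
  have "((x + h) powr (- \<alpha>) - (y - h) powr (- \<alpha>)) / Gamma (1 - \<alpha>) \<le>
      (avg_kernel \<alpha> t m (Suc n) - avg_kernel \<alpha> t m q) / Gamma (1 - \<alpha>)"
    using up lo Gamma_1_minus_pos[OF \<alpha>(2)] by (intro divide_right_mono) auto
  also have "\<dots> = (\<Sum>j=q..n. L1_weight \<alpha> t m j)"
    using qn q1 sum_Suc_diff[of q n "avg_kernel \<alpha> t m"]
    by (simp add: L1_weight_def flip: sum_divide_distrib)
  also have "\<dots> \<le> (\<Sum>j | j < m \<and> t m - y \<le> t j \<and> t j \<le> t m - x. L1_weight \<alpha> t m j)"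
  proof (intro sum_mono2)
    show "{q..n} \<subseteq> {j. j < m \<and> t m - y \<le> t j \<and> t j \<le> t m - x}"
    proof
      fix j assume j: "j \<in> {q..n}"
      then show "j \<in> {j. j < m \<and> t m - y \<le> t j \<and> t j \<le> t m - x}"
        using mesh_mono[OF mesh, of q j] mesh_mono[OF mesh, of j n] q n nm m by auto
    qed
  qed (use L1_weight_nonneg[OF \<alpha> mesh m] in auto)
  finally show ?thesis .
qed

lemma base_barrier_le:
  assumes "\<alpha> < 1" "P > 0" "s > 0"
  shows "base_barrier \<alpha> P s \<le> s powr (\<alpha> - 1)"
proof (cases "s \<le> P")
  case True
  have "s * P powr (\<alpha> - 2) \<le> s * s powr (\<alpha> - 2)"
    using True assms by (intro mult_left_mono powr_mono2') auto
  also have "\<dots> = s powr (\<alpha> - 1)" using assms powr_add[of s 1 "\<alpha> - 2"] by simp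
  finally show ?thesis using True by (simp add: base_barrier_def)
qed (simp add: base_barrier_def)

lemma base_barrier_half_ge:
  assumes "\<alpha> < 1" "P > 0" "P \<le> x" "x / 4 \<le> s" "s \<le> x"
  shows "x powr (\<alpha> - 1) / 4 \<le> base_barrier \<alpha> P s"
proof (cases "s \<le> P")
  case True
  have "x powr (\<alpha> - 1) / 4 = x / 4 * x powr (\<alpha> - 2)"
    using assms powr_add[of x 1 "\<alpha> - 2"] by simp
  also have "\<dots> \<le> s * P powr (\<alpha> - 2)"
    using assms by (intro mult_mono powr_mono2') auto
  finally show ?thesis using True by (simp add: base_barrier_def)
next
  case False
  have "x powr (\<alpha> - 1) \<le> s powr (\<alpha> - 1)" using False assms by (intro powr_mono2') auto
  moreover have "x powr (\<alpha> - 1) / 4 \<le> x powr (\<alpha> - 1)" by simp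
  ultimately have "x powr (\<alpha> - 1) / 4 \<le> s powr (\<alpha> - 1)" by (rule order_trans[rotated])
  then show ?thesis using False by (simp add: base_barrier_def)
qed

text \<open>Only nodes between \<open>t m / 4\<close> and \<open>t m / 2\<close> are kept. Their
  weights add up to order \<open>t m powr (- \<alpha>)\<close>, the barrier is at least
  \<open>t m powr (\<alpha> - 1) / 4\<close> there, and \<open>\<Psi>\<close> has not yet passed its
  value at \<open>t m / 2\<close>. The numbers 17/32 and 23/32 are 1/2 + 1/32 and 3/4 - 1/32, with a
  margin of one step.\<close>

lemma weighted_increment_sum_ge:
  fixes \<alpha> :: real and \<Psi> :: "real \<Rightarrow> real"
  defines "\<kappa> \<equiv> ((17 / 32) powr (- \<alpha>) - (23 / 32) powr (- \<alpha>)) / (4 * Gamma (1 - \<alpha>))"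
  assumes \<alpha>: "0 < \<alpha>" "\<alpha> < 1" and mesh: "temporal_mesh T M t" and m: "1 \<le> m" "m \<le> M"
    and P: "0 < P" "P \<le> t m"
    and step: "\<And>j. j \<in> {1..m} \<Longrightarrow> t j - t (j - 1) \<le> t m / 32"
    and mono: "\<And>a b. 0 < a \<Longrightarrow> a \<le> b \<Longrightarrow> \<Psi> a \<le> \<Psi> b"
  shows "\<kappa> / t m * (\<Psi> (t m) - \<Psi> (t m / 2)) \<le>
     (\<Sum>j<m. L1_weight \<alpha> t m j * ((\<Psi> (t m) - \<Psi> (t j)) * base_barrier \<alpha> P (t j)))"
proof -
  define x where "x = t m"
  have x: "x > 0" using P by (simp add: x_def)
  define J where "J = {j. j < m \<and> t m - 3 / 4 * x \<le> t j \<and> t j \<le> t m - x / 2}"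
  have "((x / 2 + x / 32) powr (- \<alpha>) - (3 / 4 * x - x / 32) powr (- \<alpha>)) / Gamma (1 - \<alpha>) \<le>
     (\<Sum>j\<in>J. L1_weight \<alpha> t m j)"
    unfolding J_def using x step by (intro L1_weight_window_sum[OF \<alpha> mesh m(2)]) (auto simp: x_def)
  moreover have "(x / 2 + x / 32) powr (- \<alpha>) = (17 / 32) powr (- \<alpha>) * x powr (- \<alpha>)"
    "(3 / 4 * x - x / 32) powr (- \<alpha>) = (23 / 32) powr (- \<alpha>) * x powr (- \<alpha>)"
    using x by (auto simp flip: powr_mult)
  moreover have "4 * \<kappa> = ((17 / 32) powr (- \<alpha>) - (23 / 32) powr (- \<alpha>)) / Gamma (1 - \<alpha>)"
    by (simp add: \<kappa>_def del: right_diff_distrib_numeral)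
  ultimately have wsum: "4 * \<kappa> * x powr (- \<alpha>) \<le> (\<Sum>j\<in>J. L1_weight \<alpha> t m j)"
    by (simp add: left_diff_distrib)
  have d: "0 \<le> \<Psi> x - \<Psi> (x / 2)" using mono[of "x / 2" x] x by simp
  have "x powr (- \<alpha>) * x powr (\<alpha> - 1) = 1 / x"
    unfolding powr_add[symmetric] using powr_minus_divide[of x 1] x by simp
  then have "\<kappa> / x * (\<Psi> x - \<Psi> (x / 2)) = 4 * \<kappa> * x powr (- \<alpha>) * ((\<Psi> x - \<Psi> (x / 2)) * (x powr (\<alpha> - 1) / 4))"
    by (simp add: mult_ac) (simp add: mult.assoc[symmetric])
  also have "\<dots> \<le> (\<Sum>j\<in>J. L1_weight \<alpha> t m j) * ((\<Psi> x - \<Psi> (x / 2)) * (x powr (\<alpha> - 1) / 4))"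
    using wsum d by (intro mult_right_mono) auto
  also have "\<dots> = (\<Sum>j\<in>J. L1_weight \<alpha> t m j * ((\<Psi> x - \<Psi> (x / 2)) * (x powr (\<alpha> - 1) / 4)))"
    by (simp add: sum_distrib_right)
  also have "\<dots> \<le> (\<Sum>j\<in>J. L1_weight \<alpha> t m j * ((\<Psi> x - \<Psi> (t j)) * base_barrier \<alpha> P (t j)))"
  proof (intro sum_mono mult_left_mono)
    fix j assume j: "j \<in> J"
    then have tj: "x / 4 \<le> t j" "t j \<le> x / 2" "t j > 0" using x by (auto simp: J_def x_def)
    have "x powr (\<alpha> - 1) / 4 \<le> base_barrier \<alpha> P (t j)"
      using P tj x \<alpha> by (intro base_barrier_half_ge) (auto simp: x_def)
    moreover have "\<Psi> (t j) \<le> \<Psi> (x / 2)" using mono[of "t j" "x / 2"] tj by simp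
    ultimately show "(\<Psi> x - \<Psi> (x / 2)) * (x powr (\<alpha> - 1) / 4) \<le> (\<Psi> x - \<Psi> (t j)) * base_barrier \<alpha> P (t j)"
      using d by (intro mult_mono) auto
    show "0 \<le> L1_weight \<alpha> t m j" using j L1_weight_nonneg[OF \<alpha> mesh m(2)] by (simp add: J_def)
  qed
  also have "\<dots> \<le> (\<Sum>j<m. L1_weight \<alpha> t m j * ((\<Psi> x - \<Psi> (t j)) * base_barrier \<alpha> P (t j)))"
  proof (intro sum_mono2)
    fix j assume "j \<in> {..<m} - J"
    then have j: "j < m" by simp
    show "0 \<le> L1_weight \<alpha> t m j * ((\<Psi> x - \<Psi> (t j)) * base_barrier \<alpha> P (t j))"
    proof (cases "j = 0")
      case True then show ?thesis using P mesh by (simp add: base_barrier_def)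
    next
      case False
      then have "0 < t j" "t j \<le> x"
        using mesh_pos[OF mesh, of j] mesh_mono[OF mesh, of j m] j m by (auto simp: x_def)
      then show ?thesis
        using mono[of "t j" x] L1_weight_nonneg[OF \<alpha> mesh m(2) j] base_barrier_nonneg[of "t j"] by simp
    qed
  qed (auto simp: J_def)
  finally show ?thesis by (simp add: x_def)
qed

text \<open>Only nodes at distance between \<open>1 / (2 * \<mu>)\<close> and
  \<open>1 / \<mu>\<close> from \<open>t m\<close> are kept. Their weights add up to order
  \<open>\<mu> powr \<alpha>\<close>, and the exponential is smaller there by at least a third. The
  numbers 5/8 and 7/8 are 1/2 + 1/8 and 1 - 1/8, with a margin of one step.\<close>

lemma exponential_increment_sum_ge:
  fixes \<alpha> \<mu> D :: real and \<Psi> :: "real \<Rightarrow> real"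
  defines "\<kappa> \<equiv> ((5 / 8) powr (- \<alpha>) - (7 / 8) powr (- \<alpha>)) / Gamma (1 - \<alpha>)"
  assumes \<alpha>: "0 < \<alpha>" "\<alpha> < 1" and mesh: "temporal_mesh T M t" and m: "1 \<le> m" "m \<le> M"
    and P: "0 < P" "P \<le> 1 / \<mu>" and \<mu>: "\<mu> > 0" "2 / \<mu> \<le> t m"
    and step: "\<And>j. j \<in> {1..m} \<Longrightarrow> t j - t (j - 1) \<le> 1 / (8 * \<mu>)"
    and mono: "\<And>a b. 0 < a \<Longrightarrow> a \<le> b \<Longrightarrow> \<Psi> a \<le> \<Psi> b" and pos: "\<And>a. 0 < a \<Longrightarrow> 0 < \<Psi> a"
    and D: "D > 0" "\<Psi> (t m) \<le> D * \<Psi> (t m / 2)"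
  shows "\<kappa> / (3 * D) * \<mu> powr \<alpha> * (exp (\<mu> * t m) * (\<Psi> (t m) * base_barrier \<alpha> P (t m))) \<le>
     (\<Sum>j<m. L1_weight \<alpha> t m j * ((exp (\<mu> * t m) - exp (\<mu> * t j)) * (\<Psi> (t j) * base_barrier \<alpha> P (t j))))"
proof -
  define x where "x = t m"
  have x: "x > 0" "2 / \<mu> \<le> x" using \<mu> by (auto simp: x_def less_le_trans[of 0 "2 / \<mu>"])
  define J where "J = {j. j < m \<and> t m - 1 / \<mu> \<le> t j \<and> t j \<le> t m - 1 / (2 * \<mu>)}"
  have "((1 / (2 * \<mu>) + 1 / (8 * \<mu>)) powr (- \<alpha>) - (1 / \<mu> - 1 / (8 * \<mu>)) powr (- \<alpha>)) / Gamma (1 - \<alpha>) \<le>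
     (\<Sum>j\<in>J. L1_weight \<alpha> t m j)"
    unfolding J_def using \<mu> x step
    by (intro L1_weight_window_sum[OF \<alpha> mesh m(2)]) (auto simp: x_def field_simps)
  moreover have "1 / (2 * \<mu>) + 1 / (8 * \<mu>) = 5 / 8 * (1 / \<mu>)" "1 / \<mu> - 1 / (8 * \<mu>) = 7 / 8 * (1 / \<mu>)"
    using \<mu> by (auto simp: field_simps)
  moreover have "(1 / \<mu>) powr (- \<alpha>) = \<mu> powr \<alpha>"
    using \<mu> by (simp add: powr_divide powr_minus_divide)
  ultimately have wsum: "\<kappa> * \<mu> powr \<alpha> \<le> (\<Sum>j\<in>J. L1_weight \<alpha> t m j)"
    by (simp only: powr_mult) (simp add: \<kappa>_def left_diff_distrib)
  define Y where "Y = exp (\<mu> * x) / 3 * (\<Psi> x / D * base_barrier \<alpha> P x)"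
  have Y: "Y \<ge> 0" unfolding Y_def using pos[of x] x D base_barrier_nonneg[of x] by simp
  have "\<kappa> / (3 * D) * \<mu> powr \<alpha> * (exp (\<mu> * x) * (\<Psi> x * base_barrier \<alpha> P x)) = \<kappa> * \<mu> powr \<alpha> * Y"
    by (simp add: Y_def)
  also have "\<dots> \<le> (\<Sum>j\<in>J. L1_weight \<alpha> t m j) * Y"
    using wsum Y by (intro mult_right_mono) auto
  also have "\<dots> = (\<Sum>j\<in>J. L1_weight \<alpha> t m j * Y)"
    by (simp add: sum_distrib_right)
  also have "\<dots> \<le> (\<Sum>j\<in>J. L1_weight \<alpha> t m j * ((exp (\<mu> * x) - exp (\<mu> * t j)) * (\<Psi> (t j) * base_barrier \<alpha> P (t j))))"
  proof (intro sum_mono mult_left_mono)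
    fix j assume j: "j \<in> J"
    then have tj: "x - 1 / \<mu> \<le> t j" "t j \<le> x - 1 / (2 * \<mu>)" by (auto simp: J_def x_def)
    \<comment> \<open>As \<open>x \<ge> 2 / \<mu>\<close> and \<open>P \<le> 1 / \<mu>\<close>,
      going back from \<open>x\<close> by \<open>1 / \<mu>\<close> stays above both
      \<open>x / 2\<close> and \<open>P\<close>.\<close>
    have "2 / \<mu> = 2 * (1 / \<mu>)" by simp
    then have half: "x / 2 \<le> t j" and Pj: "P \<le> t j" using tj P x by linarith+
    have "P \<le> x" using Pj tj \<mu> by (smt (verit) divide_pos_pos)
    have "\<mu> * t j \<le> \<mu> * x - 1 / 2"
      using mult_left_mono[OF tj(2), of \<mu>] \<mu> by (simp add: right_diff_distrib)
    then have "exp (\<mu> * t j) \<le> exp (\<mu> * x) * exp (- (1 / 2))" by (simp flip: exp_add)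
    also have "\<dots> \<le> exp (\<mu> * x) * (2 / 3)"
    proof (intro mult_left_mono)
      have "3 / 2 \<le> exp (1 / 2 :: real)" using exp_ge_add_one_self[of "1 / 2 :: real"] by simp
      then have "inverse (exp (1 / 2)) \<le> inverse (3 / 2 :: real)" by (intro le_imp_inverse_le) auto
      then show "exp (- (1 / 2)) \<le> (2 / 3 :: real)" by (simp add: exp_minus)
    qed auto
    finally have e: "exp (\<mu> * x) / 3 \<le> exp (\<mu> * x) - exp (\<mu> * t j)" by simp
    then have e0: "0 \<le> exp (\<mu> * x) - exp (\<mu> * t j)" using exp_gt_zero[of "\<mu> * x"] by linarith
    have "\<Psi> x / D \<le> \<Psi> (x / 2)" using D by (simp add: x_def field_simps)
    also have "\<dots> \<le> \<Psi> (t j)" using mono half x by simp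
    finally have \<Psi>: "\<Psi> x / D \<le> \<Psi> (t j)" .
    have "x powr (\<alpha> - 1) \<le> t j powr (\<alpha> - 1)"
      using tj P Pj \<mu> \<alpha> by (intro powr_mono2') (auto intro: order_trans)
    then have "base_barrier \<alpha> P x \<le> base_barrier \<alpha> P (t j)"
      using P Pj \<open>P \<le> x\<close> by (simp add: base_barrier_ge)
    then show "Y \<le> (exp (\<mu> * x) - exp (\<mu> * t j)) * (\<Psi> (t j) * base_barrier \<alpha> P (t j))"
      unfolding Y_def using e \<Psi> pos[of x] D x half pos[of "t j"] base_barrier_nonneg[of x] base_barrier_nonneg[of "t j"]
      by (intro mult_mono mult_nonneg_nonneg e0) auto
    show "0 \<le> L1_weight \<alpha> t m j" using j L1_weight_nonneg[OF \<alpha> mesh m(2)] by (simp add: J_def)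
  qed
  also have "\<dots> \<le> (\<Sum>j<m. L1_weight \<alpha> t m j * ((exp (\<mu> * x) - exp (\<mu> * t j)) * (\<Psi> (t j) * base_barrier \<alpha> P (t j))))"
  proof (intro sum_mono2)
    fix j assume "j \<in> {..<m} - J"
    then have j: "j < m" by simp
    show "0 \<le> L1_weight \<alpha> t m j * ((exp (\<mu> * x) - exp (\<mu> * t j)) * (\<Psi> (t j) * base_barrier \<alpha> P (t j)))"
    proof (cases "j = 0")
      case True then show ?thesis using P mesh by (simp add: base_barrier_def)
    next
      case False
      then have "0 < t j" "t j \<le> x"
        using mesh_pos[OF mesh, of j] mesh_mono[OF mesh, of j m] j m by (auto simp: x_def)
      then show ?thesis
        using pos[of "t j"] L1_weight_nonneg[OF \<alpha> mesh m(2) j] base_barrier_nonneg[of "t j"] \<mu>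
        by (intro mult_nonneg_nonneg) auto
    qed
  qed (auto simp: J_def)
  finally show ?thesis by (simp add: x_def)
qed

section \<open>Supersolutions of the L1 operator\<close>

lemma powr_eventually_large:
  fixes a B :: real
  assumes "a > 0"
  shows "\<exists>x0>0. \<forall>x\<ge>x0. B \<le> x powr a"
proof (intro exI[of _ "(max 1 B) powr (1 / a)"] conjI allI impI)
  fix x assume "x \<ge> (max 1 B) powr (1 / a)"
  then have "((max 1 B) powr (1 / a)) powr a \<le> x powr a"
    using assms by (intro powr_mono2) auto
  then show "B \<le> x powr a" using assms by (simp add: powr_powr)
qed simp

lemma powr_eventually_small:
  fixes a B :: real
  assumes "a > 0"
  shows "\<exists>\<delta>>0. \<forall>x. 0 < x \<longrightarrow> x \<le> \<delta> \<longrightarrow> B * x powr a \<le> 1"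
proof -
  obtain x0 where x0: "x0 > 0" "\<forall>x\<ge>x0. B \<le> x powr a" using powr_eventually_large[OF assms] by blast
  show ?thesis
  proof (intro exI[of _ "1 / x0"] conjI allI impI)
    fix x assume x: "0 < x" "x \<le> 1 / x0"
    then have "x0 \<le> 1 / x" using x0 by (simp add: field_simps)
    then have "B \<le> (1 / x) powr a" using x0 by blast
    then show "B * x powr a \<le> 1" using x by (simp add: powr_divide field_simps)
  qed (use x0 in simp)
qed

text \<open>Provides the breakpoint \<open>P\<close> of the barrier as a node, so that the linear
  branch is resolved exactly. The bounded ratio of consecutive nodes keeps it comparable with
  \<open>t 1\<close>.\<close>

lemma graded_mesh_first_node_ge:
  assumes g: "graded_mesh c r T M t" and "r \<ge> 1" "c > 0" and K: "K > 1" "K * t 1 \<le> T"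
  obtains p where "2 \<le> p" "p \<le> M" "K * t 1 \<le> t p" "t p \<le> max 2 ((2 * c) powr r) * K * t 1"
    "\<And>m. m < p \<Longrightarrow> t m < K * t 1"
proof
  define p where "p = (LEAST j. K * t 1 \<le> t j)"
  have "K * t 1 \<le> t M" using K graded_mesh_temporal[OF g] by (simp add: temporal_mesh_def)
  then show p: "K * t 1 \<le> t p" "p \<le> M" unfolding p_def by (rule LeastI, rule Least_le)
  show less: "t m < K * t 1" if "m < p" for m
    using not_less_Least[of m "\<lambda>j. K * t 1 \<le> t j"] that unfolding p_def by force
  have t1: "t 1 > 0" using graded_mesh_first_pos[OF g] .
  then have "t 1 < K * t 1" "0 < K * t 1" using K by auto
  moreover have "t 0 = 0" by (rule mesh_0[OF graded_mesh_temporal[OF g]])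
  ultimately have "p \<noteq> 0" "p \<noteq> 1" using p(1) by (metis not_less)+
  then show p2: "2 \<le> p" by simp
  have "t p \<le> max 2 ((2 * c) powr r) * t (p - 1)"
    using graded_mesh_ratio[OF g assms(2,3) p2 p(2)] .
  also have "\<dots> \<le> max 2 ((2 * c) powr r) * (K * t 1)"
    using less[of "p - 1"] p2 by (intro mult_left_mono) auto
  finally show "t p \<le> max 2 ((2 * c) powr r) * K * t 1" by (simp add: mult.assoc)
qed

text \<open>Up to \<open>P\<close> the barrier increases; beyond \<open>P\<close> it decreases, but
  over one step at most by a power of the ratio of consecutive nodes. The delayed term
  \<open>l1 * W (m - 1)\<close> can thus be charged to \<open>W m\<close>.\<close>

lemma base_barrier_prev_le:
  assumes g: "graded_mesh c r T M t" and "r \<ge> 1" "c > 0" and \<alpha>: "0 < \<alpha>" "\<alpha> < 1" and P: "0 < P"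
    and m: "1 \<le> m" "m \<le> M"
  shows "base_barrier \<alpha> P (t (m - 1)) \<le> max 2 ((2 * c) powr r) * base_barrier \<alpha> P (t m)"
proof -
  define \<rho> where "\<rho> = max 2 ((2 * c) powr r)"
  note mesh = graded_mesh_temporal[OF g]
  have \<rho>: "\<rho> \<ge> 1" by (simp add: \<rho>_def)
  have tm: "t (m - 1) < t m" "0 \<le> t (m - 1)" "0 < t m"
    using mesh_step[OF mesh, of m] mesh_nonneg[OF mesh, of "m - 1"] mesh_pos[OF mesh, of m] m by auto
  have V: "base_barrier \<alpha> P (t m) \<ge> 0" using base_barrier_nonneg tm by simp
  show ?thesis unfolding \<rho>_def[symmetric]
  proof (cases "t m \<le> P")
    case True
    then have "base_barrier \<alpha> P (t (m - 1)) \<le> base_barrier \<alpha> P (t m)"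
      using tm by (simp add: base_barrier_def mult_right_mono)
    also have "\<dots> \<le> \<rho> * base_barrier \<alpha> P (t m)" using V \<rho> mult_right_mono[of 1 \<rho>] by simp
    finally show "base_barrier \<alpha> P (t (m - 1)) \<le> \<rho> * base_barrier \<alpha> P (t m)" .
  next
    case False
    show "base_barrier \<alpha> P (t (m - 1)) \<le> \<rho> * base_barrier \<alpha> P (t m)"
    proof (cases "m = 1")
      case True
      then show ?thesis using P mesh V \<rho> by (simp add: base_barrier_def)
    next
      case m1: False
      then have pos: "0 < t (m - 1)" using mesh_pos[OF mesh, of "m - 1"] m by simp
      have ratio: "t m \<le> \<rho> * t (m - 1)"
        using graded_mesh_ratio[OF g assms(2,3), of m] m m1 by (simp add: \<rho>_def)
      have "base_barrier \<alpha> P (t (m - 1)) \<le> t (m - 1) powr (\<alpha> - 1)"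
        using base_barrier_le[OF \<alpha>(2) P pos] .
      also have "\<dots> \<le> \<rho> powr \<bar>\<alpha> - 1\<bar> * t m powr (\<alpha> - 1)"
        using powr_ratio_bound(2)[OF pos _ ratio] tm by simp
      also have "\<dots> \<le> \<rho> powr 1 * t m powr (\<alpha> - 1)"
        using \<rho> \<alpha> by (intro mult_right_mono powr_mono) auto
      finally show ?thesis using False \<rho> P by (simp add: base_barrier_ge)
    qed
  qed
qed

text \<open>
  The supersolution is \<open>exp (\<mu> s) (1 + s powr (\<alpha> / 2)) \<Phi> s V s\<close> with the base barrier \<open>V\<close>.
  Multiplication by a nondecreasing function adds a nonnegative term to the L1 operator: the
  increments of \<open>\<Phi>\<close> produce the right-hand side, those of \<open>s powr (\<alpha> / 2)\<close> absorb the
  zeroth-order terms for \<open>s \<le> 2 / \<mu>\<close>, and those of \<open>exp (\<mu> s)\<close> absorb them for \<open>s \<ge> 2 / \<mu>\<close>.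
\<close>
theorem L1_supersolution:
  fixes \<alpha> c r T l0 l1 \<eta> \<epsilon> D :: real
  assumes \<alpha>: "0 < \<alpha>" "\<alpha> < 1" and r: "r \<ge> 1" and c: "c > 0" and T: "T > 0"
    and l: "l0 \<ge> 0" "l1 \<ge> 0" and \<eta>: "0 < \<eta>" "\<eta> < \<alpha>" "\<eta> \<le> 1 / r" and \<epsilon>: "\<epsilon> > 0" and D: "D \<ge> 1"
  shows "\<exists>K\<ge>2. \<exists>K'>0. \<exists>\<delta>>0. \<exists>\<kappa>>0. \<exists>B>0. \<forall>M t. graded_mesh c r T M t \<longrightarrow> t 1 \<le> \<delta> \<longrightarrow>
     (\<exists>P. K * t 1 \<le> P \<and> P \<le> K' * t 1 \<and> P \<le> T \<and>
        (\<forall>\<Phi> :: real \<Rightarrow> real. (\<forall>s>0. \<Phi> s > 0) \<longrightarrow> (\<forall>a>0. \<forall>b\<ge>a. \<Phi> a \<le> \<Phi> b) \<longrightarrow>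
          (\<forall>s\<in>{P..T}. \<Phi> s \<le> D * \<Phi> (s / 2) \<and> \<Phi> s - \<Phi> (s / 2) \<ge> \<epsilon> * (P / s) powr \<eta> * \<Phi> s) \<longrightarrow>
          (\<exists>W. W 0 = 0 \<and> (\<forall>m\<in>{1..M}. W m \<le> B * \<Phi> (t m) * t m powr (\<alpha> - 1) \<and>
             L1_op \<alpha> t W m - l0 * W m - l1 * W (m - 1) \<ge>
               \<kappa> / t m * (if t m < P then \<Phi> (t m) else \<Phi> (t m) - \<Phi> (t m / 2))))))"
proof -
  define \<rho> where "\<rho> = max 2 ((2 * c) powr r)"
  \<comment> \<open>The zeroth-order term, of size \<open>x powr (\<alpha> - 1)\<close>, is smaller
    than the gain \<open>x powr b / x\<close> by the factor \<open>x powr b\<close>.\<close>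
  define b where "b = \<alpha> / 2"
  define lam where "lam = l0 + l1 * \<rho>"
  define B0 where "B0 = 1 + T powr b"
  define c1 where "c1 = ((17 / 32) powr (- \<alpha>) - (23 / 32) powr (- \<alpha>)) / (4 * Gamma (1 - \<alpha>))"
  \<comment> \<open>The divisor \<open>6 * D\<close> is \<open>3 * (2 * D)\<close>: the product of
    \<open>\<Phi>\<close> with \<open>1 + s powr b\<close> grows at most by the factor
    \<open>2 * D\<close> from \<open>s / 2\<close> to \<open>s\<close>, as
    \<open>2 powr b \<le> 2\<close>.\<close>
  define c2 where "c2 = ((5 / 8) powr (- \<alpha>) - (7 / 8) powr (- \<alpha>)) / Gamma (1 - \<alpha>) / (6 * D)"
  define \<theta> where "\<theta> = 1 - 2 powr (- b)"
  have \<rho>: "\<rho> \<ge> 2" by (simp add: \<rho>_def)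
  have b: "0 < b" "b < 1" "b < \<alpha>" using \<alpha> by (auto simp: b_def)
  have lam: "lam \<ge> 0" using l \<rho> by (simp add: lam_def)
  have B0: "B0 \<ge> 1" by (simp add: B0_def)
  have \<Gamma>: "Gamma (1 - \<alpha>) > 0" "Gamma (2 - \<alpha>) > 0"
    using Gamma_1_minus_pos \<alpha> by (auto simp: Gamma_2_minus)
  have c1: "c1 > 0" unfolding c1_def using \<Gamma> powr_less_mono2_neg[of "- \<alpha>" "17 / 32" "23 / 32"] \<alpha> by simp
  have c2: "c2 > 0" unfolding c2_def using \<Gamma> powr_less_mono2_neg[of "- \<alpha>" "5 / 8" "7 / 8"] \<alpha> D by simp
  have \<theta>: "0 < \<theta>" "\<theta> < 1" unfolding \<theta>_def using b powr_less_mono[of "- b" 0 2] by auto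
  obtain C0 where C0: "C0 > 0" and V_ge: "\<And>M t p m. graded_mesh c r T M t \<Longrightarrow> 1 \<le> p \<Longrightarrow> p \<le> m \<Longrightarrow> m \<le> M \<Longrightarrow>
     L1_op \<alpha> t (\<lambda>j. base_barrier \<alpha> (t p) (t j)) m \<ge> - C0 * (t 1 / t m) powr \<eta> / t m"
    using L1_base_barrier_ge[OF \<alpha> r c \<eta>] by blast
  \<comment> \<open>The first bound lets the gain of the exponential absorb \<open>lam\<close> for
    \<open>x > 2 / \<mu>\<close>. The second lets the gain of \<open>s powr b\<close> do so for
    \<open>x \<le> 2 / \<mu>\<close>, where
    \<open>\<mu> powr b \<le> (2 / x) powr b\<close>.\<close>
  obtain \<mu> where \<mu>: "\<mu> > 0" and \<mu>1: "lam / c2 \<le> \<mu> powr \<alpha>"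
    and \<mu>2: "lam * B0 * 2 powr b / (c1 * \<theta>) \<le> \<mu> powr b"
  proof -
    obtain x1 where x1: "x1 > 0" "\<forall>x\<ge>x1. lam / c2 \<le> x powr \<alpha>" using powr_eventually_large \<alpha> by blast
    obtain x2 where x2: "x2 > 0" "\<forall>x\<ge>x2. lam * B0 * 2 powr b / (c1 * \<theta>) \<le> x powr b"
      using powr_eventually_large b by blast
    show thesis using x1 x2 by (intro that[of "max x1 x2"]) auto
  qed
  \<comment> \<open>The first bound keeps the defect of the base barrier below half of the gain of
    \<open>\<Phi>\<close>. The second keeps all steps up to a time \<open>x \<ge> P\<close> below
    \<open>x / 32\<close>, as \<open>weighted_increment_sum_ge\<close> requires.\<close>
  obtain K where K: "K \<ge> 2" and K1: "2 * C0 * B0 / (c1 * \<epsilon>) \<le> K powr \<eta>" and K2: "32 * c \<le> K powr (1 / r)"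
  proof -
    obtain x1 where x1: "x1 > 0" "\<forall>x\<ge>x1. 2 * C0 * B0 / (c1 * \<epsilon>) \<le> x powr \<eta>" using powr_eventually_large \<eta> by blast
    obtain x2 where x2: "x2 > 0" "\<forall>x\<ge>x2. 32 * c \<le> x powr (1 / r)"
      using powr_eventually_large[of "1 / r"] r by auto
    show thesis using x1 x2 by (intro that[of "max 2 (max x1 x2)"]) auto
  qed
  \<comment> \<open>In order: a node beyond \<open>K * t 1\<close> exists; \<open>P\<close> is at
    most \<open>1 / \<mu>\<close>; the quotient
    \<open>x powr (- \<alpha>) / Gamma (2 - \<alpha>)\<close> is at least \<open>2 * lam\<close> up
    to \<open>P\<close>; every step is at most \<open>1 / (8 * \<mu>)\<close>.\<close>
  obtain \<delta> where \<delta>: "\<delta> > 0" "K * \<delta> \<le> T" "\<rho> * K * \<delta> \<le> 1 / \<mu>"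
    and \<delta>1: "\<And>x. 0 < x \<Longrightarrow> x \<le> \<rho> * K * \<delta> \<Longrightarrow> 2 * lam * Gamma (2 - \<alpha>) * x powr \<alpha> \<le> 1"
    and \<delta>2: "\<And>x. 0 < x \<Longrightarrow> x \<le> \<delta> \<Longrightarrow> (8 * \<mu> * c * T powr (1 - 1 / r)) * x powr (1 / r) \<le> 1"
  proof -
    obtain d1 where d1: "d1 > 0" "\<forall>x. 0 < x \<longrightarrow> x \<le> d1 \<longrightarrow> 2 * lam * Gamma (2 - \<alpha>) * x powr \<alpha> \<le> 1"
      using powr_eventually_small \<alpha> by blast
    obtain d2 where d2: "d2 > 0" "\<forall>x. 0 < x \<longrightarrow> x \<le> d2 \<longrightarrow> (8 * \<mu> * c * T powr (1 - 1 / r)) * x powr (1 / r) \<le> 1"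
      using powr_eventually_small[of "1 / r"] r by auto
    define d where "d = min d2 (min (T / K) (min (1 / \<mu>) d1 / (\<rho> * K)))"
    have \<rho>K: "\<rho> * K > 0" using \<rho> K by simp
    have "d > 0" using d1 d2 T K \<mu> \<rho>K by (simp add: d_def)
    moreover have "d \<le> T / K" "d \<le> min (1 / \<mu>) d1 / (\<rho> * K)" "d \<le> d2" by (auto simp: d_def)
    then have "K * d \<le> T" "\<rho> * K * d \<le> min (1 / \<mu>) d1" "d \<le> d2"
      using K \<rho>K by (simp_all only: pos_le_divide_eq) (simp_all add: mult_ac pos_le_divide_eq)
    ultimately show thesis using d1(2) d2(2) by (intro that[of d]) (auto intro: order_trans)
  qed
  define \<kappa>1 where "\<kappa>1 = (\<rho> * K) powr (\<alpha> - 2) / (2 * Gamma (2 - \<alpha>))"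
  define \<kappa> where "\<kappa> = min (c1 / 2) \<kappa>1"
  define B where "B = exp (\<mu> * T) * B0"
  have \<kappa>1: "\<kappa>1 > 0" using \<Gamma> \<rho> K by (simp add: \<kappa>1_def)
  have "\<kappa> > 0" using c1 \<kappa>1 by (simp add: \<kappa>_def)
  have "B > 0" using B0 by (simp add: B_def)
  show ?thesis
  proof (rule exI[of _ K], intro conjI K, rule exI[of _ "\<rho> * K"], intro conjI,
      (use \<rho> K in simp), rule exI[of _ \<delta>], intro conjI \<delta>(1), rule exI[of _ \<kappa>], intro conjI \<open>\<kappa> > 0\<close>,
      rule exI[of _ B], intro conjI \<open>B > 0\<close> allI impI)
    fix M t assume g: "graded_mesh c r T M t" and t1\<delta>: "t 1 \<le> \<delta>"
    note mesh = graded_mesh_temporal[OF g]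
    have t1: "t 1 > 0" using graded_mesh_first_pos[OF g] .
    have K\<delta>: "K * t 1 \<le> K * \<delta>" "\<rho> * K * t 1 \<le> \<rho> * K * \<delta>" using t1\<delta> K \<rho> by (auto intro!: mult_left_mono)
    have K': "K > 1" "K * t 1 \<le> T" using K order_trans[OF K\<delta>(1) \<delta>(2)] by auto
    obtain p where p: "2 \<le> p" "p \<le> M" "K * t 1 \<le> t p" "t p \<le> \<rho> * K * t 1" "\<And>m. m < p \<Longrightarrow> t m < K * t 1"
      using graded_mesh_first_node_ge[OF g r c K'] unfolding \<rho>_def by metis
    define P where "P = t p"
    have P: "P > 0" "P \<le> T" "P \<le> 1 / \<mu>" "P \<le> \<rho> * K * \<delta>"
      using mesh_pos[OF mesh, of p] mesh_le_T[OF mesh, of p] p \<delta> K\<delta> by (auto simp: P_def)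
    show "\<exists>P. K * t 1 \<le> P \<and> P \<le> \<rho> * K * t 1 \<and> P \<le> T \<and>
        (\<forall>\<Phi> :: real \<Rightarrow> real. (\<forall>s>0. \<Phi> s > 0) \<longrightarrow> (\<forall>a>0. \<forall>b\<ge>a. \<Phi> a \<le> \<Phi> b) \<longrightarrow>
          (\<forall>s\<in>{P..T}. \<Phi> s \<le> D * \<Phi> (s / 2) \<and> \<Phi> s - \<Phi> (s / 2) \<ge> \<epsilon> * (P / s) powr \<eta> * \<Phi> s) \<longrightarrow>
          (\<exists>W. W 0 = 0 \<and> (\<forall>m\<in>{1..M}. W m \<le> B * \<Phi> (t m) * t m powr (\<alpha> - 1) \<and>
             L1_op \<alpha> t W m - l0 * W m - l1 * W (m - 1) \<ge>
               \<kappa> / t m * (if t m < P then \<Phi> (t m) else \<Phi> (t m) - \<Phi> (t m / 2)))))"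
    proof (rule exI[of _ P], intro conjI allI impI)
      show "K * t 1 \<le> P" "P \<le> \<rho> * K * t 1" "P \<le> T" using p P by (auto simp: P_def)
      fix \<Phi> :: "real \<Rightarrow> real"
      assume pos: "\<forall>s>0. \<Phi> s > 0" and mono: "\<forall>a>0. \<forall>b\<ge>a. \<Phi> a \<le> \<Phi> b"
        and \<Phi>: "\<forall>s\<in>{P..T}. \<Phi> s \<le> D * \<Phi> (s / 2) \<and> \<Phi> s - \<Phi> (s / 2) \<ge> \<epsilon> * (P / s) powr \<eta> * \<Phi> s"
      define V where "V j = base_barrier \<alpha> P (t j)" for j
      define \<Psi> where "\<Psi> s = \<Phi> s * (1 + s powr b)" for s
      define W where "W j = exp (\<mu> * t j) * (\<Psi> (t j) * V j)" for j
      have \<Psi>_pos: "\<Psi> a > 0" if "a > 0" for a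
        unfolding \<Psi>_def using pos that by (intro mult_pos_pos) (auto intro: add_pos_nonneg)
      have \<Psi>_mono: "\<Psi> x \<le> \<Psi> y" if "0 < x" "x \<le> y" for x y
        unfolding \<Psi>_def using pos mono that b
        by (intro mult_mono add_left_mono powr_mono2) (auto intro: less_imp_le)
      show "\<exists>W. W 0 = 0 \<and> (\<forall>m\<in>{1..M}. W m \<le> B * \<Phi> (t m) * t m powr (\<alpha> - 1) \<and>
             L1_op \<alpha> t W m - l0 * W m - l1 * W (m - 1) \<ge>
               \<kappa> / t m * (if t m < P then \<Phi> (t m) else \<Phi> (t m) - \<Phi> (t m / 2)))"
      proof (intro exI[of _ W] conjI ballI)
        show "W 0 = 0" using mesh P by (simp add: W_def V_def base_barrier_def)
        fix m assume m: "m \<in> {1..M}"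
        then have mM: "m \<le> M" "1 \<le> m" by auto
        define x where "x = t m"
        have x: "0 < x" "x \<le> T" "t 1 \<le> x"
          using mesh_pos[OF mesh, of m] mesh_le_T[OF mesh, of m] mesh_mono[OF mesh, of 1 m] m by (auto simp: x_def)
        have V0: "V j \<ge> 0" if "j \<le> M" for j
          unfolding V_def using mesh_nonneg[OF mesh that] by (rule base_barrier_nonneg)
        have xb: "x powr b \<le> T powr b" using x b by (intro powr_mono2) auto
        have \<Phi>x: "\<Phi> x > 0" using pos x by simp
        have Vx: "V m \<le> x powr (\<alpha> - 1)"
          unfolding V_def x_def[symmetric] using base_barrier_le \<alpha> P x by blast
        have Wm: "W m = exp (\<mu> * x) * (\<Psi> x * V m)" by (simp add: W_def x_def)
        have \<Psi>x: "\<Psi> x \<le> B0 * \<Phi> x"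
          unfolding \<Psi>_def B0_def using \<Phi>x xb by (simp add: mult.commute)
        have "W m \<le> exp (\<mu> * T) * (B0 * \<Phi> x * x powr (\<alpha> - 1))"
          unfolding Wm using \<mu> x \<Phi>x B0 Vx V0[OF mM(1)] \<Psi>x \<Psi>_pos[OF x(1)]
          by (intro mult_mono mult_nonneg_nonneg) auto
        then show "W m \<le> B * \<Phi> (t m) * t m powr (\<alpha> - 1)" by (simp add: B_def x_def mult_ac)
        have W0: "W j \<ge> 0" if "j \<le> M" for j
        proof (cases "j = 0")
          case False
          then show ?thesis unfolding W_def
            using \<Psi>_pos[of "t j"] mesh_pos[OF mesh, of j] V0[OF that] that by simp
        qed (use \<open>W 0 = 0\<close> in simp)
        have prev: "W (m - 1) \<le> \<rho> * W m"
        proof (cases "m = 1")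
          case True
          then show ?thesis using \<open>W 0 = 0\<close> W0[of m] \<rho> m by simp
        next
          case False
          then have prev: "0 < t (m - 1)" "t (m - 1) \<le> t m"
            using mesh_pos[OF mesh, of "m - 1"] mesh_mono[OF mesh, of "m - 1" m] m by auto
          have "V (m - 1) \<le> \<rho> * V m"
            unfolding V_def \<rho>_def using base_barrier_prev_le[OF g r c \<alpha> P(1)] m by simp
          then have "W (m - 1) \<le> exp (\<mu> * t m) * (\<Psi> (t m) * (\<rho> * V m))"
            unfolding W_def using prev \<mu> \<Psi>_mono[OF prev] \<Psi>_pos[OF prev(1)] V0[of "m - 1"] m
            by (intro mult_mono mult_nonneg_nonneg) auto
          then show ?thesis by (simp add: W_def mult_ac)
        qed
        have "l1 * W (m - 1) \<le> l1 * (\<rho> * W m)" using prev l by (intro mult_left_mono)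
        then have low: "l0 * W m + l1 * W (m - 1) \<le> lam * W m"
          by (simp add: lam_def algebra_simps)
        define S1 where "S1 = (\<Sum>j<m. L1_weight \<alpha> t m j * ((\<Psi> (t m) - \<Psi> (t j)) * V j))"
        define S2 where "S2 = (\<Sum>j<m. L1_weight \<alpha> t m j * ((exp (\<mu> * t m) - exp (\<mu> * t j)) * (\<Psi> (t j) * V j)))"
        \<comment> \<open>The product rule is applied twice: \<open>S2\<close> is the gain of the
          exponential, \<open>S1\<close> that of \<open>\<Psi>\<close>.\<close>
        have LW: "L1_op \<alpha> t W m = exp (\<mu> * x) * (\<Psi> x * L1_op \<alpha> t V m + S1) + S2"
          unfolding W_def[abs_def] L1_op_mult[OF \<alpha> mesh mM(1), of "\<lambda>j. exp (\<mu> * t j)"]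
            L1_op_mult[OF \<alpha> mesh mM(1), of "\<lambda>j. \<Psi> (t j)"] S1_def S2_def x_def ..
        have S_terms: "(\<Psi> (t m) - \<Psi> (t j)) * V j \<ge> 0 \<and>
            (exp (\<mu> * t m) - exp (\<mu> * t j)) * (\<Psi> (t j) * V j) \<ge> 0" if "j < m" for j
        proof (cases "j = 0")
          case True then show ?thesis using P mesh by (simp add: V_def base_barrier_def)
        next
          case False
          then have "0 < t j" "t j \<le> t m"
            using mesh_pos[OF mesh, of j] mesh_mono[OF mesh, of j m] that m by auto
          then show ?thesis
            using \<Psi>_mono[of "t j" "t m"] \<Psi>_pos[of "t j"] V0[of j] \<mu> that m
            by (intro conjI mult_nonneg_nonneg) auto
        qed
        have S1: "S1 \<ge> 0" unfolding S1_def
          by (intro sum_nonneg mult_nonneg_nonneg[OF L1_weight_nonneg[OF \<alpha> mesh mM(1)] S_terms[THEN conjunct1]]) auto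
        have S2: "S2 \<ge> 0" unfolding S2_def
          by (intro sum_nonneg mult_nonneg_nonneg[OF L1_weight_nonneg[OF \<alpha> mesh mM(1)] S_terms[THEN conjunct2]]) auto
        have e1: "exp (\<mu> * x) \<ge> 1" using \<mu> x by simp
        have "\<kappa> / x * (if x < P then \<Phi> x else \<Phi> x - \<Phi> (x / 2)) \<le> L1_op \<alpha> t W m - lam * W m"
        proof (cases "x < P")
          case True
          \<comment> \<open>On the linear branch the L1 operator multiplies \<open>V m\<close> by
            \<open>x powr (- \<alpha>) / Gamma (2 - \<alpha>)\<close>. Half of this absorbs
            \<open>lam\<close>; the other half is the right-hand side, of order \<open>1 / x\<close>
            because \<open>P \<le> \<rho> * K * x\<close>.\<close>
          then have "m \<le> p" using mesh_mono[OF mesh, of p m] m by (fastforce simp: P_def x_def)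
          have LV: "L1_op \<alpha> t V m = V m * x powr (- \<alpha>) / Gamma (2 - \<alpha>)"
            using L1_base_barrier_initial[OF \<alpha> mesh mM(2) \<open>m \<le> p\<close> p(2)] by (simp add: V_def[abs_def] P_def x_def)
          have Vm: "V m = x * P powr (\<alpha> - 2)" using True by (simp add: V_def base_barrier_def x_def)
          have "2 * lam * Gamma (2 - \<alpha>) * x powr \<alpha> \<le> 1" using \<delta>1 x True P by simp
          then have "2 * lam * Gamma (2 - \<alpha>) * x powr \<alpha> * x powr (- \<alpha>) \<le> 1 * x powr (- \<alpha>)"
            by (intro mult_right_mono) auto
          moreover have "x powr \<alpha> * x powr (- \<alpha>) = 1" using x by (simp flip: powr_add)
          ultimately have "2 * lam * Gamma (2 - \<alpha>) \<le> x powr (- \<alpha>)"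
            by (simp only: mult.assoc mult_1_right mult_1_left)
          then have lam_le: "lam \<le> x powr (- \<alpha>) / Gamma (2 - \<alpha>) / 2"
            using \<Gamma> by (simp add: field_simps)
          have "\<kappa> / x * \<Phi> x \<le> \<kappa>1 / x * \<Phi> x"
            using x \<Phi>x by (intro mult_right_mono divide_right_mono) (auto simp: \<kappa>_def)
          also have "\<dots> = (\<rho> * K) powr (\<alpha> - 2) / x * \<Phi> x / (2 * Gamma (2 - \<alpha>))" by (simp add: \<kappa>1_def)
          also have "\<dots> \<le> (x powr (1 - \<alpha>) * P powr (\<alpha> - 2)) * \<Phi> x / (2 * Gamma (2 - \<alpha>))"
          proof (intro divide_right_mono mult_right_mono)
            have "\<rho> * K * t 1 \<le> \<rho> * K * x" using x(3) \<rho> K by (intro mult_left_mono) auto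
            then have "P \<le> \<rho> * K * x" using p(4) by (simp add: P_def)
            then have "(\<rho> * K * x) powr (\<alpha> - 2) \<le> P powr (\<alpha> - 2)" using P \<alpha> by (intro powr_mono2') auto
            then have "x powr (1 - \<alpha>) * ((\<rho> * K) powr (\<alpha> - 2) * x powr (\<alpha> - 2)) \<le> x powr (1 - \<alpha>) * P powr (\<alpha> - 2)"
              using x \<rho> K by (intro mult_left_mono) (auto simp: powr_mult)
            moreover have "x powr (1 - \<alpha>) * x powr (\<alpha> - 2) = 1 / x"
              unfolding powr_add[symmetric] using powr_minus_divide[of x 1] x by simp
            ultimately show "(\<rho> * K) powr (\<alpha> - 2) / x \<le> x powr (1 - \<alpha>) * P powr (\<alpha> - 2)"
              unfolding mult.left_commute[of "x powr (1 - \<alpha>)"] by simp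
          qed (use \<Phi>x \<Gamma> in auto)
          also have "x powr (1 - \<alpha>) * P powr (\<alpha> - 2) = V m * x powr (- \<alpha>)"
            using x powr_add[of x 1 "- \<alpha>"] by (simp add: Vm)
          also have "V m * x powr (- \<alpha>) * \<Phi> x / (2 * Gamma (2 - \<alpha>)) =
              x powr (- \<alpha>) / Gamma (2 - \<alpha>) / 2 * (1 * (\<Phi> x * V m))" by (simp add: mult_ac)
          also have "\<dots> \<le> x powr (- \<alpha>) / Gamma (2 - \<alpha>) / 2 * W m"
          proof (intro mult_left_mono)
            have "\<Phi> x \<le> \<Psi> x" unfolding \<Psi>_def using \<Phi>x by simp
            then show "1 * (\<Phi> x * V m) \<le> W m"
              unfolding Wm using e1 \<Phi>x V0[OF mM(1)] by (intro mult_mono mult_right_mono mult_nonneg_nonneg) auto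
          qed (use \<Gamma> in auto)
          also have "\<dots> \<le> x powr (- \<alpha>) / Gamma (2 - \<alpha>) * W m - lam * W m"
            using mult_right_mono[OF lam_le W0[OF mM(1)]] by simp
          also have "x powr (- \<alpha>) / Gamma (2 - \<alpha>) * W m = exp (\<mu> * x) * (\<Psi> x * L1_op \<alpha> t V m)"
            by (simp add: Wm LV)
          also have "\<dots> \<le> L1_op \<alpha> t W m"
            unfolding LW using S1 S2 by (simp add: distrib_left)
          finally show ?thesis using True by simp
        next
          case False
          then have Px: "P \<le> x" by simp
          have pm: "p \<le> m" using mesh_strict_mono[OF mesh, of m p] p(2) Px by (force simp: P_def x_def not_le)
          have step: "t j - t (j - 1) \<le> c * t 1 powr (1 / r) * x powr (1 - 1 / r)" if "j \<in> {1..m}" for j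
            using graded_mesh_step_le[OF g r c, of j m] that mM by (simp add: x_def)
          have step1: "t j - t (j - 1) \<le> t m / 32" if j: "j \<in> {1..m}" for j
          proof -
            have "t j - t (j - 1) \<le> c * (t 1 / x) powr (1 / r) * x"
              using step[OF j] unfolding graded_step_rescale[OF t1 x(1)] .
            also have "\<dots> \<le> c * (1 / K) powr (1 / r) * x"
            proof -
              have "t 1 / x \<le> 1 / K" using p(3) Px K x by (simp add: P_def field_simps)
              then show ?thesis using c x t1 r by (intro mult_right_mono mult_left_mono powr_mono2) auto
            qed
            also have "\<dots> = (c / K powr (1 / r)) * x" using K by (simp add: powr_divide)
            also have "\<dots> \<le> 1 / 32 * x"
              using K2 K x by (intro mult_right_mono) (auto simp: field_simps)
            finally show ?thesis by (simp add: x_def)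
          qed
          have step2: "t j - t (j - 1) \<le> 1 / (8 * \<mu>)" if j: "j \<in> {1..m}" for j
          proof -
            have "t j - t (j - 1) \<le> c * t 1 powr (1 / r) * x powr (1 - 1 / r)" using step[OF j] .
            also have "\<dots> \<le> c * t 1 powr (1 / r) * T powr (1 - 1 / r)"
              using c x r by (intro mult_left_mono powr_mono2) auto
            also have "\<dots> \<le> 1 / (8 * \<mu>)"
              using \<delta>2[OF t1 t1\<delta>] \<mu> by (simp add: field_simps)
            finally show ?thesis .
          qed
          have g1: "c1 / x * (\<Psi> x - \<Psi> (x / 2)) \<le> S1"
            unfolding c1_def S1_def V_def x_def
            using weighted_increment_sum_ge[OF \<alpha> mesh mM(2,1) P(1) _ step1 \<Psi>_mono] Px by (simp add: x_def)
          define Y where "Y = \<Phi> x - \<Phi> (x / 2)"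
          have Y: "\<epsilon> * (P / x) powr \<eta> * \<Phi> x \<le> Y" "\<Phi> x \<le> D * \<Phi> (x / 2)"
            using \<Phi> Px x by (auto simp: Y_def)
          have Y0: "Y \<ge> 0" using mono x by (simp add: Y_def)
          \<comment> \<open>In the increment of \<open>\<Phi> s * (1 + s powr b)\<close> the factor
            \<open>\<Phi> (x / 2)\<close> of \<open>(x / 2) powr b\<close> is raised to
            \<open>\<Phi> x\<close>; this leaves the increment of \<open>\<Phi>\<close> plus
            \<open>\<Phi> x\<close> times that of \<open>s powr b\<close>.\<close>
          have g2: "Y + \<theta> * (x powr b * \<Phi> x) \<le> \<Psi> x - \<Psi> (x / 2)"
          proof -
            have "\<Phi> (x / 2) * (x / 2) powr b \<le> \<Phi> x * (x / 2) powr b"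
              using Y0 by (intro mult_right_mono) (auto simp: Y_def)
            also have half: "(x / 2) powr b = 2 powr (- b) * x powr b"
              using x by (simp add: powr_divide powr_minus_divide)
            finally have "\<Phi> (x / 2) * (2 powr (- b) * x powr b) \<le> \<Phi> x * (2 powr (- b) * x powr b)" .
            then show ?thesis unfolding \<Psi>_def half by (simp add: Y_def \<theta>_def algebra_simps)
          qed
          \<comment> \<open>As \<open>K * t 1 \<le> P\<close>, the defect of the base barrier
            carries the factor \<open>K powr (- \<eta>)\<close> against the growth required of
            \<open>\<Phi>\<close>, so half of the gain \<open>c1 / x * Y\<close> pays for
            it.\<close>
          have LV: "\<Psi> x * L1_op \<alpha> t V m \<ge> - (c1 / 2 / x * Y)"
          proof -
            have "t 1 / x \<le> (P / x) / K" using p(3) K x by (simp add: P_def field_simps)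
            then have "(t 1 / x) powr \<eta> \<le> ((P / x) / K) powr \<eta>"
              using t1 x \<eta> by (intro powr_mono2) auto
            also have "\<dots> = (P / x) powr \<eta> / K powr \<eta>" by (rule powr_divide)
            finally have le: "(t 1 / x) powr \<eta> \<le> (P / x) powr \<eta> / K powr \<eta>" .
            have K1': "C0 * B0 / K powr \<eta> \<le> c1 / 2 * \<epsilon>"
              using K1 K c1 \<epsilon> by (simp add: field_simps)
            have "\<Psi> x * (C0 * (t 1 / x) powr \<eta> / x) \<le> (B0 * \<Phi> x) * (C0 * ((P / x) powr \<eta> / K powr \<eta>) / x)"
              using \<Psi>x le C0 x B0 \<Phi>x by (intro mult_mono divide_right_mono mult_left_mono) auto
            also have "\<dots> = (C0 * B0 / K powr \<eta>) * ((P / x) powr \<eta> * \<Phi> x / x)" by simp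
            also have "\<dots> \<le> (c1 / 2 * \<epsilon>) * ((P / x) powr \<eta> * \<Phi> x / x)"
              using K1' \<Phi>x x by (intro mult_right_mono) auto
            also have "\<dots> = c1 / 2 / x * (\<epsilon> * (P / x) powr \<eta> * \<Phi> x)" by simp
            also have "\<dots> \<le> c1 / 2 / x * Y" using Y c1 x by (intro mult_left_mono) auto
            finally have "\<Psi> x * (C0 * (t 1 / x) powr \<eta> / x) \<le> c1 / 2 / x * Y" .
            moreover have "\<Psi> x * L1_op \<alpha> t V m \<ge> \<Psi> x * (- C0 * (t 1 / x) powr \<eta> / x)"
              using V_ge[OF g _ pm mM(1)] p(1) \<Psi>_pos[OF x(1)] unfolding V_def P_def x_def
              by (intro mult_left_mono) auto
            ultimately show ?thesis by simp
          qed
          have main: "c1 / 2 / x * Y + c1 * \<theta> / x * (x powr b * \<Phi> x) \<le> \<Psi> x * L1_op \<alpha> t V m + S1"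
          proof -
            have "c1 / x * (Y + \<theta> * (x powr b * \<Phi> x)) \<le> c1 / x * (\<Psi> x - \<Psi> (x / 2))"
              using g2 c1 x by (intro mult_left_mono) auto
            also note g1
            finally have "c1 / x * (Y + \<theta> * (x powr b * \<Phi> x)) \<le> S1" .
            moreover have "c1 / x * (Y + \<theta> * (x powr b * \<Phi> x)) = 2 * (c1 / 2 / x * Y) + c1 * \<theta> / x * (x powr b * \<Phi> x)"
              by (simp add: distrib_left)
            ultimately show ?thesis using LV by linarith
          qed
          have absorb: "lam * W m \<le> exp (\<mu> * x) * (c1 * \<theta> / x * (x powr b * \<Phi> x)) + S2"
          proof (cases "x \<le> 2 / \<mu>")
            case True
            have "lam * B0 * 2 powr b \<le> c1 * \<theta> * \<mu> powr b"
              using \<mu>2 c1 \<theta> by (simp add: field_simps)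
            also have "\<dots> \<le> c1 * \<theta> * (2 / x) powr b"
              using True c1 \<theta> \<mu> x b by (intro mult_left_mono powr_mono2) (auto simp: field_simps)
            also have "\<dots> = (c1 * \<theta> / x powr b) * 2 powr b" using x by (simp add: powr_divide)
            finally have "lam * B0 \<le> c1 * \<theta> / x powr b" by (simp only: mult_le_cancel_right_pos powr_gt_zero)
            then have "lam * B0 * x powr (\<alpha> - 1) \<le> c1 * \<theta> / x powr b * x powr (\<alpha> - 1)"
              by (intro mult_right_mono) auto
            also have "\<dots> = c1 * \<theta> * (x powr (- b) * x powr (\<alpha> - 1))"
              by (simp add: powr_minus_divide)
            also have "x powr (- b) * x powr (\<alpha> - 1) = x powr b / x"
              unfolding powr_add[symmetric] using x powr_diff[of x b 1] by (simp add: b_def)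
            finally have *: "lam * B0 * x powr (\<alpha> - 1) \<le> c1 * \<theta> / x * x powr b" by simp
            have "lam * W m \<le> lam * (exp (\<mu> * x) * (B0 * \<Phi> x * x powr (\<alpha> - 1)))"
              unfolding Wm using lam \<Psi>x Vx V0[OF mM(1)] \<Phi>x B0 \<Psi>_pos[OF x(1)]
              by (intro mult_left_mono mult_mono mult_nonneg_nonneg) auto
            also have "\<dots> = exp (\<mu> * x) * ((lam * B0 * x powr (\<alpha> - 1)) * \<Phi> x)" by simp
            also have "\<dots> \<le> exp (\<mu> * x) * ((c1 * \<theta> / x * x powr b) * \<Phi> x)"
              using * \<Phi>x by (intro mult_left_mono mult_right_mono) auto
            finally show ?thesis using S2 by (simp add: mult.assoc)
          next
            case False
            have D2: "\<Psi> (t m) \<le> 2 * D * \<Psi> (t m / 2)"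
            proof -
              have "x powr b = 2 powr b * (x / 2) powr b" using x by (simp add: powr_divide)
              moreover have "2 powr b \<le> (2::real)" using b powr_mono[of b 1 2] by simp
              ultimately have "1 + x powr b \<le> 2 * (1 + (x / 2) powr b)"
                using mult_right_mono[of "2 powr b" 2 "(x / 2) powr b"] by simp
              then have "\<Psi> x \<le> (D * \<Phi> (x / 2)) * (2 * (1 + (x / 2) powr b))"
                unfolding \<Psi>_def using Y \<Phi>x by (intro mult_mono) auto
              then show ?thesis unfolding \<Psi>_def x_def by (simp only: mult_ac)
            qed
            have "c2 * \<mu> powr \<alpha> * W m \<le> S2"
            proof -
              have "((5 / 8) powr (- \<alpha>) - (7 / 8) powr (- \<alpha>)) / Gamma (1 - \<alpha>) / (3 * (2 * D)) * \<mu> powr \<alpha> *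
                  (exp (\<mu> * t m) * (\<Psi> (t m) * base_barrier \<alpha> P (t m))) \<le> S2"
                unfolding S2_def V_def
                using False D x by (intro exponential_increment_sum_ge[OF \<alpha> mesh mM(2,1) P(1,3) \<mu> _ step2 \<Psi>_mono \<Psi>_pos _ D2])
                  (auto simp: x_def)
              then show ?thesis by (simp add: c2_def Wm V_def x_def)
            qed
            moreover have "lam * W m \<le> c2 * \<mu> powr \<alpha> * W m"
              using \<mu>1 c2 W0[OF mM(1)] by (intro mult_right_mono) (auto simp: field_simps)
            moreover have "0 \<le> exp (\<mu> * x) * (c1 * \<theta> / x * (x powr b * \<Phi> x))"
              using c1 \<theta> x \<Phi>x by (intro mult_nonneg_nonneg) auto
            ultimately show ?thesis by linarith
          qed
          have "\<kappa> / x * Y \<le> c1 / 2 / x * Y"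
            using x Y0 by (intro mult_right_mono divide_right_mono) (auto simp: \<kappa>_def)
          also have "\<dots> \<le> exp (\<mu> * x) * (c1 / 2 / x * Y)"
            using e1 c1 x Y0 mult_right_mono[of 1 "exp (\<mu> * x)" "c1 / 2 / x * Y"] by simp
          finally have first: "\<kappa> / x * Y \<le> exp (\<mu> * x) * (c1 / 2 / x * Y)" .
          have "exp (\<mu> * x) * (c1 / 2 / x * Y + c1 * \<theta> / x * (x powr b * \<Phi> x)) \<le>
              exp (\<mu> * x) * (\<Psi> x * L1_op \<alpha> t V m + S1)"
            using main by (intro mult_left_mono) auto
          then have "exp (\<mu> * x) * (c1 / 2 / x * Y) + exp (\<mu> * x) * (c1 * \<theta> / x * (x powr b * \<Phi> x)) + S2 \<le> L1_op \<alpha> t W m"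
            unfolding LW by (simp only: distrib_left)
          then have "\<kappa> / x * Y \<le> L1_op \<alpha> t W m - lam * W m"
            using first absorb by linarith
          then show ?thesis using False by (simp add: Y_def)
        qed
        then show "L1_op \<alpha> t W m - l0 * W m - l1 * W (m - 1) \<ge>
               \<kappa> / t m * (if t m < P then \<Phi> (t m) else \<Phi> (t m) - \<Phi> (t m / 2))"
          using low unfolding x_def by linarith
      qed
    qed
  qed
qed

section \<open>Stability on quasi-graded meshes\<close>

text \<open>
  Right-hand sides \<open>g\<close> and bounds \<open>w\<close> are functions of the first step and of time, and the constants
  are uniform over all sufficiently fine meshes.
\<close>
definition L1_stable ::
    "real \<Rightarrow> real \<Rightarrow> real \<Rightarrow> real \<Rightarrow> real \<Rightarrow> real \<Rightarrow> (real \<Rightarrow> real \<Rightarrow> real) \<Rightarrow> (real \<Rightarrow> real \<Rightarrow> real) \<Rightarrow> bool" where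
  "L1_stable \<alpha> c r T l0 l1 g w \<longleftrightarrow>
     (\<exists>\<delta>>0. \<exists>C>0. \<forall>M t. graded_mesh c r T M t \<longrightarrow> t 1 \<le> \<delta> \<longrightarrow>
        (\<exists>W. W 0 = 0 \<and> (\<forall>m\<in>{1..M}. W m \<le> C * w (t 1) (t m) \<and>
           g (t 1) (t m) \<le> L1_op \<alpha> t W m - l0 * W m - l1 * W (m - 1))))"

lemma L1_stableI:
  assumes "\<delta> > 0" "C > 0"
    and "\<And>M t. graded_mesh c r T M t \<Longrightarrow> t 1 \<le> \<delta> \<Longrightarrow>
        \<exists>W. W 0 = 0 \<and> (\<forall>m\<in>{1..M}. W m \<le> C * w (t 1) (t m) \<and>
           g (t 1) (t m) \<le> L1_op \<alpha> t W m - l0 * W m - l1 * W (m - 1))"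
  shows "L1_stable \<alpha> c r T l0 l1 g w"
  using assms unfolding L1_stable_def by blast

lemma graded_mesh_node:
  assumes "graded_mesh c r T M t" "m \<in> {1..M}"
  shows "0 < t 1" "t 1 \<le> t m" "t m \<le> T"
  using graded_mesh_first_pos[OF assms(1)] graded_mesh_first_le[OF assms(1), of m]
    mesh_le_T[OF graded_mesh_temporal[OF assms(1)], of m] assms(2) by auto

text \<open>The operator is linear and the first step is a constant on each mesh, so a supersolution
  may be multiplied by any nonnegative function \<open>\<phi>\<close> of it.\<close>

lemma L1_stable_mono:
  assumes "L1_stable \<alpha> c r T l0 l1 g w" and \<phi>: "\<And>\<tau>. \<tau> > 0 \<Longrightarrow> \<phi> \<tau> \<ge> 0" and k: "k > 0"
    and g: "\<And>\<tau> s. 0 < \<tau> \<Longrightarrow> \<tau> \<le> s \<Longrightarrow> s \<le> T \<Longrightarrow> g' \<tau> s \<le> \<phi> \<tau> * g \<tau> s"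
    and w: "\<And>\<tau> s. 0 < \<tau> \<Longrightarrow> \<tau> \<le> s \<Longrightarrow> s \<le> T \<Longrightarrow> \<phi> \<tau> * w \<tau> s \<le> k * w' \<tau> s"
  shows "L1_stable \<alpha> c r T l0 l1 g' w'"
proof -
  obtain \<delta> C where \<delta>: "\<delta> > 0" and C: "C > 0" and *: "\<And>M t. graded_mesh c r T M t \<Longrightarrow> t 1 \<le> \<delta> \<Longrightarrow>
        \<exists>W. W 0 = 0 \<and> (\<forall>m\<in>{1..M}. W m \<le> C * w (t 1) (t m) \<and>
           g (t 1) (t m) \<le> L1_op \<alpha> t W m - l0 * W m - l1 * W (m - 1))"
    using assms(1) unfolding L1_stable_def by blast
  show ?thesis
  proof (rule L1_stableI[of \<delta> "C * k"])
    fix M t assume gm: "graded_mesh c r T M t" "t 1 \<le> \<delta>"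
    obtain W where W: "W 0 = 0" "\<And>m. m \<in> {1..M} \<Longrightarrow> W m \<le> C * w (t 1) (t m)"
      "\<And>m. m \<in> {1..M} \<Longrightarrow> g (t 1) (t m) \<le> L1_op \<alpha> t W m - l0 * W m - l1 * W (m - 1)"
      using *[OF gm] by blast
    define z where "z = \<phi> (t 1)"
    have z: "z \<ge> 0" using \<phi> graded_mesh_first_pos[OF gm(1)] by (simp add: z_def)
    show "\<exists>W. W 0 = 0 \<and> (\<forall>m\<in>{1..M}. W m \<le> C * k * w' (t 1) (t m) \<and>
           g' (t 1) (t m) \<le> L1_op \<alpha> t W m - l0 * W m - l1 * W (m - 1))"
    proof (intro exI[of _ "\<lambda>j. z * W j"] conjI ballI)
      fix m assume m: "m \<in> {1..M}"
      note n = graded_mesh_node[OF gm(1) m]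
      have "z * W m \<le> C * (z * w (t 1) (t m))"
        using mult_left_mono[OF W(2)[OF m] z] by (simp add: mult_ac)
      also have "\<dots> \<le> C * (k * w' (t 1) (t m))"
        using w[OF n] C by (intro mult_left_mono) (auto simp: z_def)
      finally show "z * W m \<le> C * k * w' (t 1) (t m)" by (simp add: mult_ac)
      have "g' (t 1) (t m) \<le> z * g (t 1) (t m)" using g[OF n] by (simp add: z_def)
      also have "\<dots> \<le> z * (L1_op \<alpha> t W m - l0 * W m - l1 * W (m - 1))"
        using W(3)[OF m] z by (intro mult_left_mono) auto
      also have "\<dots> = L1_op \<alpha> t (\<lambda>j. z * W j) m - l0 * (z * W m) - l1 * (z * W (m - 1))"
        unfolding L1_op_scale by (simp add: algebra_simps)
      finally show "g' (t 1) (t m) \<le> L1_op \<alpha> t (\<lambda>j. z * W j) m - l0 * (z * W m) - l1 * (z * W (m - 1))" .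
    qed (use W in simp)
  qed (use \<delta> C k in auto)
qed

lemma L1_stable_cong:
  assumes "L1_stable \<alpha> c r T l0 l1 g w" and "k > 0" "k' > 0"
    and "\<And>\<tau> s. 0 < \<tau> \<Longrightarrow> \<tau> \<le> s \<Longrightarrow> s \<le> T \<Longrightarrow> g' \<tau> s \<le> k * g \<tau> s"
    and "\<And>\<tau> s. 0 < \<tau> \<Longrightarrow> \<tau> \<le> s \<Longrightarrow> s \<le> T \<Longrightarrow> w \<tau> s \<le> k' * w' \<tau> s"
  shows "L1_stable \<alpha> c r T l0 l1 g' w'"
  by (rule L1_stable_mono[OF assms(1), of "\<lambda>_. k" "k * k'"]) (use assms in \<open>auto simp: mult.assoc\<close>)

lemma L1_stable_scale:
  assumes "L1_stable \<alpha> c r T l0 l1 g w" and "\<And>\<tau>. \<tau> > 0 \<Longrightarrow> \<phi> \<tau> \<ge> 0"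
  shows "L1_stable \<alpha> c r T l0 l1 (\<lambda>\<tau> s. \<phi> \<tau> * g \<tau> s) (\<lambda>\<tau> s. \<phi> \<tau> * w \<tau> s)"
  by (rule L1_stable_mono[OF assms, where k = 1]) auto

lemma L1_stable_add:
  assumes "L1_stable \<alpha> c r T l0 l1 g w" "L1_stable \<alpha> c r T l0 l1 g' w'"
    and w: "\<And>\<tau> s. 0 < \<tau> \<Longrightarrow> \<tau> \<le> s \<Longrightarrow> s \<le> T \<Longrightarrow> 0 \<le> w \<tau> s \<and> 0 \<le> w' \<tau> s"
  shows "L1_stable \<alpha> c r T l0 l1 (\<lambda>\<tau> s. g \<tau> s + g' \<tau> s) (\<lambda>\<tau> s. w \<tau> s + w' \<tau> s)"
proof -
  obtain \<delta> C where \<delta>: "\<delta> > 0" and C: "C > 0" and *: "\<And>M t. graded_mesh c r T M t \<Longrightarrow> t 1 \<le> \<delta> \<Longrightarrow>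
        \<exists>W. W 0 = 0 \<and> (\<forall>m\<in>{1..M}. W m \<le> C * w (t 1) (t m) \<and>
           g (t 1) (t m) \<le> L1_op \<alpha> t W m - l0 * W m - l1 * W (m - 1))"
    using assms(1) unfolding L1_stable_def by blast
  obtain \<delta>' C' where \<delta>': "\<delta>' > 0" and C': "C' > 0" and star': "\<And>M t. graded_mesh c r T M t \<Longrightarrow> t 1 \<le> \<delta>' \<Longrightarrow>
        \<exists>W. W 0 = 0 \<and> (\<forall>m\<in>{1..M}. W m \<le> C' * w' (t 1) (t m) \<and>
           g' (t 1) (t m) \<le> L1_op \<alpha> t W m - l0 * W m - l1 * W (m - 1))"
    using assms(2) unfolding L1_stable_def by blast
  show ?thesis
  proof (rule L1_stableI[of "min \<delta> \<delta>'" "C + C'"])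
    fix M t assume gm: "graded_mesh c r T M t" "t 1 \<le> min \<delta> \<delta>'"
    obtain W where W: "W 0 = 0" "\<And>m. m \<in> {1..M} \<Longrightarrow> W m \<le> C * w (t 1) (t m)"
      "\<And>m. m \<in> {1..M} \<Longrightarrow> g (t 1) (t m) \<le> L1_op \<alpha> t W m - l0 * W m - l1 * W (m - 1)"
      using *[OF gm(1)] gm(2) by auto
    obtain W' where W': "W' 0 = 0" "\<And>m. m \<in> {1..M} \<Longrightarrow> W' m \<le> C' * w' (t 1) (t m)"
      "\<And>m. m \<in> {1..M} \<Longrightarrow> g' (t 1) (t m) \<le> L1_op \<alpha> t W' m - l0 * W' m - l1 * W' (m - 1)"
      using star'[OF gm(1)] gm(2) by auto
    show "\<exists>W. W 0 = 0 \<and> (\<forall>m\<in>{1..M}. W m \<le> (C + C') * (w (t 1) (t m) + w' (t 1) (t m)) \<and>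
           g (t 1) (t m) + g' (t 1) (t m) \<le> L1_op \<alpha> t W m - l0 * W m - l1 * W (m - 1))"
    proof (intro exI[of _ "\<lambda>j. W j + W' j"] conjI ballI)
      fix m assume m: "m \<in> {1..M}"
      have "0 \<le> C * w' (t 1) (t m)" "0 \<le> C' * w (t 1) (t m)"
        using w[OF graded_mesh_node[OF gm(1) m]] C C' by auto
      then show "W m + W' m \<le> (C + C') * (w (t 1) (t m) + w' (t 1) (t m))"
        using W(2)[OF m] W'(2)[OF m] unfolding distrib_left distrib_right by linarith
      show "g (t 1) (t m) + g' (t 1) (t m) \<le> L1_op \<alpha> t (\<lambda>j. W j + W' j) m - l0 * (W m + W' m) - l1 * (W (m - 1) + W' (m - 1))"
        using W(3)[OF m] W'(3)[OF m] unfolding L1_op_add distrib_left by linarith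
    qed (use W W' in simp)
  qed (use \<delta> C \<delta>' C' in auto)
qed

text \<open>The breakpoint \<open>P\<close> varies with the mesh, so the profile is a family indexed
  by all \<open>P\<close>. Of its relation to the first step only \<open>2 * \<tau> \<le> P\<close>
  is passed on, which \<open>K \<ge> 2\<close> provides; \<open>upper\<close> and
  \<open>lower\<close> then eliminate \<open>P\<close> from the conclusion.\<close>

lemma L1_stable_of_profile:
  fixes \<Phi> \<omega> g :: "real \<Rightarrow> real \<Rightarrow> real"
  assumes std: "0 < \<alpha>" "\<alpha> < 1" "r \<ge> 1" "c > 0" "T > 0" "l0 \<ge> 0" "l1 \<ge> 0"
    and \<eta>: "0 < \<eta>" "\<eta> < \<alpha>" "\<eta> \<le> 1 / r" and \<epsilon>: "\<epsilon> > 0" and D: "D \<ge> 1" and A: "A > 0" and k: "k > 0"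
    and pos: "\<And>P s. 0 < P \<Longrightarrow> 0 < s \<Longrightarrow> 0 < \<Phi> P s"
    and mono: "\<And>P a b. 0 < P \<Longrightarrow> 0 < a \<Longrightarrow> a \<le> b \<Longrightarrow> \<Phi> P a \<le> \<Phi> P b"
    and incr: "\<And>P s. 0 < P \<Longrightarrow> P \<le> s \<Longrightarrow>
       \<Phi> P s \<le> D * \<Phi> P (s / 2) \<and> \<Phi> P s - \<Phi> P (s / 2) \<ge> \<epsilon> * (P / s) powr \<eta> * \<Phi> P s"
    and upper: "\<And>P \<tau> s. 0 < \<tau> \<Longrightarrow> 2 * \<tau> \<le> P \<Longrightarrow> \<tau> \<le> s \<Longrightarrow> \<Phi> P s \<le> A * \<omega> \<tau> s"
    and lower: "\<And>P \<tau> s. 0 < \<tau> \<Longrightarrow> 2 * \<tau> \<le> P \<Longrightarrow> \<tau> \<le> s \<Longrightarrow>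
       k * g \<tau> s \<le> (if s < P then \<Phi> P s else \<Phi> P s - \<Phi> P (s / 2))"
  shows "L1_stable \<alpha> c r T l0 l1 (\<lambda>\<tau> s. g \<tau> s / s) (\<lambda>\<tau> s. \<omega> \<tau> s * s powr (\<alpha> - 1))"
proof -
  obtain K K' \<delta> \<kappa> B where K: "K \<ge> 2" "K' > 0" "\<delta> > 0" "\<kappa> > 0" "B > 0"
    and *: "\<And>M t. graded_mesh c r T M t \<Longrightarrow> t 1 \<le> \<delta> \<Longrightarrow>
     (\<exists>P. K * t 1 \<le> P \<and> P \<le> K' * t 1 \<and> P \<le> T \<and>
        (\<forall>\<Phi> :: real \<Rightarrow> real. (\<forall>s>0. \<Phi> s > 0) \<longrightarrow> (\<forall>a>0. \<forall>b\<ge>a. \<Phi> a \<le> \<Phi> b) \<longrightarrow>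
          (\<forall>s\<in>{P..T}. \<Phi> s \<le> D * \<Phi> (s / 2) \<and> \<Phi> s - \<Phi> (s / 2) \<ge> \<epsilon> * (P / s) powr \<eta> * \<Phi> s) \<longrightarrow>
          (\<exists>W. W 0 = 0 \<and> (\<forall>m\<in>{1..M}. W m \<le> B * \<Phi> (t m) * t m powr (\<alpha> - 1) \<and>
             L1_op \<alpha> t W m - l0 * W m - l1 * W (m - 1) \<ge>
               \<kappa> / t m * (if t m < P then \<Phi> (t m) else \<Phi> (t m) - \<Phi> (t m / 2))))))"
    using L1_supersolution[OF std \<eta> \<epsilon> D] by blast
  have "L1_stable \<alpha> c r T l0 l1 (\<lambda>\<tau> s. \<kappa> * k * (g \<tau> s / s)) (\<lambda>\<tau> s. A * (\<omega> \<tau> s * s powr (\<alpha> - 1)))"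
  proof (rule L1_stableI[OF K(3,5)])
    fix M t assume gm: "graded_mesh c r T M t" "t 1 \<le> \<delta>"
    obtain P where P: "K * t 1 \<le> P" "P \<le> T" and
      **: "\<And>\<Phi> :: real \<Rightarrow> real. (\<forall>s>0. \<Phi> s > 0) \<Longrightarrow> (\<forall>a>0. \<forall>b\<ge>a. \<Phi> a \<le> \<Phi> b) \<Longrightarrow>
          (\<forall>s\<in>{P..T}. \<Phi> s \<le> D * \<Phi> (s / 2) \<and> \<Phi> s - \<Phi> (s / 2) \<ge> \<epsilon> * (P / s) powr \<eta> * \<Phi> s) \<Longrightarrow>
          (\<exists>W. W 0 = 0 \<and> (\<forall>m\<in>{1..M}. W m \<le> B * \<Phi> (t m) * t m powr (\<alpha> - 1) \<and>
             L1_op \<alpha> t W m - l0 * W m - l1 * W (m - 1) \<ge>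
               \<kappa> / t m * (if t m < P then \<Phi> (t m) else \<Phi> (t m) - \<Phi> (t m / 2))))"
      using *[OF gm] by blast
    have t1: "t 1 > 0" using graded_mesh_first_pos[OF gm(1)] .
    have "2 * t 1 \<le> K * t 1" using K t1 by (intro mult_right_mono) auto
    then have P2: "2 * t 1 \<le> P" "P > 0" using P t1 by linarith+
    obtain W where W: "W 0 = 0" "\<And>m. m \<in> {1..M} \<Longrightarrow> W m \<le> B * \<Phi> P (t m) * t m powr (\<alpha> - 1)"
       "\<And>m. m \<in> {1..M} \<Longrightarrow> \<kappa> / t m * (if t m < P then \<Phi> P (t m) else \<Phi> P (t m) - \<Phi> P (t m / 2)) \<le>
         L1_op \<alpha> t W m - l0 * W m - l1 * W (m - 1)"
      using **[of "\<Phi> P"] pos mono incr P2 by auto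
    show "\<exists>W. W 0 = 0 \<and> (\<forall>m\<in>{1..M}. W m \<le> B * (A * (\<omega> (t 1) (t m) * t m powr (\<alpha> - 1))) \<and>
           \<kappa> * k * (g (t 1) (t m) / t m) \<le> L1_op \<alpha> t W m - l0 * W m - l1 * W (m - 1))"
    proof (intro exI[of _ W] conjI ballI W(1))
      fix m assume m: "m \<in> {1..M}"
      note n = graded_mesh_node[OF gm(1) m]
      note W(2)[OF m]
      also have "B * \<Phi> P (t m) * t m powr (\<alpha> - 1) \<le> B * (A * \<omega> (t 1) (t m)) * t m powr (\<alpha> - 1)"
        using upper[OF n(1) P2(1) n(2)] K by (intro mult_right_mono mult_left_mono) auto
      finally show "W m \<le> B * (A * (\<omega> (t 1) (t m) * t m powr (\<alpha> - 1)))" by (simp add: mult_ac)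
      have "\<kappa> * k * (g (t 1) (t m) / t m) = \<kappa> / t m * (k * g (t 1) (t m))" by simp
      also have "\<dots> \<le> \<kappa> / t m * (if t m < P then \<Phi> P (t m) else \<Phi> P (t m) - \<Phi> P (t m / 2))"
        using lower[OF n(1) P2(1) n(2)] K n by (intro mult_left_mono) auto
      also note W(3)[OF m]
      finally show "\<kappa> * k * (g (t 1) (t m) / t m) \<le> L1_op \<alpha> t W m - l0 * W m - l1 * W (m - 1)" .
    qed
  qed
  then show ?thesis
    by (rule L1_stable_cong[of _ _ _ _ _ _ _ _ "1 / (\<kappa> * k)" A]) (use K k A in auto)
qed

section \<open>The three model right-hand sides\<close>

context
  fixes \<alpha> c r T l0 l1 :: real
  assumes std: "0 < \<alpha>" "\<alpha> < 1" "r \<ge> 1" "c > 0" "T > 0" "l0 \<ge> 0" "l1 \<ge> 0"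
begin

lemma exponent_choice:
  obtains \<eta> where "0 < \<eta>" "\<eta> < \<alpha>" "\<eta> \<le> 1 / r" "\<eta> \<le> x \<or> x \<le> 0"
proof (cases "x > 0")
  case True
  show ?thesis by (rule that[of "min x (min (\<alpha> / 2) (1 / r))"]) (use std True in \<open>auto simp: min_def\<close>)
next
  case False
  show ?thesis by (rule that[of "min (\<alpha> / 2) (1 / r)"]) (use std False in \<open>auto simp: min_def\<close>)
qed

text \<open>The profile \<open>s powr b\<close> gains the fixed fraction
  \<open>1 - 2 powr (- b)\<close> whenever time doubles, so it satisfies the growth condition for
  every \<open>P\<close> at once.\<close>

lemma L1_stable_power:
  assumes b: "b > 0"
  shows "L1_stable \<alpha> c r T l0 l1 (\<lambda>\<tau> s. s powr (b - 1)) (\<lambda>\<tau> s. s powr (b + \<alpha> - 1))"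
proof -
  obtain \<eta> where \<eta>: "0 < \<eta>" "\<eta> < \<alpha>" "\<eta> \<le> 1 / r" using exponent_choice by blast
  define \<epsilon> where "\<epsilon> = 1 - 2 powr (- b)"
  have \<epsilon>: "\<epsilon> > 0" unfolding \<epsilon>_def using b powr_less_mono[of "- b" 0 2] by simp
  have half: "(s / 2) powr b = (1 - \<epsilon>) * s powr b" if "s > 0" for s
    using that by (simp add: \<epsilon>_def powr_divide powr_minus_divide)
  have "L1_stable \<alpha> c r T l0 l1 (\<lambda>\<tau> s. s powr b / s) (\<lambda>\<tau> s. s powr b * s powr (\<alpha> - 1))"
  proof (rule L1_stable_of_profile[OF std \<eta> \<epsilon>, of "2 powr b" 1 \<epsilon> "\<lambda>P s. s powr b"])
    fix P s :: real assume s: "0 < P" "P \<le> s"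
    have "s powr b = 2 powr b * (s / 2) powr b" using s by (simp add: powr_divide)
    moreover have "\<epsilon> * (P / s) powr \<eta> * s powr b \<le> \<epsilon> * 1 * s powr b"
      using s \<eta> \<epsilon> by (intro mult_right_mono mult_left_mono powr_le1) auto
    ultimately show "s powr b \<le> 2 powr b * (s / 2) powr b \<and> \<epsilon> * (P / s) powr \<eta> * s powr b \<le> s powr b - (s / 2) powr b"
      using s half[of s] by (simp add: left_diff_distrib)
  next
    fix P \<tau> s :: real assume s: "0 < \<tau>" "2 * \<tau> \<le> P" "\<tau> \<le> s"
    have "\<epsilon> * s powr b \<le> 1 * s powr b" unfolding \<epsilon>_def by (intro mult_right_mono) auto
    then show "\<epsilon> * s powr b \<le> (if s < P then s powr b else s powr b - (s / 2) powr b)"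
      using half[of s] s by (simp add: left_diff_distrib)
  qed (use b \<epsilon> in \<open>auto intro!: powr_mono2 ge_one_powr_ge_zero\<close>)
  then show ?thesis
    by (rule L1_stable_cong[of _ _ _ _ _ _ _ _ 1 1])
       (auto simp: powr_diff add_diff_eq[symmetric] powr_add)
qed

text \<open>The profile stays between 1 and 2, and its increment from \<open>s / 2\<close> to
  \<open>s\<close> is exactly \<open>k * (P / s) powr \<eta>\<close>. Replacing
  \<open>\<gamma>\<close> by a smaller \<open>\<eta> < \<alpha>\<close> enlarges the source but
  costs nothing, since the response is of order \<open>s powr (\<alpha> - 1)\<close> for every
  positive exponent.\<close>

lemma L1_stable_decaying:
  assumes \<gamma>: "\<gamma> > 0"
  shows "L1_stable \<alpha> c r T l0 l1 (\<lambda>\<tau> s. (\<tau> / s) powr \<gamma> / s) (\<lambda>\<tau> s. s powr (\<alpha> - 1))"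
proof -
  obtain \<eta> where \<eta>: "0 < \<eta>" "\<eta> < \<alpha>" "\<eta> \<le> 1 / r" "\<eta> \<le> \<gamma>" using exponent_choice[of \<gamma>] \<gamma> by auto
  define k where "k = 1 - 2 powr (- \<eta>)"
  have k: "k > 0" "k \<le> 1" unfolding k_def using \<eta> powr_less_mono[of "- \<eta>" 0 2] by auto
  define \<Phi> where "\<Phi> P s = (if s \<le> P / 2 then 1 else 2 - (P / (2 * s)) powr \<eta>)" for P s :: real
  have range: "1 \<le> \<Phi> P s" "\<Phi> P s \<le> 2" if "0 < P" "0 < s" for P s
    using that \<eta> powr_le1[of \<eta> "P / (2 * s)"] by (auto simp: \<Phi>_def)
  have diff: "\<Phi> P s - \<Phi> P (s / 2) = k * (P / s) powr \<eta>" if "0 < P" "P \<le> s" for P s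
  proof -
    have "P / (2 * s) = P / s / 2" by simp
    then have "(P / (2 * s)) powr \<eta> = (P / s) powr \<eta> * 2 powr (- \<eta>)"
      using that by (simp only: powr_divide powr_minus_divide) simp
    moreover have "\<Phi> P (s / 2) = 2 - (P / s) powr \<eta>" using that by (cases "s = P") (auto simp: \<Phi>_def)
    ultimately show ?thesis using that by (simp add: \<Phi>_def k_def algebra_simps)
  qed
  have "L1_stable \<alpha> c r T l0 l1 (\<lambda>\<tau> s. (\<tau> / s) powr \<gamma> / s) (\<lambda>\<tau> s. 1 * s powr (\<alpha> - 1))"
  \<comment> \<open>The growth condition is relative to \<open>\<Phi> P s\<close>, which may be as
    large as 2; hence \<open>k / 2\<close> in place of \<open>k\<close>.\<close>
  proof (rule L1_stable_of_profile[OF std \<eta>(1-3), of "k / 2" 2 2 k \<Phi>])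
    fix P a b :: real assume s: "0 < P" "0 < a" "a \<le> b"
    show "\<Phi> P a \<le> \<Phi> P b"
    proof (cases "a \<le> P / 2")
      case True then show ?thesis using range[of P b] s by (simp add: \<Phi>_def)
    next
      case False
      have "(P / (2 * b)) powr \<eta> \<le> (P / (2 * a)) powr \<eta>"
        using s \<eta> by (intro powr_mono2 divide_left_mono) auto
      then show ?thesis using False s by (simp add: \<Phi>_def)
    qed
  next
    fix P s :: real assume s: "0 < P" "P \<le> s"
    have "\<Phi> P s \<le> 2 * \<Phi> P (s / 2)" using range[of P s] range[of P "s / 2"] s by simp
    moreover have "k / 2 * (P / s) powr \<eta> * \<Phi> P s \<le> k / 2 * (P / s) powr \<eta> * 2"
      using range[of P s] s k by (intro mult_left_mono) auto
    ultimately show "\<Phi> P s \<le> 2 * \<Phi> P (s / 2) \<and> k / 2 * (P / s) powr \<eta> * \<Phi> P s \<le> \<Phi> P s - \<Phi> P (s / 2)"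
      using diff[OF s] by simp
  next
    fix P \<tau> s :: real assume s: "0 < \<tau>" "2 * \<tau> \<le> P" "\<tau> \<le> s"
    have one: "(\<tau> / s) powr \<gamma> \<le> 1" using s \<gamma> by (intro powr_le1) auto
    show "k * (\<tau> / s) powr \<gamma> \<le> (if s < P then \<Phi> P s else \<Phi> P s - \<Phi> P (s / 2))"
    proof (cases "s < P")
      case True
      have "k * (\<tau> / s) powr \<gamma> \<le> 1 * 1" using one k by (intro mult_mono) auto
      then show ?thesis using range[of P s] s True by simp
    next
      case False
      have "(\<tau> / s) powr \<gamma> \<le> (\<tau> / s) powr \<eta>" using s \<eta> by (intro powr_mono') auto
      also have "\<dots> \<le> (P / s) powr \<eta>" using s \<eta> by (intro powr_mono2 divide_right_mono) auto
      finally show ?thesis using diff[of P s] s False k by simp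
    qed
  qed (use k range in \<open>auto intro: less_le_trans[OF zero_less_one]\<close>)
  then show ?thesis by simp
qed

text \<open>Each doubling of time adds the constant \<open>ln 2\<close> to the profile, whose size
  is logarithmic. The relative growth condition still holds because \<open>ln (s / P)\<close> is at
  most \<open>(s / P) powr \<eta> / \<eta>\<close>; this is the origin of
  \<open>\<epsilon>\<close>.\<close>

lemma L1_stable_critical:
  "L1_stable \<alpha> c r T l0 l1 (\<lambda>\<tau> s. 1 / s) (\<lambda>\<tau> s. (1 + ln (s / \<tau>)) * s powr (\<alpha> - 1))"
proof -
  obtain \<eta> where \<eta>: "0 < \<eta>" "\<eta> < \<alpha>" "\<eta> \<le> 1 / r" using exponent_choice by blast
  define \<epsilon> where "\<epsilon> = ln 2 / (2 + 1 / \<eta>)"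
  have \<epsilon>: "\<epsilon> > 0" unfolding \<epsilon>_def using \<eta> by (intro divide_pos_pos) (auto intro: add_pos_pos)
  have ln2: "ln 2 \<le> (1::real)" using ln_le_minus_one[of "2::real"] by simp
  define \<Phi> where "\<Phi> P s = (if s \<le> P / 2 then 1 else 1 + ln (2 * s / P))" for P s :: real
  have ge1: "1 \<le> \<Phi> P s" if "0 < P" "0 < s" for P s
    using that by (auto simp: \<Phi>_def)
  have eq: "\<Phi> P s = 1 + ln 2 + ln (s / P)" "\<Phi> P (s / 2) = 1 + ln (s / P)" if "0 < P" "P \<le> s" for P s
  proof -
    have "ln (2 * s / P) = ln 2 + ln (s / P)" using that ln_mult[of 2 "s / P"] by simp
    then show "\<Phi> P s = 1 + ln 2 + ln (s / P)" using that by (simp add: \<Phi>_def)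
    show "\<Phi> P (s / 2) = 1 + ln (s / P)" using that by (cases "s = P") (auto simp: \<Phi>_def)
  qed
  show ?thesis
  proof (rule L1_stable_of_profile[OF std \<eta> \<epsilon>, of 2 1 "ln 2" \<Phi>])
    fix P a b :: real assume s: "0 < P" "0 < a" "a \<le> b"
    show "\<Phi> P a \<le> \<Phi> P b"
    proof (cases "a \<le> P / 2")
      case True then show ?thesis using ge1[of P b] s by (simp add: \<Phi>_def)
    next
      case False
      then show ?thesis using s by (simp add: \<Phi>_def divide_right_mono)
    qed
  next
    fix P s :: real assume s: "0 < P" "P \<le> s"
    have x: "ln (s / P) \<ge> 0" using s by simp
    have "\<eta> * ln (s / P) = ln ((s / P) powr \<eta>)" using s by (simp add: ln_powr)
    also have "\<dots> \<le> (s / P) powr \<eta>" using ln_le_minus_one[of "(s / P) powr \<eta>"] s by simp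
    finally have "ln (s / P) \<le> (1 / \<eta>) * (s / P) powr \<eta>" using \<eta> by (simp add: field_simps)
    moreover have "1 \<le> (s / P) powr \<eta>" using s \<eta> by (intro ge_one_powr_ge_zero) auto
    ultimately have "\<Phi> P s \<le> 2 * (s / P) powr \<eta> + (1 / \<eta>) * (s / P) powr \<eta>"
      unfolding eq(1)[OF s] using ln2 by linarith
    then have "\<Phi> P s \<le> (2 + 1 / \<eta>) * (s / P) powr \<eta>" by (simp only: distrib_right)
    then have "(\<epsilon> * (P / s) powr \<eta>) * \<Phi> P s \<le> (\<epsilon> * (P / s) powr \<eta>) * ((2 + 1 / \<eta>) * (s / P) powr \<eta>)"
      using \<epsilon> by (intro mult_left_mono) auto
    also have "\<dots> = \<epsilon> * (2 + 1 / \<eta>) * ((P / s) powr \<eta> * (s / P) powr \<eta>)" by simp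
    also have "(P / s) powr \<eta> * (s / P) powr \<eta> = 1" using s by (simp flip: powr_mult)
    also have "\<epsilon> * (2 + 1 / \<eta>) * 1 = ln 2" 
    proof -
      have "2 + 1 / \<eta> > 0" using \<eta> by (auto intro: add_pos_pos)
      then show ?thesis by (simp add: \<epsilon>_def)
    qed
    finally show "\<Phi> P s \<le> 2 * \<Phi> P (s / 2) \<and> \<epsilon> * (P / s) powr \<eta> * \<Phi> P s \<le> \<Phi> P s - \<Phi> P (s / 2)"
      unfolding eq[OF s] using ln2 x by simp
  next
    fix P \<tau> s :: real assume s: "0 < \<tau>" "2 * \<tau> \<le> P" "\<tau> \<le> s"
    have "2 * s / P \<le> s / \<tau>" using s by (simp add: field_simps)
    then have "ln (2 * s / P) \<le> ln (s / \<tau>)" using s by (intro ln_mono) auto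
    moreover have "0 \<le> ln (s / \<tau>)" using s by simp
    ultimately show "\<Phi> P s \<le> 1 * (1 + ln (s / \<tau>))" by (simp add: \<Phi>_def)
    show "ln 2 * 1 \<le> (if s < P then \<Phi> P s else \<Phi> P s - \<Phi> P (s / 2))"
      using ge1[of P s] eq[of P s] ln2 s by (cases "s < P") auto
  qed (use ge1 in \<open>auto intro: less_le_trans[OF zero_less_one]\<close>)
qed

end

section \<open>Consistency\<close>

lemma real_differentiable_bound:
  fixes f f' \<phi> \<phi>' :: "real \<Rightarrow> real"
  assumes "a \<le> b" "continuous_on {a..b} f" "continuous_on {a..b} \<phi>"
    and "\<And>x. a < x \<Longrightarrow> x < b \<Longrightarrow> (f has_real_derivative f' x) (at x)"
    and "\<And>x. a < x \<Longrightarrow> x < b \<Longrightarrow> (\<phi> has_real_derivative \<phi>' x) (at x)"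
    and "\<And>x. a < x \<Longrightarrow> x < b \<Longrightarrow> \<bar>f' x\<bar> \<le> \<phi>' x"
  shows "\<bar>f b - f a\<bar> \<le> \<phi> b - \<phi> a"
proof (cases "a = b")
  case False
  then have "a < b" using assms by simp
  from differentiable_bound_general[OF this assms(2,3), of f' \<phi>'] assms(4-6)
  show ?thesis by (simp add: has_real_derivative_iff_has_vector_derivative)
qed simp

text \<open>The first derivative is bounded with exponent \<open>min \<sigma> 1 - 1\<close>, since
  for \<open>\<sigma> > 1\<close> it need not vanish at 0. Derivatives are two-sided in the
  interior; at \<open>T\<close> only continuity and the bounds are kept.\<close>

definition weakly_singular ::
    "real \<Rightarrow> real \<Rightarrow> real \<Rightarrow> (real \<Rightarrow> real) \<Rightarrow> (real \<Rightarrow> real) \<Rightarrow> (real \<Rightarrow> real) \<Rightarrow> bool" where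
  "weakly_singular T \<sigma> A u u1 u2 \<longleftrightarrow>
     continuous_on {0..T} u \<and> continuous_on {0<..T} u1 \<and>
     (\<forall>s\<in>{0<..<T}. (u has_real_derivative u1 s) (at s) \<and> (u1 has_real_derivative u2 s) (at s)) \<and>
     (\<forall>s\<in>{0<..T}. \<bar>u1 s\<bar> \<le> A * s powr (min \<sigma> 1 - 1) \<and> \<bar>u2 s\<bar> \<le> A * s powr (\<sigma> - 2))"

section \<open>Regularity of the solution and its increments\<close>

lemma time_deriv_interior:
  assumes "v differentiable (at s within {0..T})" "s \<in> {0<..<T}"
  shows "(v has_real_derivative time_deriv T v s) (at s)"
proof -
  have "(v has_vector_derivative time_deriv T v s) (at s within {0..T})"
    unfolding time_deriv_def using assms(1) vector_derivative_works by blast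
  moreover have "at s within {0..T} = at s" using assms(2) by (intro at_within_Icc_at) auto
  ultimately show ?thesis by (simp add: has_real_derivative_iff_has_vector_derivative)
qed

lemma weakly_singularI:
  assumes T: "T > 0" and \<sigma>: "\<sigma> < 2" and cont: "continuous_on {0..T} u" and d: "twice_cont_diff T u"
    and bound: "\<forall>l\<le>2. \<forall>s\<in>{0<..T}. \<bar>(time_deriv T ^^ l) u s\<bar> \<le> Cu * (1 + s powr (\<sigma> - real l))"
  shows "\<exists>A>0. weakly_singular T \<sigma> A u (time_deriv T u) (time_deriv T (time_deriv T u))"
proof -
  define B where "B = \<bar>Cu\<bar> * (1 + T powr \<bar>\<sigma> - 1\<bar>)"
  define B2 where "B2 = \<bar>Cu\<bar> * (1 + T powr (2 - \<sigma>))"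
  define A where "A = 1 + B + B2"
  have B: "B \<ge> 0" "B2 \<ge> 0" by (auto simp: B_def B2_def)
  have diff: "u differentiable (at s within {0..T})" "time_deriv T u differentiable (at s within {0..T})"
    if "s \<in> {0<..T}" for s
    using d that unfolding twice_cont_diff_def by (auto simp: less_2_cases_iff dest: spec[of _ 0] spec[of _ "Suc 0"])
  \<comment> \<open>On a bounded time range the constant 1 is dominated by a multiple of any
    nonpositive power, so it merges with the singular term.\<close>
  have neg: "1 + s powr a \<le> (1 + T powr (- a)) * s powr a" if "0 < s" "s \<le> T" "a \<le> 0" for s a
  proof -
    have "1 = s powr (- a) * s powr a" using that by (simp flip: powr_add)
    also have "\<dots> \<le> T powr (- a) * s powr a" using that by (intro mult_right_mono powr_mono2) auto
    finally show ?thesis by (simp add: distrib_right)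
  qed
  have b1: "\<bar>time_deriv T u s\<bar> \<le> B * s powr (min \<sigma> 1 - 1)" if s: "s \<in> {0<..T}" for s
  proof -
    have "\<bar>time_deriv T u s\<bar> \<le> Cu * (1 + s powr (\<sigma> - 1))"
      using bound[rule_format, of 1 s] s by simp
    also have "\<dots> \<le> \<bar>Cu\<bar> * (1 + s powr (\<sigma> - 1))" by (intro mult_right_mono) (auto intro: add_nonneg_nonneg)
    also have "\<dots> \<le> \<bar>Cu\<bar> * ((1 + T powr \<bar>\<sigma> - 1\<bar>) * s powr (min \<sigma> 1 - 1))"
    proof (intro mult_left_mono)
      show "1 + s powr (\<sigma> - 1) \<le> (1 + T powr \<bar>\<sigma> - 1\<bar>) * s powr (min \<sigma> 1 - 1)"
      proof (cases "\<sigma> \<le> 1")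
        case True
        then show ?thesis using neg[of s "\<sigma> - 1"] s by simp
      next
        case False
        then have "s powr (\<sigma> - 1) \<le> T powr (\<sigma> - 1)" using s by (intro powr_mono2) auto
        then show ?thesis using False s by simp
      qed
    qed simp
    finally show ?thesis by (simp add: B_def)
  qed
  have b2: "\<bar>time_deriv T (time_deriv T u) s\<bar> \<le> B2 * s powr (\<sigma> - 2)" if s: "s \<in> {0<..T}" for s
  proof -
    have "\<bar>time_deriv T (time_deriv T u) s\<bar> \<le> Cu * (1 + s powr (\<sigma> - 2))"
      using bound[rule_format, of 2 s] s by (simp add: numeral_2_eq_2)
    also have "\<dots> \<le> \<bar>Cu\<bar> * (1 + s powr (\<sigma> - 2))" by (intro mult_right_mono) (auto intro: add_nonneg_nonneg)
    also have "\<dots> \<le> \<bar>Cu\<bar> * ((1 + T powr (2 - \<sigma>)) * s powr (\<sigma> - 2))"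
      using neg[of s "\<sigma> - 2"] s \<sigma> by (intro mult_left_mono) auto
    finally show ?thesis by (simp add: B2_def)
  qed
  have "weakly_singular T \<sigma> A u (time_deriv T u) (time_deriv T (time_deriv T u))"
    unfolding weakly_singular_def
  proof (intro conjI ballI cont)
    have "continuous (at s within {0<..T}) (time_deriv T u)" if "s \<in> {0<..T}" for s
      using differentiable_imp_continuous_within[OF diff(2)[OF that]]
      by (rule continuous_within_subset) auto
    then show "continuous_on {0<..T} (time_deriv T u)" by (simp add: continuous_on_eq_continuous_within)
    fix s assume s: "s \<in> {0<..<T}"
    then have s': "s \<in> {0<..T}" by simp
    show "(u has_real_derivative time_deriv T u s) (at s)"
      by (rule time_deriv_interior[OF diff(1)[OF s'] s])
    show "(time_deriv T u has_real_derivative time_deriv T (time_deriv T u) s) (at s)"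
      by (rule time_deriv_interior[OF diff(2)[OF s'] s])
  next
    fix s assume s: "s \<in> {0<..T}"
    have "B * s powr (min \<sigma> 1 - 1) \<le> A * s powr (min \<sigma> 1 - 1)" "B2 * s powr (\<sigma> - 2) \<le> A * s powr (\<sigma> - 2)"
      using B by (auto simp: A_def intro!: mult_right_mono)
    then show "\<bar>time_deriv T u s\<bar> \<le> A * s powr (min \<sigma> 1 - 1)"
      "\<bar>time_deriv T (time_deriv T u) s\<bar> \<le> A * s powr (\<sigma> - 2)"
      using b1[OF s] b2[OF s] by linarith+
  qed
  moreover have "A > 0" using B by (simp add: A_def)
  ultimately show ?thesis by blast
qed

text \<open>On the first interval the bound on the derivative is integrable up to 0 and gives a
  multiple of \<open>t 1 powr min \<sigma> 1\<close>. On every other interval it varies by a bounded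
  factor and is multiplied by the step.\<close>

lemma weakly_singular_increment:
  fixes \<sigma> c r T A :: real
  assumes "r \<ge> 1" "c > 0" "\<sigma> > 0" "A > 0" and ws: "weakly_singular T \<sigma> A u u1 u2"
  shows "\<exists>C>0. \<forall>M t. graded_mesh c r T M t \<longrightarrow> (\<forall>m\<in>{1..M}.
     \<bar>u (t m) - u (t (m - 1))\<bar> \<le> C * (t 1 powr (1 / r) * t m powr (min \<sigma> 1 - 1 / r)))"
proof -
  define h where "h = min \<sigma> 1"
  define \<rho> where "\<rho> = max 2 ((2 * c) powr r)"
  have h: "0 < h" "h \<le> 1" using assms by (auto simp: h_def)
  have \<rho>: "\<rho> \<ge> 2" by (simp add: \<rho>_def)
  note ws' = ws[unfolded weakly_singular_def]
  have cont: "continuous_on {x..y} u" if "0 \<le> x" "y \<le> T" for x y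
    using ws' that by (auto intro: continuous_on_subset)
  show ?thesis
  proof (intro exI[of _ "A / h + A * \<rho> * c"] conjI allI impI ballI)
    show "A / h + A * \<rho> * c > 0" using assms h \<rho> by (intro add_pos_pos) auto
    fix M t m assume g: "graded_mesh c r T M t" and m: "m \<in> {1..M}"
    note mesh = graded_mesh_temporal[OF g]
    note n = graded_mesh_node[OF g m]
    have tm: "t m > 0" using n by simp
    have nonneg: "0 \<le> t 1 powr (1 / r) * t m powr (h - 1 / r)" by simp
    show "\<bar>u (t m) - u (t (m - 1))\<bar> \<le> (A / h + A * \<rho> * c) * (t 1 powr (1 / r) * t m powr (min \<sigma> 1 - 1 / r))"
    proof (cases "m = 1")
      case True
      have "\<bar>u (t 1) - u 0\<bar> \<le> A / h * t 1 powr h - A / h * 0 powr h"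
      proof (rule real_differentiable_bound)
        show "continuous_on {0..t 1} u" using n by (intro cont) auto
        show "continuous_on {0..t 1} (\<lambda>s. A / h * s powr h)"
          using h by (intro continuous_on_mult continuous_on_powr' continuous_intros) auto
        fix s assume s: "0 < s" "s < t 1"
        show "(u has_real_derivative u1 s) (at s)" using ws' s n by auto
        show "((\<lambda>s. A / h * s powr h) has_real_derivative A / h * (h * s powr (h - 1))) (at s)"
          by (intro DERIV_cmult has_real_derivative_powr s)
        show "\<bar>u1 s\<bar> \<le> A / h * (h * s powr (h - 1))" using ws' s n h by (auto simp: h_def)
      qed (use n in simp)
      also have "\<dots> = A / h * (t 1 powr (1 / r) * t 1 powr (h - 1 / r))"
        by (simp flip: powr_add)
      also have "\<dots> \<le> (A / h + A * \<rho> * c) * (t 1 powr (1 / r) * t 1 powr (h - 1 / r))"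
        using assms \<rho> by (intro mult_right_mono) auto
      finally show ?thesis using True mesh by (simp add: h_def)
    next
      case False
      then have p: "0 < t (m - 1)" "t (m - 1) < t m" "t m \<le> \<rho> * t (m - 1)"
        using mesh_pos[OF mesh, of "m - 1"] mesh_step[OF mesh m] m
          graded_mesh_ratio[OF g assms(1,2), of m, folded \<rho>_def] by auto
      define D where "D = A * (\<rho> * t m powr (h - 1))"
      have "\<bar>u (t m) - u (t (m - 1))\<bar> \<le> D * t m - D * t (m - 1)"
      proof (rule real_differentiable_bound)
        show "continuous_on {t (m - 1)..t m} u" using n p by (intro cont) auto
        fix s assume s: "t (m - 1) < s" "s < t m"
        show "(u has_real_derivative u1 s) (at s)" using ws' s n p by auto
        show "((\<lambda>s. D * s) has_real_derivative D) (at s)"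
          by (auto intro!: derivative_eq_intros)
        have "\<rho> * t (m - 1) \<le> \<rho> * s" using s \<rho> by (intro mult_left_mono) auto
        then have "s powr (h - 1) \<le> \<rho> powr \<bar>h - 1\<bar> * t m powr (h - 1)"
          using s p by (intro powr_ratio_bound(2)) auto
        also have "\<dots> \<le> \<rho> powr 1 * t m powr (h - 1)"
          using \<rho> h by (intro mult_right_mono powr_mono) auto
        finally have "A * s powr (h - 1) \<le> D"
          unfolding D_def using assms \<rho> by (intro mult_left_mono) auto
        moreover have "\<bar>u1 s\<bar> \<le> A * s powr (h - 1)" using ws' s n p by (auto simp: h_def)
        ultimately show "\<bar>u1 s\<bar> \<le> D" by simp
      qed (use p in \<open>auto intro!: continuous_intros\<close>)
      also have "\<dots> = D * (t m - t (m - 1))" by (simp add: right_diff_distrib)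
      also have "\<dots> \<le> D * (c * t 1 powr (1 / r) * t m powr (1 - 1 / r))"
        using graded_mesh_step_le[OF g assms(1,2), of m m] m \<rho> assms by (intro mult_left_mono) (auto simp: D_def)
      also have "\<dots> = A * \<rho> * c * (t 1 powr (1 / r) * (t m powr (h - 1) * t m powr (1 - 1 / r)))"
        by (simp add: D_def)
      also have "t m powr (h - 1) * t m powr (1 - 1 / r) = t m powr (h - 1 / r)"
        by (simp flip: powr_add)
      also have "A * \<rho> * c * (t 1 powr (1 / r) * t m powr (h - 1 / r)) \<le>
          (A / h + A * \<rho> * c) * (t 1 powr (1 / r) * t m powr (h - 1 / r))"
        using assms h by (intro mult_right_mono) auto
      finally show ?thesis by (simp add: h_def)
    qed
  qed
qed

text \<open>For \<open>\<sigma> < 1\<close> the two values are bounded separately. For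
  \<open>\<sigma> > 1\<close> the difference is controlled through the second derivative, whose
  bound \<open>s powr (\<sigma> - 2)\<close> is then integrable up to 0.\<close>

lemma weakly_singular_deriv_first_interval:
  assumes \<sigma>: "0 < \<sigma>" "\<sigma> < 2" "\<sigma> \<noteq> 1" and A: "A > 0" and ws: "weakly_singular T \<sigma> A u u1 u2"
    and s: "0 < s" "s < \<tau>" "\<tau> \<le> T"
  shows "\<bar>u1 s - u1 \<tau>\<bar> \<le> A * (1 + 1 / \<bar>\<sigma> - 1\<bar>) * (\<tau> powr (\<sigma> - 1) + s powr (\<sigma> - 1))"
proof -
  note ws' = ws[unfolded weakly_singular_def]
  have "\<bar>u1 s - u1 \<tau>\<bar> \<le> A * (\<tau> powr (\<sigma> - 1) + s powr (\<sigma> - 1)) \<or>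
     \<bar>u1 s - u1 \<tau>\<bar> \<le> A * (1 / \<bar>\<sigma> - 1\<bar>) * (\<tau> powr (\<sigma> - 1) + s powr (\<sigma> - 1))"
  proof (cases "\<sigma> < 1")
    case True
    then have "\<bar>u1 s\<bar> \<le> A * s powr (\<sigma> - 1)" "\<bar>u1 \<tau>\<bar> \<le> A * \<tau> powr (\<sigma> - 1)"
      using ws' s by auto
    then show ?thesis unfolding distrib_left by linarith
  next
    case False
    have "\<bar>u1 \<tau> - u1 s\<bar> \<le> A / (\<sigma> - 1) * \<tau> powr (\<sigma> - 1) - A / (\<sigma> - 1) * s powr (\<sigma> - 1)"
    proof (rule real_differentiable_bound)
      show "continuous_on {s..\<tau>} u1" using ws' s by (auto intro: continuous_on_subset)
      show "continuous_on {s..\<tau>} (\<lambda>x. A / (\<sigma> - 1) * x powr (\<sigma> - 1))"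
        using s by (intro continuous_intros) auto
      fix x assume x: "s < x" "x < \<tau>"
      show "(u1 has_real_derivative u2 x) (at x)" using ws' s x by auto
      have "((\<lambda>x. A / (\<sigma> - 1) * x powr (\<sigma> - 1)) has_real_derivative A / (\<sigma> - 1) * ((\<sigma> - 1) * x powr (\<sigma> - 1 - 1))) (at x)"
        using s x by (intro DERIV_cmult has_real_derivative_powr) auto
      then show "((\<lambda>x. A / (\<sigma> - 1) * x powr (\<sigma> - 1)) has_real_derivative A * x powr (\<sigma> - 2)) (at x)"
        using False \<sigma> by simp
      show "\<bar>u2 x\<bar> \<le> A * x powr (\<sigma> - 2)" using ws' s x by auto
    qed (use s in simp)
    also have "\<dots> \<le> A / (\<sigma> - 1) * \<tau> powr (\<sigma> - 1) + A / (\<sigma> - 1) * s powr (\<sigma> - 1)"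
      using A False by simp
    finally show ?thesis using False \<sigma> by (simp add: abs_minus_commute distrib_left)
  qed
  moreover have "A * (1 / \<bar>\<sigma> - 1\<bar>) * (\<tau> powr (\<sigma> - 1) + s powr (\<sigma> - 1)) \<ge> 0"
    "A * (\<tau> powr (\<sigma> - 1) + s powr (\<sigma> - 1)) \<ge> 0"
    using A by (auto intro!: mult_nonneg_nonneg add_nonneg_nonneg)
  ultimately show ?thesis by (simp only: distrib_left distrib_right mult_1_right) linarith
qed

text \<open>Near 0 the deviation of the derivative has only the integrable bound
  \<open>\<psi>\<close>. If \<open>x \<ge> 2 * \<tau>\<close>, the oscillation of the kernel, of
  order \<open>\<tau> * x powr (- \<alpha> - 1)\<close>, is multiplied by the integral of
  \<open>\<psi>\<close>. Otherwise \<open>x\<close> and \<open>\<tau>\<close> are comparable and the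
  crude bound by the kernel plus its mean suffices.\<close>

lemma first_interval_error:
  fixes \<alpha> \<sigma> T A :: real
  assumes \<alpha>: "0 < \<alpha>" "\<alpha> < 1" and \<sigma>: "0 < \<sigma>" "\<sigma> < 2" "\<sigma> \<noteq> 1" and A: "A > 0"
    and ws: "weakly_singular T \<sigma> A u u1 u2"
  shows "\<exists>C>0. \<forall>\<tau> x I. 0 < \<tau> \<longrightarrow> \<tau> \<le> x \<longrightarrow> x \<le> T \<longrightarrow>
     ((\<lambda>s. (x - s) powr (- \<alpha>) * u1 s) has_integral I) {0..\<tau>} \<longrightarrow>
     \<bar>I - (u \<tau> - u 0) * (((x - 0) powr (1 - \<alpha>) - (x - \<tau>) powr (1 - \<alpha>)) / ((1 - \<alpha>) * (\<tau> - 0)))\<bar> \<le>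
       C * (\<tau> powr (\<sigma> + 1) * x powr (- \<alpha> - 1))"
proof -
  note ws' = ws[unfolded weakly_singular_def]
  define A' where "A' = A * (1 + 1 / \<bar>\<sigma> - 1\<bar>)"
  have A': "A' > 0" unfolding A'_def using A by (intro mult_pos_pos) (auto intro: add_pos_nonneg)
  define C1 where "C1 = A' * \<alpha> * 2 powr (\<alpha> + 1) * (1 + 1 / \<sigma>)"
  define a where "a = 1 / (1 - \<alpha>)"
  define C2 where "C2 = A' * (3 * a + (2 + a) / \<sigma> + a) * 2 powr (\<alpha> + 1)"
  have a: "a > 0" using \<alpha> by (simp add: a_def)
  have C1: "C1 > 0" unfolding C1_def using A' \<alpha> \<sigma> by (intro mult_pos_pos) (auto intro: add_pos_pos)
  have C2: "C2 > 0" unfolding C2_def using A' a \<sigma> by (intro mult_pos_pos add_pos_pos) auto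
  show ?thesis
  proof (intro exI[of _ "C1 + C2"] conjI allI impI)
    show "C1 + C2 > 0" using C1 C2 by simp
    fix \<tau> x I assume \<tau>: "0 < \<tau>" "\<tau> \<le> x" "x \<le> T"
      and int: "((\<lambda>s. (x - s) powr (- \<alpha>) * u1 s) has_integral I) {0..\<tau>}"
    define \<kappa> where "\<kappa> = ((x - 0) powr (1 - \<alpha>) - (x - \<tau>) powr (1 - \<alpha>)) / ((1 - \<alpha>) * (\<tau> - 0))"
    have err: "((\<lambda>s. ((x - s) powr (- \<alpha>) - \<kappa>) * (u1 s - u1 \<tau>)) has_integral (I - (u \<tau> - u 0) * \<kappa>)) {0<..<\<tau>}"
      unfolding \<kappa>_def
      using \<tau> ws' by (intro interpolation_error_has_integral[OF \<alpha> _ _ _ _ int]) (auto intro: continuous_on_subset)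
    define \<psi> where "\<psi> s = \<tau> powr (\<sigma> - 1) + s powr (\<sigma> - 1)" for s
    have \<psi>: "\<bar>u1 s - u1 \<tau>\<bar> \<le> A' * \<psi> s" if "s \<in> {0<..<\<tau>}" for s
      unfolding A'_def \<psi>_def using weakly_singular_deriv_first_interval[OF \<sigma> A ws, of s \<tau>] that \<tau> by simp
    have \<psi>0: "\<psi> s \<ge> 0" for s by (simp add: \<psi>_def)
    have p\<sigma>: "((\<lambda>s. s powr (\<sigma> - 1)) has_integral \<tau> powr \<sigma> / \<sigma>) {0<..<\<tau>}"
      using has_integral_powr_from_0[of "\<sigma> - 1" \<tau>] \<sigma> \<tau> by (simp add: has_integral_Icc_iff_Ioo)
    have const: "((\<lambda>s. k) has_integral \<tau> * k) {0<..<\<tau>}" for k :: real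
      using has_integral_const_real[of k 0 \<tau>] \<tau> by (simp add: has_integral_Icc_iff_Ioo)
    have one: "\<tau> * \<tau> powr (\<sigma> - 1) = \<tau> powr \<sigma>" using \<tau> powr_add[of \<tau> 1 "\<sigma> - 1"] by simp
    have nonneg: "0 \<le> \<tau> powr (\<sigma> + 1) * x powr (- \<alpha> - 1)" by simp
    have "\<bar>I - (u \<tau> - u 0) * \<kappa>\<bar> \<le> C1 * (\<tau> powr (\<sigma> + 1) * x powr (- \<alpha> - 1)) \<or>
      \<bar>I - (u \<tau> - u 0) * \<kappa>\<bar> \<le> C2 * (\<tau> powr (\<sigma> + 1) * x powr (- \<alpha> - 1))"
    proof (cases "x \<ge> 2 * \<tau>")
      case True
      define \<Delta> where "\<Delta> = \<alpha> * 2 powr (\<alpha> + 1) * x powr (- \<alpha> - 1) * \<tau>"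
      have \<Delta>0: "\<Delta> \<ge> 0" using \<alpha> \<tau> by (simp add: \<Delta>_def)
      have "(x - \<tau>) powr (- \<alpha>) - (x - 0) powr (- \<alpha>) \<le> \<alpha> * (x - \<tau>) powr (- \<alpha> - 1) * ((x - 0) - (x - \<tau>))"
        using powr_neg_diff_le[of \<alpha> "x - \<tau>" "x - 0"] True \<tau> \<alpha> by simp
      also have "\<dots> \<le> \<alpha> * (x / 2) powr (- \<alpha> - 1) * ((x - 0) - (x - \<tau>))"
        using True \<tau> \<alpha> by (intro mult_right_mono mult_left_mono powr_mono2') auto
      also have "(x / 2) powr (- \<alpha> - 1) = 2 powr (\<alpha> + 1) * x powr (- \<alpha> - 1)"
        using powr_minus_divide[of 2 "\<alpha> + 1"] \<tau> by (simp add: powr_divide)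
      finally have \<Delta>: "(x - \<tau>) powr (- \<alpha>) - (x - 0) powr (- \<alpha>) \<le> \<Delta>" by (simp add: \<Delta>_def)
      have bd: "((\<lambda>s. \<Delta> * A' * \<psi> s) has_integral \<Delta> * A' * (\<tau> * \<tau> powr (\<sigma> - 1) + \<tau> powr \<sigma> / \<sigma>)) {0<..<\<tau>}"
        unfolding \<psi>_def by (intro has_integral_mult_right has_integral_add const p\<sigma>)
      have "\<bar>I - (u \<tau> - u 0) * \<kappa>\<bar> \<le> \<Delta> * A' * (\<tau> * \<tau> powr (\<sigma> - 1) + \<tau> powr \<sigma> / \<sigma>)"
      proof (rule has_integral_abs_le[OF err bd])
        fix s assume s: "s \<in> {0<..<\<tau>}"
        have "\<bar>(x - s) powr (- \<alpha>) - \<kappa>\<bar> \<le> \<Delta>"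
          using kernel_minus_mean_le(2)[OF \<alpha>, of 0 s \<tau> x] s True \<tau> \<Delta> unfolding \<kappa>_def by simp
        then have "\<bar>(x - s) powr (- \<alpha>) - \<kappa>\<bar> * \<bar>u1 s - u1 \<tau>\<bar> \<le> \<Delta> * (A' * \<psi> s)"
          using \<psi>[OF s] \<Delta>0 by (intro mult_mono) auto
        then show "\<bar>((x - s) powr (- \<alpha>) - \<kappa>) * (u1 s - u1 \<tau>)\<bar> \<le> \<Delta> * A' * \<psi> s"
          by (simp add: abs_mult)
      qed
      also have "\<dots> = C1 * ((\<tau> * \<tau> powr \<sigma>) * x powr (- \<alpha> - 1))"
        unfolding one C1_def \<Delta>_def by (simp add: algebra_simps)
      also have "\<tau> * \<tau> powr \<sigma> = \<tau> powr (\<sigma> + 1)" using \<tau> powr_add[of \<tau> \<sigma> 1] by simp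
      finally show ?thesis ..
    next
      case False
      define \<kappa>0 where "\<kappa>0 = a * \<tau> powr (- \<alpha>)"
      have k\<tau>: "((\<lambda>s. (\<tau> - s) powr (- \<alpha>)) has_integral a * \<tau> powr (1 - \<alpha>)) {0<..<\<tau>}"
        using kernel_has_integral[of \<alpha> 0 \<tau> \<tau>] \<alpha> \<tau> by (simp add: has_integral_Icc_iff_Ioo a_def)
      have "((\<lambda>s. (x - s) powr (- \<alpha>)) has_integral \<kappa> * \<tau>) {0<..<\<tau>}"
        using kernel_has_integral[of \<alpha> 0 \<tau> x] \<alpha> \<tau> by (simp add: has_integral_Icc_iff_Ioo \<kappa>_def)
      then have "\<kappa> * \<tau> \<le> a * \<tau> powr (1 - \<alpha>)"
        by (rule has_integral_le[OF _ k\<tau>]) (use \<tau> \<alpha> in \<open>auto intro!: powr_mono2'\<close>)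
      also have "a * \<tau> powr (1 - \<alpha>) = \<kappa>0 * \<tau>"
        using \<tau> powr_add[of \<tau> 1 "- \<alpha>"] by (simp add: \<kappa>0_def)
      finally have \<kappa>: "\<kappa> \<le> \<kappa>0" using \<tau> by simp
      have \<kappa>0: "\<kappa>0 \<ge> 0" using a by (simp add: \<kappa>0_def)
      \<comment> \<open>The kernel may be singular at the right end, and the bound on the derivative
        at 0. On each half of the interval one of the two factors is bounded, so their product is at
        most a sum of two integrable functions.\<close>
      define B where "B s = A' * (3 * \<tau> powr (\<sigma> - 1) * (\<tau> - s) powr (- \<alpha>) +
          (2 * \<tau> powr (- \<alpha>) + \<kappa>0) * s powr (\<sigma> - 1) + \<kappa>0 * \<tau> powr (\<sigma> - 1))" for s
      have bd: "(B has_integral A' * (3 * \<tau> powr (\<sigma> - 1) * (a * \<tau> powr (1 - \<alpha>)) +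
          (2 * \<tau> powr (- \<alpha>) + \<kappa>0) * (\<tau> powr \<sigma> / \<sigma>) + \<tau> * (\<kappa>0 * \<tau> powr (\<sigma> - 1)))) {0<..<\<tau>}"
        unfolding B_def by (intro has_integral_mult_right has_integral_add k\<tau> p\<sigma> const)
      have "\<bar>I - (u \<tau> - u 0) * \<kappa>\<bar> \<le> A' * (3 * \<tau> powr (\<sigma> - 1) * (a * \<tau> powr (1 - \<alpha>)) +
          (2 * \<tau> powr (- \<alpha>) + \<kappa>0) * (\<tau> powr \<sigma> / \<sigma>) + \<tau> * (\<kappa>0 * \<tau> powr (\<sigma> - 1)))"
      proof (rule has_integral_abs_le[OF err bd])
        fix s assume s: "s \<in> {0<..<\<tau>}"
        define k where "k = (\<tau> - s) powr (- \<alpha>)"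
        have k0: "k \<ge> 0" by (simp add: k_def)
        have "(x - s) powr (- \<alpha>) \<le> k" unfolding k_def using s \<tau> \<alpha> by (intro powr_mono2') auto
        then have "\<bar>(x - s) powr (- \<alpha>) - \<kappa>\<bar> \<le> k + \<kappa>0"
          using kernel_minus_mean_le(1)[OF \<alpha>, of 0 s \<tau> x] s \<tau> \<kappa> unfolding \<kappa>_def by simp
        then have "\<bar>(x - s) powr (- \<alpha>) - \<kappa>\<bar> * \<bar>u1 s - u1 \<tau>\<bar> \<le> (k + \<kappa>0) * (A' * \<psi> s)"
          using \<psi>[OF s] k0 \<kappa>0 by (intro mult_mono) auto
        also have "\<dots> = A' * (k * \<tau> powr (\<sigma> - 1) + k * s powr (\<sigma> - 1) + \<kappa>0 * s powr (\<sigma> - 1) + \<kappa>0 * \<tau> powr (\<sigma> - 1))"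
          by (simp add: \<psi>_def algebra_simps)
        also have "\<dots> \<le> B s"
        proof -
          have "k * s powr (\<sigma> - 1) \<le> 2 * \<tau> powr (- \<alpha>) * s powr (\<sigma> - 1) \<or>
              k * s powr (\<sigma> - 1) \<le> 2 * \<tau> powr (\<sigma> - 1) * k"
          proof (cases "s \<le> \<tau> / 2")
            case True
            have "k \<le> (\<tau> / 2) powr (- \<alpha>)" unfolding k_def using True s \<tau> \<alpha> by (intro powr_mono2') auto
            also have "\<dots> \<le> 2 powr \<bar>- \<alpha>\<bar> * \<tau> powr (- \<alpha>)"
              using \<tau> by (intro powr_ratio_bound(2)) auto
            also have "\<dots> \<le> 2 powr 1 * \<tau> powr (- \<alpha>)" using \<alpha> by (intro mult_right_mono powr_mono) auto
            finally show ?thesis by (intro disjI1 mult_right_mono) auto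
          next
            case False
            have "s powr (\<sigma> - 1) \<le> 2 powr \<bar>\<sigma> - 1\<bar> * \<tau> powr (\<sigma> - 1)"
              using s False by (intro powr_ratio_bound(2)) auto
            also have "\<dots> \<le> 2 powr 1 * \<tau> powr (\<sigma> - 1)" using \<sigma> by (intro mult_right_mono powr_mono) auto
            finally have "s powr (\<sigma> - 1) * k \<le> (2 * \<tau> powr (\<sigma> - 1)) * k" using k0 by (intro mult_right_mono) auto
            then show ?thesis by (simp add: mult.commute)
          qed
          moreover have "0 \<le> 2 * \<tau> powr (- \<alpha>) * s powr (\<sigma> - 1)" "0 \<le> 2 * \<tau> powr (\<sigma> - 1) * k" using k0 by auto
          ultimately have "k * s powr (\<sigma> - 1) \<le> 2 * \<tau> powr (- \<alpha>) * s powr (\<sigma> - 1) + 2 * \<tau> powr (\<sigma> - 1) * k" by linarith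
          then have "k * \<tau> powr (\<sigma> - 1) + k * s powr (\<sigma> - 1) + \<kappa>0 * s powr (\<sigma> - 1) + \<kappa>0 * \<tau> powr (\<sigma> - 1) \<le>
             3 * \<tau> powr (\<sigma> - 1) * k + (2 * \<tau> powr (- \<alpha>) + \<kappa>0) * s powr (\<sigma> - 1) + \<kappa>0 * \<tau> powr (\<sigma> - 1)"
            by (simp add: algebra_simps)
          then show ?thesis unfolding B_def k_def[symmetric] using A' by (intro mult_left_mono) auto
        qed
        finally show "\<bar>((x - s) powr (- \<alpha>) - \<kappa>) * (u1 s - u1 \<tau>)\<bar> \<le> B s" by (simp add: abs_mult)
      qed
      also have "\<dots> = A' * (3 * a + (2 + a) / \<sigma> + a) * \<tau> powr (\<sigma> - \<alpha>)"
      proof -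
        have "\<tau> powr (\<sigma> - 1) * \<tau> powr (1 - \<alpha>) = \<tau> powr (\<sigma> - \<alpha>)" "\<tau> powr (- \<alpha>) * \<tau> powr \<sigma> = \<tau> powr (\<sigma> - \<alpha>)"
          by (simp_all flip: powr_add)
        moreover have "A' * (3 * \<tau> powr (\<sigma> - 1) * (a * \<tau> powr (1 - \<alpha>)) +
            (2 * \<tau> powr (- \<alpha>) + \<kappa>0) * (\<tau> powr \<sigma> / \<sigma>) + \<tau> * (\<kappa>0 * \<tau> powr (\<sigma> - 1))) =
          A' * (3 * a * (\<tau> powr (\<sigma> - 1) * \<tau> powr (1 - \<alpha>)) + (2 + a) / \<sigma> * (\<tau> powr (- \<alpha>) * \<tau> powr \<sigma>)
             + a * (\<tau> powr (- \<alpha>) * (\<tau> * \<tau> powr (\<sigma> - 1))))"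
          unfolding \<kappa>0_def by (simp add: add_divide_distrib algebra_simps)
        ultimately show ?thesis unfolding one by (simp add: algebra_simps)
      qed
      also have "\<tau> powr (\<sigma> - \<alpha>) \<le> 2 powr (\<alpha> + 1) * (\<tau> powr (\<sigma> + 1) * x powr (- \<alpha> - 1))"
      proof -
        have "\<tau> powr (- \<alpha> - 1) \<le> 2 powr \<bar>- \<alpha> - 1\<bar> * x powr (- \<alpha> - 1)"
          using \<tau> False by (intro powr_ratio_bound(2)) auto
        then have "\<tau> powr (\<sigma> + 1) * \<tau> powr (- \<alpha> - 1) \<le> \<tau> powr (\<sigma> + 1) * (2 powr (\<alpha> + 1) * x powr (- \<alpha> - 1))"
          using \<alpha> by (intro mult_left_mono) (auto simp: add.commute)
        then show ?thesis by (simp add: mult_ac flip: powr_add)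
      qed
      finally show ?thesis
        unfolding C2_def using A' a \<sigma> by (simp add: mult_left_mono mult.assoc)
    qed
    moreover have "0 \<le> C1 * (\<tau> powr (\<sigma> + 1) * x powr (- \<alpha> - 1))" "0 \<le> C2 * (\<tau> powr (\<sigma> + 1) * x powr (- \<alpha> - 1))"
      using nonneg C1 C2 by auto
    ultimately show "\<bar>I - (u \<tau> - u 0) * (((x - 0) powr (1 - \<alpha>) - (x - \<tau>) powr (1 - \<alpha>)) / ((1 - \<alpha>) * (\<tau> - 0)))\<bar>
        \<le> (C1 + C2) * (\<tau> powr (\<sigma> + 1) * x powr (- \<alpha> - 1))"
      unfolding \<kappa>_def[symmetric] distrib_right by linarith
  qed
qed

text \<open>The first interval, where the derivative may blow up, is treated by
  \<open>first_interval_error\<close>; the others are summed with \<open>p = 1\<close>. If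
  \<open>\<sigma> - q + 1\<close> is negative, the latter sum is governed by its early end and
  reproduces the first term of the bound.\<close>

lemma L1_truncation_error:
  fixes \<alpha> c r \<sigma> T A :: real
  assumes \<alpha>: "0 < \<alpha>" "\<alpha> < 1" and r: "r \<ge> 1" and c: "c > 0"
    and \<sigma>: "0 < \<sigma>" "\<sigma> < 2" "\<sigma> \<noteq> 1" and A: "A > 0"
    and ws: "weakly_singular T \<sigma> A u (time_deriv T u) u2"
  shows "\<exists>C>0. \<forall>M t. graded_mesh c r T M t \<longrightarrow> (\<forall>m\<in>{1..M}.
     set_integrable lborel {0..t m} (\<lambda>s. (t m - s) powr (- \<alpha>) * time_deriv T u s) \<longrightarrow>
     \<bar>L1_op \<alpha> t (\<lambda>j. u (t j)) m - caputo \<alpha> T u (t m)\<bar> \<le>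
       C * (t 1 powr (\<sigma> + 1) * t m powr (- \<alpha> - 1) +
            t 1 powr ((2 - \<alpha>) / r) * t m powr (\<sigma> - \<alpha> - (2 - \<alpha>) / r)))"
proof -
  define u1 where "u1 = time_deriv T u"
  define \<rho> where "\<rho> = max 2 ((2 * c) powr r)"
  note ws1 = ws[folded u1_def] note ws' = ws1[unfolded weakly_singular_def]
  \<comment> \<open>The natural exponent is \<open>(2 - \<alpha>) / r\<close>. If it makes
    \<open>\<sigma> - q + 1\<close> vanish, the sum would be logarithmic; the larger
    \<open>2 / r\<close> makes this exponent negative instead.\<close>
  define q where "q = (if (2 - \<alpha>) / r = \<sigma> + 1 then 2 / r else (2 - \<alpha>) / r)"
  have q: "0 \<le> q" "q \<le> 2 / r" "\<sigma> - q + 1 \<noteq> 0" "(2 - \<alpha>) / r \<le> q"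
  proof -
    have "(2 - \<alpha>) / r < 2 / r" "0 \<le> (2 - \<alpha>) / r"
      using r \<alpha> by (auto simp: divide_strict_right_mono)
    then show "0 \<le> q" "q \<le> 2 / r" "\<sigma> - q + 1 \<noteq> 0" "(2 - \<alpha>) / r \<le> q"
      using r unfolding q_def by (simp_all split: if_split)
  qed
  have \<Gamma>: "Gamma (1 - \<alpha>) > 0" using Gamma_1_minus_pos \<alpha> by blast
  define A' where "A' = A * \<rho> powr (2 - \<sigma>)"
  have A': "A' > 0" using A by (simp add: A'_def \<rho>_def)
  obtain C1 where C1: "C1 > 0" and first: "\<And>\<tau> x I. 0 < \<tau> \<Longrightarrow> \<tau> \<le> x \<Longrightarrow> x \<le> T \<Longrightarrow>
     ((\<lambda>s. (x - s) powr (- \<alpha>) * u1 s) has_integral I) {0..\<tau>} \<Longrightarrow>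
     \<bar>I - (u \<tau> - u 0) * (((x - 0) powr (1 - \<alpha>) - (x - \<tau>) powr (1 - \<alpha>)) / ((1 - \<alpha>) * (\<tau> - 0)))\<bar> \<le>
       C1 * (\<tau> powr (\<sigma> + 1) * x powr (- \<alpha> - 1))"
    using first_interval_error[OF \<alpha> \<sigma> A ws1] by blast
  define C2 where "C2 = interpolation_const \<alpha> c r \<sigma> q"
  have C2: "C2 > 0" unfolding C2_def by (rule interpolation_const_pos[OF \<alpha> c])
  show ?thesis
  proof (intro exI[of _ "(C1 + 2 * C2 * A') / Gamma (1 - \<alpha>)"] conjI allI impI ballI)
    show "(C1 + 2 * C2 * A') / Gamma (1 - \<alpha>) > 0" using C1 C2 A' \<Gamma> by (intro divide_pos_pos add_pos_pos) auto
    fix M t m assume g: "graded_mesh c r T M t" and m: "m \<in> {1..M}"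
      and si: "set_integrable lborel {0..t m} (\<lambda>s. (t m - s) powr (- \<alpha>) * time_deriv T u s)"
    note mesh = graded_mesh_temporal[OF g]
    note n = graded_mesh_node[OF g m]
    have mM: "m \<le> M" "1 \<le> m" using m by auto
    define f where "f s = (t m - s) powr (- \<alpha>) * u1 s" for s
    define J where "J j = integral {t (j - 1)..t j} f" for j
    define E where "E j = J j - (u (t j) - u (t (j - 1))) * avg_kernel \<alpha> t m j" for j
    have int: "f integrable_on {0..t m}"
      using set_borel_integral_eq_integral(1)[OF si] by (simp add: f_def[abs_def] u1_def)
    have intj: "(f has_integral J j) {t (j - 1)..t j}" if j: "j \<in> {1..m}" for j
      unfolding J_def using mesh_nonneg[OF mesh, of "j - 1"] mesh_mono[OF mesh, of j m] j m
      by (intro integrable_integral integrable_on_subinterval[OF int]) auto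
    have split: "(\<Sum>j=1..k. J j) = integral {0..t k} f" if "k \<le> m" for k
      using that
    proof (induction k)
      case 0 then show ?case using mesh by simp
    next
      case (Suc k)
      have "0 \<le> t k" "t k \<le> t (Suc k)" "t (Suc k) \<le> t m"
        using mesh_nonneg[OF mesh, of k] mesh_mono[OF mesh, of k "Suc k"] mesh_mono[OF mesh, of "Suc k" m] Suc m by auto
      then have "integral {0..t k} f + integral {t k..t (Suc k)} f = integral {0..t (Suc k)} f"
        by (intro Henstock_Kurzweil_Integration.integral_combine integrable_on_subinterval[OF int]) auto
      then show ?case using Suc by (simp add: J_def)
    qed
    have cap: "caputo \<alpha> T u (t m) = (\<Sum>j=1..m. J j) / Gamma (1 - \<alpha>)"
      using set_borel_integral_eq_integral(2)[OF si] split[of m]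
      by (simp add: caputo_def f_def[abs_def] u1_def)
    have "L1_op \<alpha> t (\<lambda>j. u (t j)) m - caputo \<alpha> T u (t m) = - (\<Sum>j=1..m. E j) / Gamma (1 - \<alpha>)"
      unfolding cap L1_op_eq[OF \<alpha> mesh mM(1)] E_def sum_subtractf by (simp add: diff_divide_distrib)
    then have "\<bar>L1_op \<alpha> t (\<lambda>j. u (t j)) m - caputo \<alpha> T u (t m)\<bar> = \<bar>\<Sum>j=1..m. E j\<bar> / Gamma (1 - \<alpha>)"
      using \<Gamma> by simp
    also have "\<dots> \<le> (\<bar>E 1\<bar> + (\<Sum>j=1+1..m. \<bar>E j\<bar>)) / Gamma (1 - \<alpha>)"
    proof (intro divide_right_mono)
      have "(\<Sum>j=1..m. E j) = E 1 + (\<Sum>j=1+1..m. E j)"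
        using sum.atLeast_Suc_atMost[OF mM(2), of E] by simp
      then show "\<bar>\<Sum>j=1..m. E j\<bar> \<le> \<bar>E 1\<bar> + (\<Sum>j=1+1..m. \<bar>E j\<bar>)"
        using abs_triangle_ineq[of "E 1" "\<Sum>j=1+1..m. E j"] sum_abs[of E "{1+1..m}"] by linarith
    qed (use \<Gamma> in simp)
    also have "\<dots> \<le> (C1 * (t 1 powr (\<sigma> + 1) * t m powr (- \<alpha> - 1)) +
        2 * C2 * A' * (t 1 powr (\<sigma> + 1) * t m powr (- \<alpha> - 1) +
            t 1 powr ((2 - \<alpha>) / r) * t m powr (\<sigma> - \<alpha> - (2 - \<alpha>) / r))) / Gamma (1 - \<alpha>)"
    proof (intro divide_right_mono add_mono)
      have "((\<lambda>s. (t m - s) powr (- \<alpha>) * u1 s) has_integral J 1) {0..t 1}"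
        using intj[of 1] mM mesh by (simp add: f_def[abs_def])
      from first[OF n this] show "\<bar>E 1\<bar> \<le> C1 * (t 1 powr (\<sigma> + 1) * t m powr (- \<alpha> - 1))"
        using mesh by (simp add: E_def avg_kernel_def)
      have tj: "0 < t (j - 1)" "t (j - 1) < t j" "t j \<le> t m" "t j \<le> \<rho> * t (j - 1)" if "j \<in> {1+1..m}" for j
        using mesh_pos[OF mesh, of "j - 1"] mesh_step[OF mesh, of j] mesh_mono[OF mesh, of j m]
          graded_mesh_ratio[OF g r c, of j, folded \<rho>_def] that m by auto
      have D: "\<bar>u1 s - u1 (t j)\<bar> \<le> A' * (t j - t (j - 1)) * t j powr (\<sigma> - 2)"
        if j: "j \<in> {1+1..m}" and s: "s \<in> {t (j - 1)<..<t j}" for j s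
      proof -
        note tj = tj[OF j]
        define B where "B = A' * t j powr (\<sigma> - 2)"
        have "\<bar>u1 (t j) - u1 s\<bar> \<le> B * t j - B * s"
        proof (rule real_differentiable_bound)
          show "continuous_on {s..t j} u1" using ws' tj n s by (auto intro: continuous_on_subset)
          fix x assume x: "s < x" "x < t j"
          show "(u1 has_real_derivative u2 x) (at x)" using ws' tj n s x by auto
          show "((\<lambda>x. B * x) has_real_derivative B) (at x)" by (auto intro!: derivative_eq_intros)
          have "\<rho> * t (j - 1) \<le> \<rho> * x" using s x by (intro mult_left_mono) (auto simp: \<rho>_def)
          then have "x powr (\<sigma> - 2) \<le> \<rho> powr \<bar>\<sigma> - 2\<bar> * t j powr (\<sigma> - 2)"
            using tj s x by (intro powr_ratio_bound(2)) auto
          then have "A * x powr (\<sigma> - 2) \<le> A * (\<rho> powr (2 - \<sigma>) * t j powr (\<sigma> - 2))"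
            using A \<sigma> by (intro mult_left_mono) auto
          moreover have "\<bar>u2 x\<bar> \<le> A * x powr (\<sigma> - 2)" using ws' tj n s x by auto
          ultimately show "\<bar>u2 x\<bar> \<le> B" by (simp add: B_def A'_def)
        qed (use s in \<open>auto intro!: continuous_intros\<close>)
        also have "\<dots> = B * (t j - s)" by (simp add: right_diff_distrib)
        also have "\<dots> \<le> B * (t j - t (j - 1))" using s A' by (intro mult_left_mono) (auto simp: B_def)
        finally show ?thesis by (simp add: abs_minus_commute B_def mult_ac)
      qed
      define Y where "Y = t 1 powr (\<sigma> + 1) * t m powr (- \<alpha> - 1)"
      define Z where "Z = t 1 powr ((2 - \<alpha>) / r) * t m powr (\<sigma> - \<alpha> - (2 - \<alpha>) / r)"
      have YZ: "Y \<ge> 0" "Z \<ge> 0" by (auto simp: Y_def Z_def)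
      have "(\<Sum>j=1+1..m. \<bar>E j\<bar>) \<le> C2 * A' * (Z + t m powr (- \<alpha> - 1) * t 1 powr q *
          (if \<sigma> - q + 1 > 0 then t m powr (\<sigma> - q + 1) else t 1 powr (\<sigma> - q + 1)))"
        unfolding Z_def C2_def E_def
      proof (rule mesh_interpolation_errors_sum[OF \<alpha> r c \<sigma>(2) q(1-3) g _ mM(2,1)])
        fix j assume j: "j \<in> {1+1..m}"
        show "continuous_on {t (j - 1)..t j} u"
          using ws' tj[OF j] n by (auto intro: continuous_on_subset)
        show "(u has_real_derivative u1 s) (at s)" if "s \<in> {t (j - 1)<..<t j}" for s
          using ws' tj[OF j] n that by auto
        show "((\<lambda>s. (t m - s) powr (- \<alpha>) * u1 s) has_integral J j) {t (j - 1)..t j}"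
          using intj[of j] j by (simp add: f_def[abs_def])
      qed (use A' D in auto)
      also have "\<dots> \<le> C2 * A' * (Z + (Y + Z))"
      proof (intro mult_left_mono add_left_mono)
        show "t m powr (- \<alpha> - 1) * t 1 powr q *
          (if \<sigma> - q + 1 > 0 then t m powr (\<sigma> - q + 1) else t 1 powr (\<sigma> - q + 1)) \<le> Y + Z"
        proof (cases "\<sigma> - q + 1 > 0")
          case True
          have "t m powr (- \<alpha> - 1) * t 1 powr q * t m powr (\<sigma> - q + 1) =
              t 1 powr q * (t m powr (- \<alpha> - 1) * t m powr (\<sigma> - q + 1))" by simp
          also have "t m powr (- \<alpha> - 1) * t m powr (\<sigma> - q + 1) = t m powr (\<sigma> - \<alpha>) * t m powr (- q)"
            by (simp add: algebra_simps flip: powr_add)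
          also have "t 1 powr q * (t m powr (\<sigma> - \<alpha>) * t m powr (- q)) = (t 1 / t m) powr q * t m powr (\<sigma> - \<alpha>)"
            by (simp add: powr_divide powr_minus_divide)
          also have "\<dots> \<le> (t 1 / t m) powr ((2 - \<alpha>) / r) * t m powr (\<sigma> - \<alpha>)"
            using n q by (intro mult_right_mono powr_mono') auto
          also have "\<dots> = Z" by (simp add: Z_def powr_divide powr_diff)
          finally show ?thesis using True YZ by simp
        next
          case False
          have "t m powr (- \<alpha> - 1) * t 1 powr q * t 1 powr (\<sigma> - q + 1) =
              t m powr (- \<alpha> - 1) * (t 1 powr q * t 1 powr (\<sigma> - q + 1))" by simp
          also have "t 1 powr q * t 1 powr (\<sigma> - q + 1) = t 1 powr (\<sigma> + 1)" by (simp flip: powr_add)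
          also have "t m powr (- \<alpha> - 1) * t 1 powr (\<sigma> + 1) = Y" by (simp add: Y_def)
          finally show ?thesis using False YZ by simp
        qed
      qed (use C2 A' in simp)
      also have "\<dots> \<le> C2 * A' * (2 * (Y + Z))" using C2 A' YZ by (intro mult_left_mono) auto
      finally show "(\<Sum>j=1+1..m. \<bar>E j\<bar>) \<le> 2 * C2 * A' * (Y + Z)" by (simp add: mult_ac)
    qed (use \<Gamma> in simp)
    also have "\<dots> \<le> ((C1 + 2 * C2 * A') * (t 1 powr (\<sigma> + 1) * t m powr (- \<alpha> - 1) +
            t 1 powr ((2 - \<alpha>) / r) * t m powr (\<sigma> - \<alpha> - (2 - \<alpha>) / r))) / Gamma (1 - \<alpha>)"
    proof (intro divide_right_mono)
      have "C1 * (t 1 powr (\<sigma> + 1) * t m powr (- \<alpha> - 1)) \<le> C1 * (t 1 powr (\<sigma> + 1) * t m powr (- \<alpha> - 1) +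
            t 1 powr ((2 - \<alpha>) / r) * t m powr (\<sigma> - \<alpha> - (2 - \<alpha>) / r))"
        using C1 by (intro mult_left_mono) auto
      then show "C1 * (t 1 powr (\<sigma> + 1) * t m powr (- \<alpha> - 1)) +
        2 * C2 * A' * (t 1 powr (\<sigma> + 1) * t m powr (- \<alpha> - 1) +
            t 1 powr ((2 - \<alpha>) / r) * t m powr (\<sigma> - \<alpha> - (2 - \<alpha>) / r))
        \<le> (C1 + 2 * C2 * A') * (t 1 powr (\<sigma> + 1) * t m powr (- \<alpha> - 1) +
            t 1 powr ((2 - \<alpha>) / r) * t m powr (\<sigma> - \<alpha> - (2 - \<alpha>) / r))"
        by (simp only: distrib_right[of C1])
    qed (use \<Gamma> in simp)
    finally show "\<bar>L1_op \<alpha> t (\<lambda>j. u (t j)) m - caputo \<alpha> T u (t m)\<bar> \<le>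
       (C1 + 2 * C2 * A') / Gamma (1 - \<alpha>) * (t 1 powr (\<sigma> + 1) * t m powr (- \<alpha> - 1) +
            t 1 powr ((2 - \<alpha>) / r) * t m powr (\<sigma> - \<alpha> - (2 - \<alpha>) / r))" by simp
  qed
qed

section \<open>Error bounds\<close>

lemma L1_op_diff:
  "L1_op \<alpha> t (\<lambda>j. A j - B j) m = L1_op \<alpha> t A m - L1_op \<alpha> t B m"
  using L1_op_add[of \<alpha> t A "\<lambda>j. (-1) * B j" m] unfolding L1_op_scale by simp

text \<open>The nonlinear difference is split at \<open>F (v m) (U (m - 1))\<close>. The Lipschitz
  bound in the second argument is then needed only with the exact value as first argument, and the
  one-sided condition compares \<open>v m\<close> and \<open>U m\<close> at a common second
  argument. Multiplication by the sign of the error brings the latter into play.\<close>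

lemma L1_error_le:
  fixes F :: "real \<Rightarrow> real \<Rightarrow> real"
  assumes \<alpha>: "0 < \<alpha>" "\<alpha> < 1" and mesh: "temporal_mesh T M t" and m: "m \<le> M"
    and trunc: "\<bar>L1_op \<alpha> t v m - D\<bar> \<le> E1" and cons: "\<bar>F (v m) (v (m - 1)) - fv\<bar> \<le> E2"
    and eq: "D + fv = gm" and scheme: "L1_op \<alpha> t U m + F (U m) (U (m - 1)) = gm"
    and mono: "\<And>x w d. d \<ge> 0 \<Longrightarrow> F (x + d) w - F x w \<ge> - lam0 * d"
    and lip: "\<bar>F (v m) (U (m - 1)) - F (v m) (v (m - 1))\<bar> \<le> lam1 * \<bar>v (m - 1) - U (m - 1)\<bar>"
  shows "L1_op \<alpha> t (\<lambda>j. \<bar>v j - U j\<bar>) m - lam0 * \<bar>v m - U m\<bar> - lam1 * \<bar>v (m - 1) - U (m - 1)\<bar> \<le> E1 + E2"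
proof -
  define e where "e = v m - U m"
  define r where "r = (L1_op \<alpha> t v m - D) + (F (v m) (v (m - 1)) - fv) + (F (v m) (U (m - 1)) - F (v m) (v (m - 1)))"
  define d where "d = F (v m) (U (m - 1)) - F (U m) (U (m - 1))"
  have diff: "L1_op \<alpha> t (\<lambda>j. v j - U j) m = r - d"
    using eq scheme unfolding L1_op_diff r_def d_def by simp
  have "L1_op \<alpha> t (\<lambda>j. \<bar>v j - U j\<bar>) m \<le> sgn e * (r - d)"
    unfolding e_def diff[symmetric] by (rule L1_op_abs_le[OF \<alpha> mesh m])
  moreover have "sgn e * (r - d) = sgn e * r - sgn e * d" by (simp add: right_diff_distrib)
  moreover have "sgn e * r \<le> \<bar>r\<bar>" by (auto simp: sgn_if)
  moreover have "- (sgn e * d) \<le> lam0 * \<bar>e\<bar>"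
    using mono[of e "U m" "U (m - 1)"] mono[of "- e" "v m" "U (m - 1)"]
    by (auto simp: sgn_if e_def d_def)
  moreover have "\<bar>r\<bar> \<le> E1 + E2 + lam1 * \<bar>v (m - 1) - U (m - 1)\<bar>"
    unfolding r_def using trunc cons lip by linarith
  ultimately show ?thesis unfolding e_def by linarith
qed

text \<open>The stability constants apply once \<open>t 1 \<le> \<delta>\<close>, hence for all but
  finitely many \<open>M\<close>. On each remaining mesh the linear problem with right-hand side
  \<open>R\<close> is solved exactly, and the finitely many ratios of its solution to the positive
  bound \<open>E\<close> are collected in \<open>S\<close>.\<close>

lemma L1_barrier_all_meshes:
  fixes t :: "nat \<Rightarrow> nat \<Rightarrow> real" and E :: "nat \<Rightarrow> nat \<Rightarrow> real"
  assumes \<alpha>: "0 < \<alpha>" "\<alpha> < 1" and stable: "L1_stable \<alpha> c r T l0 l1 R w"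
    and graded: "\<And>M. M \<ge> 1 \<Longrightarrow> graded_mesh c r T M (t M)"
    and small: "\<And>\<delta>. \<delta> > 0 \<Longrightarrow> \<exists>N. \<forall>M>N. t M 1 \<le> \<delta>"
    and step: "\<And>M j. M \<ge> 1 \<Longrightarrow> j \<in> {1..M} \<Longrightarrow> l0 * (t M j - t M (j - 1)) powr \<alpha> < 1 / Gamma (2 - \<alpha>)"
    and E: "\<And>M m. M \<ge> 1 \<Longrightarrow> m \<in> {1..M} \<Longrightarrow> 0 < E M m"
    and w: "\<And>M m. M \<ge> 1 \<Longrightarrow> m \<in> {1..M} \<Longrightarrow> w (t M 1) (t M m) \<le> C' * E M m" and C': "C' \<ge> 0"
  shows "\<exists>C. \<forall>M\<ge>1. \<exists>W. W 0 = 0 \<and> (\<forall>m\<in>{1..M}. W m \<le> C * E M m \<and>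
     R (t M 1) (t M m) \<le> L1_op \<alpha> (t M) W m - l0 * W m - l1 * W (m - 1))"
proof -
  obtain \<delta> C where \<delta>: "\<delta> > 0" and C: "C > 0" and fine: "\<And>M t. graded_mesh c r T M t \<Longrightarrow> t 1 \<le> \<delta> \<Longrightarrow>
        \<exists>W. W 0 = 0 \<and> (\<forall>m\<in>{1..M}. W m \<le> C * w (t 1) (t m) \<and>
           R (t 1) (t m) \<le> L1_op \<alpha> t W m - l0 * W m - l1 * W (m - 1))"
    using stable unfolding L1_stable_def by blast
  obtain N where N: "\<And>M. M > N \<Longrightarrow> t M 1 \<le> \<delta>" using small[OF \<delta>] by blast
  have "\<exists>W. W 0 = 0 \<and> (\<forall>m\<in>{1..M}. L1_op \<alpha> (t M) W m + (- l0 * W m - l1 * W (m - 1)) = R (t M 1) (t M m))"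
    if M: "M \<ge> 1" for M
  proof -
    \<comment> \<open>The linear problem is itself an instance of the scheme, with
      \<open>- l0 * v - l1 * w\<close> in the role of \<open>F\<close>.\<close>
    have "\<exists>!W. W \<in> extensional {0..M} \<and> W 0 = 0 \<and>
      (\<forall>m\<in>{1..M}. L1_op \<alpha> (t M) W m + (- l0 * W m - l1 * W (m - 1)) = R (t M 1) (t M m))"
      by (rule L1_scheme_ex1[OF \<alpha> graded_mesh_temporal[OF graded[OF M]] step[OF M],
            of "\<lambda>v w. - l0 * v - l1 * w"]) (auto intro!: continuous_intros simp: algebra_simps)
    then show ?thesis by blast
  qed
  then obtain W where W: "\<And>M. M \<ge> 1 \<Longrightarrow> W M 0 = 0"
    "\<And>M m. M \<ge> 1 \<Longrightarrow> m \<in> {1..M} \<Longrightarrow>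
       L1_op \<alpha> (t M) (W M) m + (- l0 * W M m - l1 * W M (m - 1)) = R (t M 1) (t M m)"
    by metis
  define S where "S = (\<Sum>M\<le>N. \<Sum>m=1..M. \<bar>W M m\<bar> / E M m)"
  have S_term: "0 \<le> (\<Sum>m=1..M. \<bar>W M m\<bar> / E M m)" for M
  proof (intro sum_nonneg)
    fix m assume "m \<in> {1..M}"
    then show "0 \<le> \<bar>W M m\<bar> / E M m" using E[of M m] by simp
  qed
  have S: "S \<ge> 0" unfolding S_def by (intro sum_nonneg S_term)
  show ?thesis
  proof (intro exI[of _ "C * C' + S"] allI impI)
    fix M :: nat assume M: "M \<ge> 1"
    show "\<exists>W. W 0 = 0 \<and> (\<forall>m\<in>{1..M}. W m \<le> (C * C' + S) * E M m \<and>
     R (t M 1) (t M m) \<le> L1_op \<alpha> (t M) W m - l0 * W m - l1 * W (m - 1))"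
    proof (cases "M > N")
      case True
      obtain V where V: "V 0 = 0" "\<And>m. m \<in> {1..M} \<Longrightarrow> V m \<le> C * w (t M 1) (t M m)"
        "\<And>m. m \<in> {1..M} \<Longrightarrow> R (t M 1) (t M m) \<le> L1_op \<alpha> (t M) V m - l0 * V m - l1 * V (m - 1)"
        using fine[OF graded[OF M] N[OF True]] by blast
      have "V m \<le> (C * C' + S) * E M m" if m: "m \<in> {1..M}" for m
      proof -
        have "V m \<le> C * (C' * E M m)"
          using V(2)[OF m] mult_left_mono[OF w[OF M m] less_imp_le[OF C]] by (rule order_trans)
        also have "\<dots> \<le> (C * C' + S) * E M m" using S E[OF M m] by (simp add: distrib_right)
        finally show ?thesis .
      qed
      then show ?thesis using V by blast
    next
      case False
      have "W M m \<le> (C * C' + S) * E M m" if m: "m \<in> {1..M}" for m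
      proof -
        have "\<bar>W M m\<bar> / E M m \<le> (\<Sum>m=1..M. \<bar>W M m\<bar> / E M m)"
          using m E[OF M] by (intro member_le_sum) (auto intro!: divide_nonneg_pos)
        also have "\<dots> \<le> S" unfolding S_def using False S_term by (intro member_le_sum) auto
        also have "\<dots> \<le> C * C' + S" using C C' by simp
        finally have "\<bar>W M m\<bar> \<le> (C * C' + S) * E M m" using E[OF M m] by (simp add: pos_divide_le_eq)
        then show ?thesis by simp
      qed
      moreover have "R (t M 1) (t M m) \<le> L1_op \<alpha> (t M) (W M) m - l0 * W M m - l1 * W M (m - 1)"
        if "m \<in> {1..M}" for m using W(2)[OF M that] by simp
      ultimately show ?thesis using W(1)[OF M] by blast
    qed
  qed
qed

text \<open>By \<open>L1_error_le\<close> the modulus of the error is a subsolution for the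
  right-hand side \<open>R\<close>, for which \<open>W\<close> is a supersolution. Both vanish at
  time 0, and \<open>L1_comparison\<close> concludes.\<close>

lemma L1_scheme_error_bound:
  fixes t :: "nat \<Rightarrow> nat \<Rightarrow> real" and E :: "nat \<Rightarrow> nat \<Rightarrow> real"
  assumes \<alpha>: "0 < \<alpha>" "\<alpha> < 1" and l1: "lam1 \<ge> 0"
    and mesh: "\<And>M. M \<ge> 1 \<Longrightarrow> temporal_mesh T M (t M)"
    and step: "\<And>M j. M \<ge> 1 \<Longrightarrow> j \<in> {1..M} \<Longrightarrow> lam0 * (t M j - t M (j - 1)) powr \<alpha> < 1 / Gamma (2 - \<alpha>)"
    and barrier: "\<And>M. M \<ge> 1 \<Longrightarrow> \<exists>W. W 0 = 0 \<and> (\<forall>m\<in>{1..M}. W m \<le> C * E M m \<and>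
        R (t M 1) (t M m) \<le> L1_op \<alpha> (t M) W m - lam0 * W m - lam1 * W (m - 1))"
    and trunc: "\<And>M m. M \<ge> 1 \<Longrightarrow> m \<in> {1..M} \<Longrightarrow>
        set_integrable lborel {0..t M m} (\<lambda>s. (t M m - s) powr (- \<alpha>) * time_deriv T u s) \<Longrightarrow>
        \<bar>L1_op \<alpha> (t M) (\<lambda>j. u (t M j)) m - caputo \<alpha> T u (t M m)\<bar> +
          L * \<bar>u (t M m) - u (t M (m - 1))\<bar> powr q \<le> R (t M 1) (t M m)"
    and sol: "ivp_solution \<alpha> T f g u0 u" and A1: "consistent (u ` {0..T}) q L f F"
    and A2: "one_sided_Lipschitz (u ` {0..T}) lam0 lam1 F"
    and M: "M \<ge> 1"
  shows "\<exists>!U. U \<in> extensional {0..M} \<and> L1_scheme \<alpha> M (t M) F g u0 U"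
    and "L1_scheme \<alpha> M (t M) F g u0 U \<Longrightarrow> m \<in> {1..M} \<Longrightarrow> \<bar>u (t M m) - U m\<bar> \<le> C * E M m"
proof -
  note me = mesh[OF M]
  have F_cont: "continuous_on UNIV (\<lambda>v. F v w)" for w
  proof -
    have "continuous_on UNIV (\<lambda>(v, w). F v w)" using A2 by (simp add: one_sided_Lipschitz_def)
    then have "continuous_on UNIV (\<lambda>v. (\<lambda>(v, w). F v w) (v, w))"
      by (rule continuous_on_compose2) (auto intro!: continuous_intros)
    then show ?thesis by simp
  qed
  have F_mono: "F (v + d) w - F v w \<ge> - lam0 * d" if "d \<ge> 0" for v w d
    using A2 that by (simp add: one_sided_Lipschitz_def)
  show "\<exists>!U. U \<in> extensional {0..M} \<and> L1_scheme \<alpha> M (t M) F g u0 U"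
    unfolding L1_scheme_def by (rule L1_scheme_ex1[OF \<alpha> me step[OF M] F_cont F_mono])
  assume U: "L1_scheme \<alpha> M (t M) F g u0 U" and m: "m \<in> {1..M}"
  obtain W where W: "W 0 = 0" "\<And>m. m \<in> {1..M} \<Longrightarrow> W m \<le> C * E M m"
    "\<And>m. m \<in> {1..M} \<Longrightarrow> R (t M 1) (t M m) \<le> L1_op \<alpha> (t M) W m - lam0 * W m - lam1 * W (m - 1)"
    using barrier[OF M] by blast
  have "\<bar>u (t M m) - U m\<bar> \<le> W m"
  proof (rule L1_comparison[OF \<alpha> me l1 step[OF M]])
    show "\<bar>u (t M 0) - U 0\<bar> \<le> W 0"
      using U W(1) sol me by (simp add: L1_scheme_def ivp_solution_def)
    show "m \<le> M" using m by simp
    fix k assume k: "k \<in> {1..M}"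
    have tk: "t M k \<in> {0<..T}" "t M k \<in> {0..T}" "t M (k - 1) \<in> {0..T}"
      using mesh_pos[OF me, of k] mesh_le_T[OF me, of k] mesh_nonneg[OF me, of "k - 1"] mesh_le_T[OF me, of "k - 1"] k
      by auto
    have si: "set_integrable lborel {0..t M k} (\<lambda>s. (t M k - s) powr (- \<alpha>) * time_deriv T u s)"
      and eq: "caputo \<alpha> T u (t M k) + f (u (t M k)) = g (t M k)"
      using sol tk by (auto simp: ivp_solution_def)
    have cons: "\<bar>F (u (t M k)) (u (t M (k - 1))) - f (u (t M k))\<bar> \<le> L * \<bar>u (t M k) - u (t M (k - 1))\<bar> powr q"
      using A1 tk by (simp add: consistent_def)
    have "\<bar>F (u (t M k)) (u (t M (k - 1)) + (U (k - 1) - u (t M (k - 1)))) - F (u (t M k)) (u (t M (k - 1)))\<bar> \<le>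
        lam1 * \<bar>U (k - 1) - u (t M (k - 1))\<bar>"
      using A2 tk unfolding one_sided_Lipschitz_def by blast
    then have lip: "\<bar>F (u (t M k)) (U (k - 1)) - F (u (t M k)) (u (t M (k - 1)))\<bar> \<le> lam1 * \<bar>u (t M (k - 1)) - U (k - 1)\<bar>"
      by (simp add: abs_minus_commute)
    have scheme: "L1_op \<alpha> (t M) U k + F (U k) (U (k - 1)) = g (t M k)"
      using U k by (simp add: L1_scheme_def)
    have "L1_op \<alpha> (t M) (\<lambda>j. \<bar>u (t M j) - U j\<bar>) k - lam0 * \<bar>u (t M k) - U k\<bar> - lam1 * \<bar>u (t M (k - 1)) - U (k - 1)\<bar>
      \<le> \<bar>L1_op \<alpha> (t M) (\<lambda>j. u (t M j)) k - caputo \<alpha> T u (t M k)\<bar> + L * \<bar>u (t M k) - u (t M (k - 1))\<bar> powr q"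
      by (rule L1_error_le[OF \<alpha> me _ order_refl cons eq scheme F_mono lip]) (use k in auto)
    also have "\<dots> \<le> R (t M 1) (t M k)" by (rule trunc[OF M k si])
    also note W(3)[OF k]
    finally show "L1_op \<alpha> (t M) (\<lambda>j. \<bar>u (t M j) - U j\<bar>) k - lam0 * \<bar>u (t M k) - U k\<bar> - lam1 * \<bar>u (t M (k - 1)) - U (k - 1)\<bar>
      \<le> L1_op \<alpha> (t M) W k - lam0 * W k - lam1 * W (k - 1)" .
  qed
  then show "\<bar>u (t M m) - U m\<bar> \<le> C * E M m" using W(2)[OF m] by simp
qed

text \<open>This is \<open>err_bound\<close> with the first node in place of
  \<open>M powr (- r)\<close>. In the critical case \<open>\<tau> powr \<nu>\<close> corresponds to
  \<open>M powr (- (2 - \<alpha>))\<close>, because \<open>\<nu> * r = 2 - \<alpha>\<close>.\<close>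

definition error_profile :: "real \<Rightarrow> real \<Rightarrow> real \<Rightarrow> real \<Rightarrow> real \<Rightarrow> real" where
  "error_profile \<alpha> \<sigma> r \<tau> s =
     (let \<nu> = 1 + \<sigma> - \<alpha> in
      if r < (2 - \<alpha>) / \<nu> then \<tau> powr \<nu> * s powr (\<alpha> - 1)
      else if r = (2 - \<alpha>) / \<nu> then \<tau> powr \<nu> * ((1 + ln (s / \<tau>)) * s powr (\<alpha> - 1))
      else \<tau> powr ((2 - \<alpha>) / r) * s powr (\<sigma> - (2 - \<alpha>) / r))"

lemma error_profile_nonneg: "0 < \<tau> \<Longrightarrow> \<tau> \<le> s \<Longrightarrow> 0 \<le> error_profile \<alpha> \<sigma> r \<tau> s"
  by (auto simp: error_profile_def Let_def intro!: mult_nonneg_nonneg add_nonneg_nonneg)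

text \<open>Factoring out \<open>\<tau> powr \<nu>\<close> leaves
  \<open>(\<tau> / s) powr \<alpha> / s\<close> and \<open>(\<tau> / s) powr \<gamma> / s\<close>
  with \<open>\<gamma> = (2 - \<alpha>) / r - \<nu>\<close>. The sign of \<open>\<gamma>\<close> is
  that of \<open>(2 - \<alpha>) / \<nu> - r\<close>, so the three regimes are decay, constancy and
  growth of the second source relative to \<open>1 / s\<close>.\<close>

lemma L1_stable_truncation:
  fixes \<alpha> c r T l0 l1 \<sigma> :: real
  assumes std: "0 < \<alpha>" "\<alpha> < 1" "r \<ge> 1" "c > 0" "T > 0" "l0 \<ge> 0" "l1 \<ge> 0" and \<sigma>: "\<sigma> > 0"
  shows "L1_stable \<alpha> c r T l0 l1
     (\<lambda>\<tau> s. \<tau> powr (\<sigma> + 1) * s powr (- \<alpha> - 1) + \<tau> powr ((2 - \<alpha>) / r) * s powr (\<sigma> - \<alpha> - (2 - \<alpha>) / r))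
     (error_profile \<alpha> \<sigma> r)"
proof -
  define \<nu> where "\<nu> = 1 + \<sigma> - \<alpha>"
  define \<gamma> where "\<gamma> = (2 - \<alpha>) / r - \<nu>"
  have \<nu>: "\<nu> > 0" using std \<sigma> by (simp add: \<nu>_def)
  define R where "R \<tau> s = \<tau> powr (\<sigma> + 1) * s powr (- \<alpha> - 1) + \<tau> powr ((2 - \<alpha>) / r) * s powr (\<sigma> - \<alpha> - (2 - \<alpha>) / r)" for \<tau> s
  have R: "R \<tau> s = \<tau> powr \<nu> * ((\<tau> / s) powr \<alpha> / s + (\<tau> / s) powr \<gamma> / s)" if "0 < \<tau>" "\<tau> \<le> s" for \<tau> s
  proof -
    have aux: "\<tau> powr \<nu> * ((\<tau> / s) powr a / s) = \<tau> powr (\<nu> + a) * s powr (- a - 1)" for a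
    proof -
      have "s powr (- a - 1) = 1 / s powr a / s" using that by (simp add: powr_diff powr_minus_divide)
      then show ?thesis using that by (simp add: powr_divide powr_add)
    qed
    have eqs: "\<nu> + \<alpha> = \<sigma> + 1" "\<nu> + \<gamma> = (2 - \<alpha>) / r" "- \<gamma> - 1 = \<sigma> - \<alpha> - (2 - \<alpha>) / r"
      by (simp_all add: \<nu>_def \<gamma>_def)
    show ?thesis unfolding distrib_left aux R_def eqs ..
  qed
  have "L1_stable \<alpha> c r T l0 l1 R (error_profile \<alpha> \<sigma> r)"
  proof (cases "\<gamma> > 0")
    case True
    then have "r < (2 - \<alpha>) / \<nu>" using \<nu> std by (simp add: \<gamma>_def field_simps)
    then have ep: "error_profile \<alpha> \<sigma> r = (\<lambda>\<tau> s. \<tau> powr \<nu> * s powr (\<alpha> - 1))"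
      by (intro ext) (simp add: error_profile_def \<nu>_def)
    have "L1_stable \<alpha> c r T l0 l1 (\<lambda>\<tau> s. \<tau> powr \<nu> * ((\<tau> / s) powr \<alpha> / s + (\<tau> / s) powr \<gamma> / s))
       (\<lambda>\<tau> s. \<tau> powr \<nu> * (s powr (\<alpha> - 1) + s powr (\<alpha> - 1)))"
      by (intro L1_stable_scale L1_stable_add L1_stable_decaying std True) auto
    then show ?thesis
      by (rule L1_stable_cong[of _ _ _ _ _ _ _ _ 1 2]) (auto simp: ep R)
  next
    case False
    \<comment> \<open>Since \<open>\<tau> / s \<le> 1\<close> and
      \<open>\<gamma> \<le> 0 < \<alpha>\<close>, the source with exponent \<open>\<gamma>\<close>
      dominates the other one.\<close>
    have le: "R \<tau> s \<le> 2 * (\<tau> powr \<nu> * ((\<tau> / s) powr \<gamma> / s))" if "0 < \<tau>" "\<tau> \<le> s" for \<tau> s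
    proof -
      have "(\<tau> / s) powr \<alpha> \<le> (\<tau> / s) powr \<gamma>" using that False std by (intro powr_mono') auto
      then have "\<tau> powr \<nu> * ((\<tau> / s) powr \<alpha> / s + (\<tau> / s) powr \<gamma> / s) \<le>
          \<tau> powr \<nu> * ((\<tau> / s) powr \<gamma> / s + (\<tau> / s) powr \<gamma> / s)"
        using that by (intro mult_left_mono add_mono divide_right_mono) auto
      then show ?thesis using R[OF that] by simp
    qed
    show ?thesis
    proof (cases "\<gamma> = 0")
      case True
      then have "r = (2 - \<alpha>) / \<nu>" using \<nu> std by (simp add: \<gamma>_def field_simps)
      then have ep: "error_profile \<alpha> \<sigma> r = (\<lambda>\<tau> s. \<tau> powr \<nu> * ((1 + ln (s / \<tau>)) * s powr (\<alpha> - 1)))"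
        by (intro ext) (simp add: error_profile_def \<nu>_def)
      have "L1_stable \<alpha> c r T l0 l1 (\<lambda>\<tau> s. \<tau> powr \<nu> * (1 / s))
         (\<lambda>\<tau> s. \<tau> powr \<nu> * ((1 + ln (s / \<tau>)) * s powr (\<alpha> - 1)))"
        by (intro L1_stable_scale L1_stable_critical std) auto
      then show ?thesis
        unfolding ep by (rule L1_stable_cong[of _ _ _ _ _ _ _ _ 2 1]) (use le True in auto)
    next
      case \<gamma>0: False
      then have neg: "- \<gamma> > 0" using False by simp
      then have "r > (2 - \<alpha>) / \<nu>" using \<nu> std by (simp add: \<gamma>_def field_simps)
      then have ep: "error_profile \<alpha> \<sigma> r = (\<lambda>\<tau> s. \<tau> powr ((2 - \<alpha>) / r) * s powr (\<sigma> - (2 - \<alpha>) / r))"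
        by (intro ext) (simp add: error_profile_def \<nu>_def)
      have "L1_stable \<alpha> c r T l0 l1 (\<lambda>\<tau> s. \<tau> powr ((2 - \<alpha>) / r) * s powr (- \<gamma> - 1))
         (\<lambda>\<tau> s. \<tau> powr ((2 - \<alpha>) / r) * s powr (- \<gamma> + \<alpha> - 1))"
        by (intro L1_stable_scale L1_stable_power std neg) auto
      moreover have "- \<gamma> + \<alpha> - 1 = \<sigma> - (2 - \<alpha>) / r" by (simp add: \<gamma>_def \<nu>_def)
      ultimately have st: "L1_stable \<alpha> c r T l0 l1 (\<lambda>\<tau> s. \<tau> powr ((2 - \<alpha>) / r) * s powr (- \<gamma> - 1)) (error_profile \<alpha> \<sigma> r)"
        by (simp add: ep)
      show ?thesis
      proof (rule L1_stable_cong[OF st, of 2 1])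
        fix \<tau> s :: real assume ts: "0 < \<tau>" "\<tau> \<le> s"
        have "\<tau> powr \<nu> * ((\<tau> / s) powr \<gamma> / s) = \<tau> powr (\<nu> + \<gamma>) * (1 / s powr \<gamma> / s)"
          using ts by (simp add: powr_divide powr_add)
        also have "1 / s powr \<gamma> / s = s powr (- \<gamma> - 1)" using ts by (simp add: powr_diff powr_minus_divide)
        also have "\<nu> + \<gamma> = (2 - \<alpha>) / r" by (simp add: \<gamma>_def)
        finally show "R \<tau> s \<le> 2 * (\<tau> powr ((2 - \<alpha>) / r) * s powr (- \<gamma> - 1))" using le[OF ts] by simp
      qed auto
    qed
  qed
  then show ?thesis by (simp add: R_def[abs_def])
qed

lemma error_profile_le:
  fixes \<alpha> \<sigma> r c2 :: real
  assumes "0 < \<alpha>" "\<alpha> < 1" "\<sigma> > 0" "r \<ge> 1" and c2: "c2 > 0"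
  shows "\<exists>C>0. \<forall>M t m. 1 \<le> M \<longrightarrow> 0 < t 1 \<longrightarrow> t 1 \<le> t m \<longrightarrow> t 1 \<le> c2 * real M powr (- r) \<longrightarrow>
     error_profile \<alpha> \<sigma> r (t 1) (t m) \<le> C * err_bound \<alpha> \<sigma> r M t m"
proof -
  define \<nu> where "\<nu> = 1 + \<sigma> - \<alpha>"
  have \<nu>: "\<nu> > 0" using assms by (simp add: \<nu>_def)
  show ?thesis
  proof (intro exI[of _ "c2 powr \<nu> + c2 powr ((2 - \<alpha>) / r)"] conjI allI impI)
    show "c2 powr \<nu> + c2 powr ((2 - \<alpha>) / r) > 0" using c2 by (intro add_pos_pos) auto
    fix M :: nat and t :: "nat \<Rightarrow> real" and m
    assume M: "1 \<le> M" and t: "0 < t 1" "t 1 \<le> t m" "t 1 \<le> c2 * real M powr (- r)"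
    have pw: "t 1 powr x \<le> c2 powr x * real M powr (- (x * r))" if "x \<ge> 0" for x
    proof -
      have "t 1 powr x \<le> (c2 * real M powr (- r)) powr x" using t that by (intro powr_mono2) auto
      also have "\<dots> = c2 powr x * real M powr (- (x * r))"
        using c2 by (simp add: powr_mult powr_powr mult.commute)
      finally show ?thesis .
    qed
    have up: "t 1 powr x * y \<le> (c2 powr \<nu> + c2 powr ((2 - \<alpha>) / r)) * (real M powr (- (x * r)) * y)"
      if "x = \<nu> \<or> x = (2 - \<alpha>) / r" "y \<ge> 0" for x y
    proof -
      have "x \<ge> 0" using that \<nu> assms by auto
      then have "t 1 powr x * y \<le> c2 powr x * real M powr (- (x * r)) * y"
        using pw that by (intro mult_right_mono) auto
      also have "\<dots> \<le> (c2 powr \<nu> + c2 powr ((2 - \<alpha>) / r)) * real M powr (- (x * r)) * y"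
        using that by (intro mult_right_mono) auto
      finally show ?thesis by (simp add: mult.assoc)
    qed
    have ln0: "1 + ln (t m / t 1) \<ge> 0" using t by (intro add_nonneg_nonneg) auto
    consider "r < (2 - \<alpha>) / \<nu>" | "r = (2 - \<alpha>) / \<nu>" | "r > (2 - \<alpha>) / \<nu>" by linarith
    then show "error_profile \<alpha> \<sigma> r (t 1) (t m) \<le> (c2 powr \<nu> + c2 powr ((2 - \<alpha>) / r)) * err_bound \<alpha> \<sigma> r M t m"
    proof cases
      case 1
      then show ?thesis using up[of \<nu> "t m powr (\<alpha> - 1)"]
        by (simp add: error_profile_def err_bound_def Let_def \<nu>_def[symmetric])
    next
      case 2
      then have "\<nu> * r = 2 - \<alpha>" using \<nu> by (simp add: field_simps)
      then show ?thesis using up[of \<nu> "(1 + ln (t m / t 1)) * t m powr (\<alpha> - 1)"] ln0 2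
        by (simp add: error_profile_def err_bound_def Let_def \<nu>_def[symmetric] mult_ac)
    next
      case 3
      moreover have "(2 - \<alpha>) / r * r = 2 - \<alpha>" using assms by simp
      ultimately show ?thesis using up[of "(2 - \<alpha>) / r" "t m powr (\<sigma> - (2 - \<alpha>) / r)"]
        by (simp add: error_profile_def err_bound_def Let_def \<nu>_def[symmetric])
    qed
  qed
qed

lemma err_bound_pos:
  assumes "M \<ge> 1" "0 < t 1" "t 1 \<le> t m"
  shows "0 < err_bound \<alpha> \<sigma> r M t m" "0 < err_bound_q1 \<alpha> \<sigma> r M t m"
proof -
  have "0 < 1 + ln (t m / t 1)" using assms by (intro add_pos_nonneg) auto
  then show "0 < err_bound \<alpha> \<sigma> r M t m" using assms by (simp add: err_bound_def Let_def)
  then show "0 < err_bound_q1 \<alpha> \<sigma> r M t m" unfolding err_bound_q1_def by (intro add_pos_nonneg) auto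
qed

theorem theorem3p5:
  fixes \<alpha> T \<sigma> r lam0 lam1 L u0 :: real
    and u :: "real \<Rightarrow> real" and t :: "nat \<Rightarrow> nat \<Rightarrow> real"
  assumes "0 < \<alpha>" "\<alpha> < 1" and "T > 0" and "\<sigma> \<in> {0<..<1} \<union> {1<..<2}"
    and "lam0 \<ge> 0" "lam1 \<ge> 0" and "L > 0" and "r \<ge> 1"
    and "\<exists>C\<^sub>u. \<forall>l\<le>2. \<forall>s\<in>{0<..T}. \<bar>(time_deriv T ^^ l) u s\<bar> \<le> C\<^sub>u * (1 + s powr (\<sigma> - real l))"
    and "\<And>M. M \<ge> 1 \<Longrightarrow> temporal_mesh T M (t M)"
    and "quasi_graded r t"
    and "\<And>M j. M \<ge> 1 \<Longrightarrow> j \<in> {1..M} \<Longrightarrow> lam0 * (t M j - t M (j - 1)) powr \<alpha> < 1 / Gamma (2 - \<alpha>)"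
  shows
    "(\<exists>C. \<forall>f g F.
        unique_ivp_solution \<alpha> T f g u0 u \<and>
        consistent (u ` {0..T}) 2 L f F \<and> one_sided_Lipschitz (u ` {0..T}) lam0 lam1 F \<longrightarrow>
        (\<forall>M\<ge>1.
           (\<exists>!U. U \<in> extensional {0..M} \<and> L1_scheme \<alpha> M (t M) F g u0 U) \<and>
           (\<forall>U. L1_scheme \<alpha> M (t M) F g u0 U \<longrightarrow>
              (\<forall>m\<in>{1..M}. \<bar>u (t M m) - U m\<bar> \<le> C * err_bound \<alpha> \<sigma> r M (t M) m)))) \<and>
     (\<exists>C. \<forall>f g F.
        unique_ivp_solution \<alpha> T f g u0 u \<and>
        consistent (u ` {0..T}) 1 L f F \<and> one_sided_Lipschitz (u ` {0..T}) lam0 lam1 F \<longrightarrow>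
        (\<forall>M\<ge>1.
           (\<exists>!U. U \<in> extensional {0..M} \<and> L1_scheme \<alpha> M (t M) F g u0 U) \<and>
           (\<forall>U. L1_scheme \<alpha> M (t M) F g u0 U \<longrightarrow>
              (\<forall>m\<in>{1..M}. \<bar>u (t M m) - U m\<bar> \<le> C * err_bound_q1 \<alpha> \<sigma> r M (t M) m))))"
\<comment> \<open>The constants must not depend on \<open>f\<close>, \<open>g\<close> and
  \<open>F\<close>, yet continuity and differentiability of \<open>u\<close> come from its being a
  solution. One pair \<open>f\<close>, \<open>g\<close> supplies them; if there is none, both claims
  are vacuous.\<close>
proof (cases "\<exists>f g. ivp_solution \<alpha> T f g u0 u")
  case False
  then show ?thesis by (auto simp: unique_ivp_solution_def)
next
  case True
  note \<alpha> = assms(1,2) and r = assms(8) and mesh = assms(10) and step = assms(12)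
  have \<sigma>: "0 < \<sigma>" "\<sigma> < 2" "\<sigma> \<noteq> 1" using assms(4) by auto
  define h where "h = min \<sigma> 1"
  have h: "0 < h" "h \<le> 1" "\<sigma> \<le> 2 * h" using \<sigma> by (auto simp: h_def min_def)
  obtain Cu where Cu: "\<forall>l\<le>2. \<forall>s\<in>{0<..T}. \<bar>(time_deriv T ^^ l) u s\<bar> \<le> Cu * (1 + s powr (\<sigma> - real l))"
    using assms(9) by blast
  obtain A where A: "A > 0" and ws: "weakly_singular T \<sigma> A u (time_deriv T u) (time_deriv T (time_deriv T u))"
    using weakly_singularI[OF assms(3) \<sigma>(2) _ _ Cu] True by (auto simp: ivp_solution_def)
  obtain c2 c where c2: "c2 > 0" and c: "c > 0" and first: "\<And>M. M \<ge> 1 \<Longrightarrow> t M 1 \<le> c2 * real M powr (- r)"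
    and steps: "\<And>M j. M \<ge> 1 \<Longrightarrow> j \<in> {1..M} \<Longrightarrow>
        t M j - t M (j - 1) \<le> c * t M 1 powr (1 / r) * t M j powr (1 - 1 / r)"
    using assms(11) unfolding quasi_graded_def by blast
  have graded: "graded_mesh c r T M (t M)" if "M \<ge> 1" for M
    using mesh[OF that] steps[OF that] that by (simp add: graded_mesh_def)
  have small: "\<exists>N. \<forall>M>N. t M 1 \<le> \<delta>" if "\<delta> > 0" for \<delta>
  proof -
    obtain N :: nat where N: "c2 / \<delta> < real N" using reals_Archimedean2 by blast
    have "t M 1 \<le> \<delta>" if "M > N" for M
    proof -
      have M: "real M \<ge> 1" "c2 / \<delta> \<le> real M" using that N by linarith+
      have "real M powr 1 \<le> real M powr r" using M r by (intro powr_mono) auto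
      then have "c2 / \<delta> \<le> real M powr r" using M by simp
      then have "c2 * real M powr (- r) \<le> \<delta>"
        using \<open>\<delta> > 0\<close> M by (simp add: powr_minus_divide field_simps)
      then show ?thesis using first[of M] M by simp
    qed
    then show ?thesis by blast
  qed
  define R0 where "R0 \<tau> s = \<tau> powr (\<sigma> + 1) * s powr (- \<alpha> - 1) +
      \<tau> powr ((2 - \<alpha>) / r) * s powr (\<sigma> - \<alpha> - (2 - \<alpha>) / r)" for \<tau> s
  obtain C1 where C1: "C1 > 0" and trunc: "\<And>M t m. graded_mesh c r T M t \<Longrightarrow> m \<in> {1..M} \<Longrightarrow>
     set_integrable lborel {0..t m} (\<lambda>s. (t m - s) powr (- \<alpha>) * time_deriv T u s) \<Longrightarrow>
     \<bar>L1_op \<alpha> t (\<lambda>j. u (t j)) m - caputo \<alpha> T u (t m)\<bar> \<le> C1 * R0 (t 1) (t m)"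
    using L1_truncation_error[OF \<alpha> r c \<sigma> A ws] unfolding R0_def by blast
  obtain C2 where C2: "C2 > 0" and incr: "\<And>M t m. graded_mesh c r T M t \<Longrightarrow> m \<in> {1..M} \<Longrightarrow>
     \<bar>u (t m) - u (t (m - 1))\<bar> \<le> C2 * (t 1 powr (1 / r) * t m powr (h - 1 / r))"
    using weakly_singular_increment[OF r c \<sigma>(1) A ws] unfolding h_def by blast
  obtain C3 where C3: "C3 > 0" and profile: "\<And>M t m. 1 \<le> M \<Longrightarrow> 0 < t 1 \<Longrightarrow> t 1 \<le> t m \<Longrightarrow>
     t 1 \<le> c2 * real M powr (- r) \<Longrightarrow> error_profile \<alpha> \<sigma> r (t 1) (t m) \<le> C3 * err_bound \<alpha> \<sigma> r M t m"
    using error_profile_le[OF \<alpha> \<sigma>(1) r c2] by blast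
  have stable0: "L1_stable \<alpha> c r T lam0 lam1 R0 (error_profile \<alpha> \<sigma> r)"
    using L1_stable_truncation[OF \<alpha> r c assms(3,5,6) \<sigma>(1)] by (simp add: R0_def[abs_def])
  note node = graded_mesh_node[OF graded]
  \<comment> \<open>Both claims share this argument, with the constant fixed before
    \<open>f\<close>, \<open>g\<close> and \<open>F\<close>; they differ in \<open>q\<close>, the
    right-hand side \<open>R\<close>, the profile \<open>w\<close> and the bound
    \<open>E\<close>.\<close>
  have bound: "\<exists>C. \<forall>f g F. unique_ivp_solution \<alpha> T f g u0 u \<and>
        consistent (u ` {0..T}) q L f F \<and> one_sided_Lipschitz (u ` {0..T}) lam0 lam1 F \<longrightarrow>
        (\<forall>M\<ge>1.
           (\<exists>!U. U \<in> extensional {0..M} \<and> L1_scheme \<alpha> M (t M) F g u0 U) \<and>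
           (\<forall>U. L1_scheme \<alpha> M (t M) F g u0 U \<longrightarrow>
              (\<forall>m\<in>{1..M}. \<bar>u (t M m) - U m\<bar> \<le> C * E M m)))"
    if stable: "L1_stable \<alpha> c r T lam0 lam1 R w"
      and E: "\<And>M m. M \<ge> 1 \<Longrightarrow> m \<in> {1..M} \<Longrightarrow> 0 < E M m"
      and w: "\<And>M m. M \<ge> 1 \<Longrightarrow> m \<in> {1..M} \<Longrightarrow> w (t M 1) (t M m) \<le> C' * E M m" and C': "C' \<ge> 0"
      and R: "\<And>M m. M \<ge> 1 \<Longrightarrow> m \<in> {1..M} \<Longrightarrow>
          C1 * R0 (t M 1) (t M m) + L * \<bar>u (t M m) - u (t M (m - 1))\<bar> powr q \<le> R (t M 1) (t M m)"
    for R w E C' q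
  proof -
    obtain C where C: "\<And>M. M \<ge> 1 \<Longrightarrow> \<exists>W. W 0 = 0 \<and> (\<forall>m\<in>{1..M}. W m \<le> C * E M m \<and>
        R (t M 1) (t M m) \<le> L1_op \<alpha> (t M) W m - lam0 * W m - lam1 * W (m - 1))"
      using L1_barrier_all_meshes[OF \<alpha> stable graded small step E w C'] by blast
    have tr: "\<bar>L1_op \<alpha> (t M) (\<lambda>j. u (t M j)) m - caputo \<alpha> T u (t M m)\<bar> +
          L * \<bar>u (t M m) - u (t M (m - 1))\<bar> powr q \<le> R (t M 1) (t M m)"
      if "M \<ge> 1" "m \<in> {1..M}" "set_integrable lborel {0..t M m} (\<lambda>s. (t M m - s) powr (- \<alpha>) * time_deriv T u s)"
      for M m
      using trunc[OF graded[OF that(1)] that(2,3)] R[OF that(1,2)] by linarith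
    show ?thesis
    proof (intro exI[of _ C] allI impI)
      fix f g F and M :: nat
      assume *: "unique_ivp_solution \<alpha> T f g u0 u \<and>
        consistent (u ` {0..T}) q L f F \<and> one_sided_Lipschitz (u ` {0..T}) lam0 lam1 F" and M: "M \<ge> 1"
      then have sol: "ivp_solution \<alpha> T f g u0 u" and A1: "consistent (u ` {0..T}) q L f F"
        and A2: "one_sided_Lipschitz (u ` {0..T}) lam0 lam1 F" by (auto simp: unique_ivp_solution_def)
      note err = L1_scheme_error_bound[OF \<alpha> assms(6) mesh step C tr sol A1 A2 M]
      show "(\<exists>!U. U \<in> extensional {0..M} \<and> L1_scheme \<alpha> M (t M) F g u0 U) \<and>
           (\<forall>U. L1_scheme \<alpha> M (t M) F g u0 U \<longrightarrow>
              (\<forall>m\<in>{1..M}. \<bar>u (t M m) - U m\<bar> \<le> C * E M m))"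
        using err by blast
    qed
  qed
  show ?thesis
  proof (rule conjI, goal_cases)
    case 1
    \<comment> \<open>The squared increment is at most a multiple of
      \<open>(\<tau> / s) powr (2 / r) * s powr (2 * h)\<close>. As
      \<open>\<tau> / s \<le> 1\<close> and \<open>\<sigma> - \<alpha> < 2 * h\<close>, the second
      term of \<open>R0\<close> absorbs it, and the surplus power of \<open>s\<close> becomes a
      power of \<open>T\<close>.\<close>
    define C4 where "C4 = C1 + L * C2\<^sup>2 * T powr (2 * h - \<sigma> + \<alpha>)"
    have C4: "C4 > 0" unfolding C4_def using C1 assms(7) by (intro add_pos_nonneg) auto
    show ?case
    proof (rule bound)
      show "L1_stable \<alpha> c r T lam0 lam1 (\<lambda>\<tau> s. C4 * R0 \<tau> s) (error_profile \<alpha> \<sigma> r)"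
        by (rule L1_stable_cong[OF stable0, of C4 1]) (use C4 in auto)
      fix M :: nat and m assume M: "M \<ge> 1" and m: "m \<in> {1..M}"
      note n = node[OF M m]
      show "0 < err_bound \<alpha> \<sigma> r M (t M) m" using err_bound_pos M n by blast
      show "error_profile \<alpha> \<sigma> r (t M 1) (t M m) \<le> C3 * err_bound \<alpha> \<sigma> r M (t M) m"
        by (rule profile[OF M n(1,2) first[OF M]])
      define \<tau> s where "\<tau> = t M 1" and "s = t M m"
      have ts: "0 < \<tau>" "\<tau> \<le> s" "s \<le> T" "0 < s" using n by (auto simp: \<tau>_def s_def)
      have "\<bar>u s - u (t M (m - 1))\<bar> powr 2 \<le> (C2 * (\<tau> powr (1 / r) * s powr (h - 1 / r))) powr 2"
        using incr[OF graded[OF M] m] by (intro powr_mono2) (auto simp: \<tau>_def s_def)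
      also have "\<dots> = C2\<^sup>2 * (\<tau> powr (2 / r) * s powr (2 * h - 2 / r))"
        using C2 ts by (simp add: powr_mult powr_powr left_diff_distrib mult.commute)
      also have "\<tau> powr (2 / r) * s powr (2 * h - 2 / r) = (\<tau> / s) powr (2 / r) * s powr (2 * h)"
        by (simp add: powr_divide powr_diff)
      also have "C2\<^sup>2 * ((\<tau> / s) powr (2 / r) * s powr (2 * h)) \<le> C2\<^sup>2 * ((\<tau> / s) powr ((2 - \<alpha>) / r) * (s powr (\<sigma> - \<alpha>) * T powr (2 * h - \<sigma> + \<alpha>)))"
      proof (intro mult_left_mono mult_mono)
        show "(\<tau> / s) powr (2 / r) \<le> (\<tau> / s) powr ((2 - \<alpha>) / r)"
          using ts r \<alpha> by (intro powr_mono') (auto simp: divide_right_mono)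
        have "s powr (2 * h) = s powr (\<sigma> - \<alpha>) * s powr (2 * h - \<sigma> + \<alpha>)" by (simp flip: powr_add)
        also have "\<dots> \<le> s powr (\<sigma> - \<alpha>) * T powr (2 * h - \<sigma> + \<alpha>)"
          using ts h \<alpha> by (intro mult_left_mono powr_mono2) auto
        finally show "s powr (2 * h) \<le> s powr (\<sigma> - \<alpha>) * T powr (2 * h - \<sigma> + \<alpha>)" .
      qed auto
      also have "\<dots> = C2\<^sup>2 * T powr (2 * h - \<sigma> + \<alpha>) * (\<tau> powr ((2 - \<alpha>) / r) * s powr (\<sigma> - \<alpha> - (2 - \<alpha>) / r))"
        by (simp add: powr_divide powr_diff mult_ac)
      also have "\<dots> \<le> C2\<^sup>2 * T powr (2 * h - \<sigma> + \<alpha>) * R0 \<tau> s"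
        by (intro mult_left_mono) (auto simp: R0_def)
      finally have "L * \<bar>u s - u (t M (m - 1))\<bar> powr 2 \<le> L * (C2\<^sup>2 * T powr (2 * h - \<sigma> + \<alpha>) * R0 \<tau> s)"
        using assms(7) by (intro mult_left_mono) auto
      then show "C1 * R0 (t M 1) (t M m) + L * \<bar>u (t M m) - u (t M (m - 1))\<bar> powr 2 \<le> C4 * R0 (t M 1) (t M m)"
        by (simp add: C4_def distrib_right mult.assoc \<tau>_def s_def)
    qed (use C3 in simp)
  next
    case 2
    \<comment> \<open>For \<open>q = 1\<close> the increment is not absorbed but becomes a source of
      its own, a power of \<open>s\<close> scaled by \<open>\<tau> powr (1 / r)\<close>. The
      exponent is written as \<open>b - 1\<close> with \<open>b = h + 1 - 1 / r > 0\<close> to match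
      \<open>L1_stable_power\<close>.\<close>
    define R1 where "R1 \<tau> s = \<tau> powr (1 / r) * s powr ((h + 1 - 1 / r) - 1)" for \<tau> s
    define w1 where "w1 \<tau> s = \<tau> powr (1 / r) * s powr ((h + 1 - 1 / r) + \<alpha> - 1)" for \<tau> s
    define C4 where "C4 = C1 + L * C2"
    have C4: "C4 > 0" unfolding C4_def using C1 C2 assms(7) by (intro add_pos_pos) auto
    define C5 where "C5 = C3 + c2 powr (1 / r)"
    have "1 / r \<le> 1" using r by simp
    then have b: "h + 1 - 1 / r > 0" using h by linarith
    have stable1: "L1_stable \<alpha> c r T lam0 lam1 R1 w1"
      unfolding R1_def[abs_def] w1_def[abs_def]
      by (intro L1_stable_scale L1_stable_power \<alpha> r c assms(3,5,6) b) auto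
    have stable: "L1_stable \<alpha> c r T lam0 lam1 (\<lambda>\<tau> s. R0 \<tau> s + R1 \<tau> s) (\<lambda>\<tau> s. error_profile \<alpha> \<sigma> r \<tau> s + w1 \<tau> s)"
      by (rule L1_stable_add[OF stable0 stable1]) (auto simp: error_profile_nonneg w1_def)
    show ?case
    proof (rule bound)
      show "L1_stable \<alpha> c r T lam0 lam1 (\<lambda>\<tau> s. C4 * (R0 \<tau> s + R1 \<tau> s)) (\<lambda>\<tau> s. error_profile \<alpha> \<sigma> r \<tau> s + w1 \<tau> s)"
        by (rule L1_stable_cong[OF stable, of C4 1]) (use C4 in auto)
      fix M :: nat and m assume M: "M \<ge> 1" and m: "m \<in> {1..M}"
      note n = node[OF M m]
      show "0 < err_bound_q1 \<alpha> \<sigma> r M (t M) m" using err_bound_pos M n by blast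
      have "t M 1 powr (1 / r) \<le> (c2 * real M powr (- r)) powr (1 / r)"
        using n first[OF M] r by (intro powr_mono2) auto
      also have "\<dots> = c2 powr (1 / r) * real M powr (- 1)"
        using c2 r by (simp add: powr_mult powr_powr)
      finally have "t M 1 powr (1 / r) * t M m powr (h + \<alpha> - 1 / r) \<le>
          c2 powr (1 / r) * real M powr (- 1) * t M m powr (h + \<alpha> - 1 / r)"
        by (intro mult_right_mono) auto
      then have "w1 (t M 1) (t M m) \<le> c2 powr (1 / r) * (real M powr (- 1) * t M m powr (h + \<alpha> - 1 / r))"
        by (simp add: w1_def algebra_simps)
      moreover have "error_profile \<alpha> \<sigma> r (t M 1) (t M m) \<le> C3 * err_bound \<alpha> \<sigma> r M (t M) m"
        by (rule profile[OF M n(1,2) first[OF M]])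
      moreover have "0 \<le> C3 * (real M powr (- 1) * t M m powr (h + \<alpha> - 1 / r))"
        "0 \<le> c2 powr (1 / r) * err_bound \<alpha> \<sigma> r M (t M) m"
        using C3 err_bound_pos(1)[of M "t M" m \<alpha> \<sigma> r] M n by auto
      ultimately show "error_profile \<alpha> \<sigma> r (t M 1) (t M m) + w1 (t M 1) (t M m) \<le> C5 * err_bound_q1 \<alpha> \<sigma> r M (t M) m"
        unfolding C5_def err_bound_q1_def h_def[symmetric] distrib_left distrib_right by linarith
      have "\<bar>u (t M m) - u (t M (m - 1))\<bar> \<le> C2 * R1 (t M 1) (t M m)"
        using incr[OF graded[OF M] m] by (simp add: R1_def)
      then have "L * \<bar>u (t M m) - u (t M (m - 1))\<bar> \<le> L * (C2 * R1 (t M 1) (t M m))"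
        using assms(7) by (intro mult_left_mono) auto
      moreover have "0 \<le> C1 * R1 (t M 1) (t M m)" "0 \<le> L * C2 * R0 (t M 1) (t M m)"
        using C1 C2 assms(7) by (auto simp: R1_def R0_def)
      ultimately show "C1 * R0 (t M 1) (t M m) + L * \<bar>u (t M m) - u (t M (m - 1))\<bar> powr 1 \<le>
          C4 * (R0 (t M 1) (t M m) + R1 (t M 1) (t M m))"
        unfolding C4_def by (simp add: distrib_left distrib_right mult.assoc)
    qed (use C3 in \<open>simp add: C5_def\<close>)
  qed
qed

end
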